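(* Let $P$ be the $k$-dimensional torus $T^k$, $k\le n$. Then on the $n$-dimensional torus $T^n$ there exists an exact $P$-function with $n-k+1$ singularities (critical submanifolds). In particular, an exact round function on the $n$-dimensional torus has $n$ singularities.
   Context: **$P$-function.** Let $P$ be a fixed smooth manifold without boundary. A differentiable function on a manifold whose set of critical points is a disjoint union of smooth submanifolds without boundary is called a $P$-function if each of its critical submanifolds is homeomorphic to $P$. A $P$-function is called **round** if its critical submanifolds are homeomorphic to the circle $S^1$ (i.e. $P=S^1$). A $P$-function on a manifold is called **exact** if the number of its critical submanifolds equals the minimum, taken over all $P$-functions on the manifold, of the number of critical submanifolds. *)

theory Defs
  imports "HOL-Analysis.Analysis"
begin

text \<open>
  A smooth manifold without boundary is given by a dimension \<open>n :: nat\<close>, a topology \<open>X\<close> and an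
  atlas \<open>A\<close>, a set of charts \<open>(U, \<phi>)\<close>. The model space \<open>R^n\<close> is \<^term>\<open>Euclidean_space n\<close>, the
  sequences vanishing from index \<open>n\<close> on. Thus the dimension is an ordinary natural number,
  possibly 0.
\<close>

subsection \<open>Smooth functions on open subsets of \<open>R^n\<close>\<close>

text \<open>\<open>C_diff n r W f\<close>: on the open set \<open>W\<close> of \<open>R^n\<close>, all iterated partial derivatives of \<open>f\<close> of
  order at most \<open>r\<close> exist and are continuous.\<close>

primrec C_diff :: "nat \<Rightarrow> nat \<Rightarrow> (nat \<Rightarrow> real) set \<Rightarrow> ((nat \<Rightarrow> real) \<Rightarrow> real) \<Rightarrow> bool" where
  "C_diff n 0 W f \<longleftrightarrow> continuous_map (subtopology (Euclidean_space n) W) euclideanreal f"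
| "C_diff n (Suc r) W f \<longleftrightarrow>
     continuous_map (subtopology (Euclidean_space n) W) euclideanreal f \<and>
     (\<forall>i<n. \<exists>g. (\<forall>x\<in>W. ((\<lambda>t. f (x(i := t))) has_real_derivative g x) (at (x i))) \<and>
                 C_diff n r W g)"

definition C_infinity :: "nat \<Rightarrow> (nat \<Rightarrow> real) set \<Rightarrow> ((nat \<Rightarrow> real) \<Rightarrow> real) \<Rightarrow> bool" where
  "C_infinity n W f \<longleftrightarrow> (\<forall>r. C_diff n r W f)"

subsection \<open>Smooth manifolds and submanifolds\<close>

type_synonym 'a chart = "'a set \<times> ('a \<Rightarrow> nat \<Rightarrow> real)"

definition is_chart :: "nat \<Rightarrow> 'a topology \<Rightarrow> 'a chart \<Rightarrow> bool" where
  "is_chart n X = (\<lambda>(U, \<phi>).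
     openin X U \<and> openin (Euclidean_space n) (\<phi> ` U) \<and>
     homeomorphic_map (subtopology X U) (subtopology (Euclidean_space n) (\<phi> ` U)) \<phi>)"

definition smooth_transition :: "nat \<Rightarrow> 'a chart \<Rightarrow> 'a chart \<Rightarrow> bool" where
  "smooth_transition n = (\<lambda>(U, \<phi>) (V, \<psi>).
     \<forall>i<n. C_infinity n (\<phi> ` (U \<inter> V)) (\<lambda>x. \<psi> (inv_into U \<phi> x) i))"

definition smooth_manifold :: "nat \<Rightarrow> 'a topology \<Rightarrow> 'a chart set \<Rightarrow> bool" where
  "smooth_manifold n X A \<longleftrightarrow>
     Hausdorff_space X \<and> second_countable X \<and>
     (\<forall>c\<in>A. is_chart n X c) \<and> topspace X \<subseteq> (\<Union>(U, \<phi>)\<in>A. U) \<and>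
     (\<forall>c\<in>A. \<forall>c'\<in>A. smooth_transition n c c')"

definition maximal_atlas :: "nat \<Rightarrow> 'a topology \<Rightarrow> 'a chart set \<Rightarrow> 'a chart set" where
  "maximal_atlas n X A =
     {c. is_chart n X c \<and> (\<forall>c'\<in>A. smooth_transition n c c' \<and> smooth_transition n c' c)}"

text \<open>An embedded submanifold of dimension \<open>d\<close>, by slice charts: around each of its points some
  smooth chart identifies it with \<open>R^d \<subseteq> R^n\<close>.\<close>

definition smooth_submanifold ::
  "nat \<Rightarrow> 'a topology \<Rightarrow> 'a chart set \<Rightarrow> nat \<Rightarrow> 'a set \<Rightarrow> bool" where
  "smooth_submanifold n X A d S \<longleftrightarrow>
     d \<le> n \<and> S \<subseteq> topspace X \<and>
     (\<forall>p\<in>S. \<exists>(U, \<phi>)\<in>maximal_atlas n X A.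
        p \<in> U \<and> \<phi> ` (U \<inter> S) = \<phi> ` U \<inter> topspace (Euclidean_space d))"

definition smooth_function :: "nat \<Rightarrow> 'a chart set \<Rightarrow> ('a \<Rightarrow> real) \<Rightarrow> bool" where
  "smooth_function n A f \<longleftrightarrow> (\<forall>(U, \<phi>)\<in>A. C_infinity n (\<phi> ` U) (\<lambda>x. f (inv_into U \<phi> x)))"

definition critical_set :: "nat \<Rightarrow> 'a topology \<Rightarrow> 'a chart set \<Rightarrow> ('a \<Rightarrow> real) \<Rightarrow> 'a set" where
  "critical_set n X A f =
     {p \<in> topspace X. \<forall>(U, \<phi>)\<in>A. p \<in> U \<longrightarrow>
        (\<forall>i<n. ((\<lambda>t. f (inv_into U \<phi> ((\<phi> p)(i := t)))) has_real_derivative 0) (at (\<phi> p i)))}"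

subsection \<open>\<open>P\<close>-functions\<close>

text \<open>
  \<open>\<S>\<close> presents the critical set as a disjoint union of submanifolds homeomorphic to \<open>P\<close>. The
  disjoint union is one of topological spaces, so its pieces are open in the critical set;
  otherwise a constant function on a torus would be a round function, by slicing the torus into
  circles.
\<close>

definition critical_submanifolds ::
  "nat \<Rightarrow> 'a topology \<Rightarrow> 'a chart set \<Rightarrow> 'b topology \<Rightarrow> ('a \<Rightarrow> real) \<Rightarrow> 'a set set \<Rightarrow> bool" where
  "critical_submanifolds n X A P f \<S> \<longleftrightarrow>
     \<Union>\<S> = critical_set n X A f \<and> disjoint \<S> \<and>
     (\<forall>S\<in>\<S>. (\<exists>d. smooth_submanifold n X A d S) \<and>
             openin (subtopology X (critical_set n X A f)) S \<and>
             subtopology X S homeomorphic_space P)"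

definition P_function ::
  "nat \<Rightarrow> 'a topology \<Rightarrow> 'a chart set \<Rightarrow> 'b topology \<Rightarrow> ('a \<Rightarrow> real) \<Rightarrow> bool" where
  "P_function n X A P f \<longleftrightarrow>
     smooth_function n A f \<and> (\<exists>\<S>. critical_submanifolds n X A P f \<S>)"

text \<open>Finiteness is required explicitly, as \<^const>\<open>card\<close> is 0 on infinite sets: infinitely many
  critical submanifolds do not compete for the minimum below.\<close>

definition has_critical_submanifolds ::
  "nat \<Rightarrow> 'a topology \<Rightarrow> 'a chart set \<Rightarrow> 'b topology \<Rightarrow> ('a \<Rightarrow> real) \<Rightarrow> nat \<Rightarrow> bool" where
  "has_critical_submanifolds n X A P f m \<longleftrightarrow>
     (\<exists>\<S>. critical_submanifolds n X A P f \<S> \<and> finite \<S> \<and> card \<S> = m)"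

definition exact_P_function ::
  "nat \<Rightarrow> 'a topology \<Rightarrow> 'a chart set \<Rightarrow> 'b topology \<Rightarrow> ('a \<Rightarrow> real) \<Rightarrow> bool" where
  "exact_P_function n X A P f \<longleftrightarrow>
     P_function n X A P f \<and>
     (\<exists>m. has_critical_submanifolds n X A P f m \<and>
          (\<forall>g m'. P_function n X A P g \<and> has_critical_submanifolds n X A P g m' \<longrightarrow> m \<le> m'))"

subsection \<open>The torus\<close>

abbreviation circle :: "complex topology" where
  "circle \<equiv> top_of_set (sphere 0 1)"

abbreviation exact_round_function ::
  "nat \<Rightarrow> 'a topology \<Rightarrow> 'a chart set \<Rightarrow> ('a \<Rightarrow> real) \<Rightarrow> bool" where
  "exact_round_function n X A f \<equiv> exact_P_function n X A circle f"

definition torus :: "nat \<Rightarrow> (nat \<Rightarrow> complex) topology" where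
  "torus n = product_topology (\<lambda>_. circle) {..<n}"

text \<open>The charts are the local inverses of the covering \<open>R^n \<rightarrow> T^n\<close>,
  \<open>x \<mapsto> (exp (\<i> x\<^sub>0), \<dots>, exp (\<i> x\<^sub>n\<^sub>-\<^sub>1))\<close>.\<close>

definition torus_atlas :: "nat \<Rightarrow> (nat \<Rightarrow> complex) chart set" where
  "torus_atlas n = {(U, \<phi>). is_chart n (torus n) (U, \<phi>) \<and> (\<forall>z\<in>U. \<forall>i<n. cis (\<phi> z i) = z i)}"


subsection \<open>The torus is a smooth manifold\<close>

lemma topspace_torus: "topspace (torus n) = (\<Pi>\<^sub>E i\<in>{..<n}. sphere 0 1)"
  by (simp add: torus_def)

lemma Hausdorff_space_torus: "Hausdorff_space (torus n)"
  by (simp add: torus_def Hausdorff_space_product_topology Hausdorff_space_subtopology)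

lemma second_countable_euclidean: "second_countable (euclidean :: 'a::second_countable_topology topology)"
proof -
  obtain B :: "'a set set" where B: "countable B" "topological_basis B"
    using ex_countable_basis by blast
  show ?thesis
    unfolding second_countable_def
  proof (intro exI conjI ballI allI impI)
    show "countable B" by (fact B)
    show "openin euclidean V" if "V \<in> B" for V
      using B that by (auto simp: topological_basis_open)
    show "\<exists>V\<in>B. x \<in> V \<and> V \<subseteq> U" if "openin euclidean U \<and> x \<in> U" for U x
      using topological_basisE[OF B(2), of U x] that by (metis open_openin)
  qed
qed

lemma second_countable_torus: "second_countable (torus n)"
proof -
  define Y :: "(nat \<Rightarrow> complex) topology"
    where "Y = top_of_set {z. (\<forall>i<n. z i \<in> sphere 0 1) \<and> (\<forall>i\<ge>n. z i = 1)}"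
  define r where "r = (\<lambda>z :: nat \<Rightarrow> complex. \<lambda>i. if i < n then z i else 1)"
  define s where "s = (\<lambda>z :: nat \<Rightarrow> complex. restrict z {..<n})"
  have proj: "continuous_map (torus n) euclidean (\<lambda>z. z i)" if "i < n" for i
    using continuous_map_product_projection[of i "{..<n}" "\<lambda>_. circle"] that
    by (auto simp: torus_def continuous_map_in_subtopology)
  have "continuous_map (torus n) Y r"
  proof -
    have "continuous_map (torus n) (product_topology (\<lambda>_. euclidean) UNIV) r"
      unfolding continuous_map_componentwise_UNIV
    proof
      show "continuous_map (torus n) euclidean (\<lambda>x. r x k)" for k
        by (cases "k < n") (auto simp: r_def proj)
    qed
    then show ?thesis
      by (auto simp: Y_def continuous_map_in_subtopology euclidean_product_topology
          topspace_torus r_def PiE_def Pi_iff)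
  qed
  moreover have "continuous_map Y (torus n) s"
    unfolding torus_def continuous_map_componentwise
  proof (intro conjI ballI)
    show "s ` topspace Y \<subseteq> extensional {..<n}" by (auto simp: s_def)
    show "continuous_map Y circle (\<lambda>x. s x k)" if "k \<in> {..<n}" for k
    proof -
      have "continuous_map euclidean euclidean (\<lambda>x :: nat \<Rightarrow> complex. x k)"
        by (auto simp: continuous_on_coordinatewise_then_product intro!: continuous_intros)
      then have "continuous_map Y euclidean (\<lambda>x. x k)"
        unfolding Y_def by (rule continuous_map_from_subtopology)
      then have "continuous_map Y euclidean (\<lambda>x. s x k)"
        using that by (simp add: s_def)
      then show ?thesis
        using that by (auto simp: continuous_map_in_subtopology Y_def s_def)
    qed
  qed
  ultimately have "homeomorphic_maps (torus n) Y r s"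
    by (auto simp: homeomorphic_maps_def topspace_torus Y_def r_def s_def PiE_def extensional_def
        fun_eq_iff)
  then have "torus n homeomorphic_space Y"
    by (auto simp: homeomorphic_space_def)
  then show ?thesis
    by (simp add: homeomorphic_space_second_countability Y_def second_countable_subtopology
        second_countable_euclidean)
qed

lemma torus_charts_cover:
  assumes z: "z \<in> topspace (torus n)"
  obtains U \<phi> where "(U, \<phi>) \<in> torus_atlas n" "z \<in> U"
proof -
  define U where "U = {w \<in> topspace (torus n). \<forall>i<n. Re (w i * cnj (z i)) > 0}"
  define \<phi> where
    "\<phi> = (\<lambda>(w :: nat \<Rightarrow> complex) i. if i < n then Arg (z i) + Arg (w i * cnj (z i)) else 0)"
  define e where "e = (\<lambda>x :: nat \<Rightarrow> real. restrict (\<lambda>i. cis (x i)) {..<n})"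
  define W where "W = {x \<in> topspace (Euclidean_space n). \<forall>i<n. \<bar>x i - Arg (z i)\<bar> < pi / 2}"
  have nz: "cmod (z i) = 1" if "i < n" for i
    using z that by (auto simp: topspace_torus PiE_def Pi_iff)
  have cz: "cis (Arg (z i)) = z i" "z i * cnj (z i) = 1" if "i < n" for i
    using nz[OF that] cis_Arg[of "z i"] norm_zero[where 'a = complex]
    by (fastforce simp: sgn_div_norm complex_norm_square[symmetric])+
  have proj: "continuous_map (torus n) euclidean (\<lambda>z. z i)" if "i < n" for i
    using continuous_map_product_projection[of i "{..<n}" "\<lambda>_. circle"] that
    by (auto simp: torus_def continuous_map_in_subtopology)
  have projz: "continuous_map (torus n) euclidean (\<lambda>w. w i * cnj (z i))" if "i < n" for i
  proof -
    have "continuous_map euclidean euclidean (\<lambda>u. u * cnj (z i))"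
      by (auto intro!: continuous_intros)
    from continuous_map_compose[OF proj[OF that] this] show ?thesis by (simp add: o_def)
  qed
  have proj': "continuous_map (Euclidean_space n) euclideanreal (\<lambda>x. x i)" for i
    unfolding Euclidean_space_def
    by (intro continuous_map_from_subtopology continuous_map_product_projection) auto
  have opU: "openin (torus n) U"
  proof -
    have "openin (torus n) {w \<in> topspace (torus n). w i * cnj (z i) \<in> {u. 0 < Re u}}" if "i < n" for i
    proof (rule openin_continuous_map_preimage)
      show "continuous_map (torus n) euclidean (\<lambda>w. w i * cnj (z i))"
        by (rule projz[OF that])
    qed (simp add: open_halfspace_Re_gt)
    then have "openin (torus n) (topspace (torus n) \<inter>
        \<Inter>((\<lambda>i. {w \<in> topspace (torus n). w i * cnj (z i) \<in> {u. 0 < Re u}}) ` {..<n}))"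
      by (cases "n = 0") (auto intro!: openin_Int openin_Inter)
    also have "\<dots> = U" by (auto simp: U_def)
    finally show ?thesis .
  qed
  have opW: "openin (Euclidean_space n) W"
  proof -
    have "openin (Euclidean_space n)
        {x \<in> topspace (Euclidean_space n). x i \<in> ball (Arg (z i)) (pi / 2)}" for i
      by (rule openin_continuous_map_preimage[OF proj']) auto
    then have "openin (Euclidean_space n) (topspace (Euclidean_space n) \<inter>
        \<Inter>((\<lambda>i. {x \<in> topspace (Euclidean_space n). x i \<in> ball (Arg (z i)) (pi / 2)}) ` {..<n}))"
      by (cases "n = 0") (auto intro!: openin_Int openin_Inter)
    also have "\<dots> = W" by (auto simp: W_def dist_real_def abs_minus_commute)
    finally show ?thesis .
  qed
  have cis_phi: "cis (\<phi> w i) = w i" if w: "w \<in> U" and i: "i < n" for w i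
  proof -
    have nw: "cmod (w i) = 1"
      using w i by (auto simp: U_def topspace_torus PiE_def Pi_iff)
    have ne: "w i * cnj (z i) \<noteq> 0" "cmod (w i * cnj (z i)) = 1"
      using nw nz[OF i] by (auto simp: norm_mult)
    have "cis (\<phi> w i) = z i * (w i * cnj (z i))"
      using i ne cis_Arg[OF ne(1)] cz(1)[OF i] ne(2)
      by (simp add: \<phi>_def cis_mult[symmetric] sgn_div_norm)
    then show ?thesis using cz(2)[OF i] by (simp add: algebra_simps)
  qed
  have phi_in: "\<phi> w \<in> W" if w: "w \<in> U" for w
  proof -
    have "\<bar>Arg (w i * cnj (z i))\<bar> < pi / 2" if "i < n" for i
      using w that Arg_Re_pos[of "w i * cnj (z i)"] by (auto simp: U_def)
    then show ?thesis by (auto simp: W_def \<phi>_def topspace_Euclidean_space)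
  qed
  have diff: "cis (x i) * cnj (z i) = cis (x i - Arg (z i))" if "i < n" for x :: "nat \<Rightarrow> real" and i
    using cz(1)[OF that] by (metis cis_cnj cis_mult diff_conv_add_uminus)
  have e_in: "e x \<in> U" if x: "x \<in> W" for x
  proof -
    have "Re (e x i * cnj (z i)) > 0" if "i < n" for i
    proof -
      have "cos (x i - Arg (z i)) > 0"
      proof (rule cos_gt_zero_pi)
        have "\<bar>x i - Arg (z i)\<bar> < pi / 2" using x that by (simp add: W_def)
        then show "- (pi / 2) < x i - Arg (z i)" "x i - Arg (z i) < pi / 2" by linarith+
      qed
      then show ?thesis using that by (simp add: e_def diff del: complex_cnj_mult)
    qed
    then show ?thesis by (auto simp: U_def topspace_torus e_def)
  qed
  have e_phi: "e (\<phi> w) = w" if w: "w \<in> U" for w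
  proof
    fix i show "e (\<phi> w) i = w i"
      using cis_phi[OF w, of i] w by (cases "i < n") (auto simp: e_def U_def topspace_torus PiE_def extensional_def)
  qed
  have phi_e: "\<phi> (e x) = x" if x: "x \<in> W" for x
  proof
    fix i show "\<phi> (e x) i = x i"
    proof (cases "i < n")
      case True
      then have "\<bar>x i - Arg (z i)\<bar> < pi / 2" using x by (auto simp: W_def)
      then have "Arg (cis (x i - Arg (z i))) = x i - Arg (z i)"
        using pi_gt_zero by (intro Arg_cis) (simp only: abs_less_iff greaterThanAtMost_iff, argo)
      then show ?thesis using True by (simp add: \<phi>_def e_def diff)
    next
      case False
      then show ?thesis using x by (auto simp: \<phi>_def W_def topspace_Euclidean_space)
    qed
  qed
  have "homeomorphic_maps (subtopology (torus n) U) (subtopology (Euclidean_space n) W) \<phi> e"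
    unfolding homeomorphic_maps_def
  proof (intro conjI ballI)
    have "continuous_map (subtopology (torus n) U) euclideanreal (\<lambda>w. \<phi> w i)" for i
    proof (cases "i < n")
      case True
      have "continuous_map (subtopology (torus n) U) (top_of_set {u. 0 < Re u}) (\<lambda>w. w i * cnj (z i))"
        unfolding continuous_map_in_subtopology
      proof
        show "continuous_map (subtopology (torus n) U) euclidean (\<lambda>w. w i * cnj (z i))"
          by (rule continuous_map_from_subtopology[OF projz[OF True]])
      qed (use True in \<open>auto simp: U_def\<close>)
      moreover have "continuous_map (top_of_set {u. 0 < Re u}) euclideanreal (\<lambda>u. Arg (z i) + Arg u)"
        by (auto simp: complex_nonpos_Reals_iff intro!: continuous_intros)
      ultimately have "continuous_map (subtopology (torus n) U) euclideanreal
          ((\<lambda>u. Arg (z i) + Arg u) \<circ> (\<lambda>w. w i * cnj (z i)))"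
        by (rule continuous_map_compose)
      then show ?thesis using True by (simp add: \<phi>_def o_def)
    qed (simp add: \<phi>_def)
    then show "continuous_map (subtopology (torus n) U) (subtopology (Euclidean_space n) W) \<phi>"
      using phi_in
      by (auto simp: continuous_map_in_subtopology Euclidean_space_def continuous_map_componentwise_UNIV
          W_def topspace_Euclidean_space Pi_iff)
    have "continuous_map (subtopology (Euclidean_space n) W) circle (\<lambda>x. e x i)" if "i < n" for i
    proof -
      have "continuous_map (subtopology (Euclidean_space n) W) euclideanreal (\<lambda>x. x i)"
        by (rule continuous_map_from_subtopology[OF proj'])
      moreover have "continuous_map euclideanreal circle cis"
        by (auto simp: continuous_map_in_subtopology intro!: continuous_intros)
      ultimately have "continuous_map (subtopology (Euclidean_space n) W) circle (cis \<circ> (\<lambda>x. x i))"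
        by (rule continuous_map_compose)
      then show ?thesis using that by (simp add: e_def o_def)
    qed
    then have "continuous_map (subtopology (Euclidean_space n) W) (torus n) e"
      by (auto simp: torus_def continuous_map_componentwise e_def)
    then show "continuous_map (subtopology (Euclidean_space n) W) (subtopology (torus n) U) e"
      using e_in by (auto simp: continuous_map_in_subtopology)
  qed (auto simp: e_phi phi_e)
  moreover have "\<phi> ` U = W"
    using phi_in e_in phi_e by (metis image_subset_iff subsetI subset_antisym image_eqI)
  ultimately have "is_chart n (torus n) (U, \<phi>)"
    using opU opW by (auto simp: is_chart_def homeomorphic_map_maps)
  moreover have "z \<in> U"
  proof -
    have "Re (z i * cnj (z i)) > 0" if "i < n" for i
      by (simp only: cz(2)[OF that] one_complex.sel zero_less_one)
    with z show ?thesis by (simp only: U_def mem_Collect_eq) blast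
  qed
  ultimately show ?thesis
    using that[of U \<phi>] cis_phi by (simp add: torus_atlas_def)
qed

lemma C_diff_const: "C_diff n r W (\<lambda>_. c)"
proof (induction r arbitrary: c)
  case (Suc r)
  then show ?case by (auto intro!: exI[of _ "\<lambda>_. 0"])
qed simp

lemma torus_transitions_smooth:
  assumes c: "c \<in> torus_atlas n" and c': "c' \<in> torus_atlas n"
  shows "smooth_transition n c c'"
proof -
  obtain U \<phi> V \<psi> where [simp]: "c = (U, \<phi>)" "c' = (V, \<psi>)" by (cases c, cases c') auto
  define W where "W = \<phi> ` (U \<inter> V)"
  have U: "openin (torus n) U" "openin (Euclidean_space n) (\<phi> ` U)"
    and hU: "homeomorphic_map (subtopology (torus n) U) (subtopology (Euclidean_space n) (\<phi> ` U)) \<phi>"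
    and V: "openin (torus n) V" "openin (Euclidean_space n) (\<psi> ` V)"
    and hV: "homeomorphic_map (subtopology (torus n) V) (subtopology (Euclidean_space n) (\<psi> ` V)) \<psi>"
    and cU: "\<And>z i. z \<in> U \<Longrightarrow> i < n \<Longrightarrow> cis (\<phi> z i) = z i"
    and cV: "\<And>z i. z \<in> V \<Longrightarrow> i < n \<Longrightarrow> cis (\<psi> z i) = z i"
    using c c' by (auto simp: torus_atlas_def is_chart_def)
  have sub: "U \<subseteq> topspace (torus n)" "V \<subseteq> topspace (torus n)"
      "\<phi> ` U \<subseteq> topspace (Euclidean_space n)" "\<psi> ` V \<subseteq> topspace (Euclidean_space n)"
    using U V openin_subset by blast+
  have inj: "inj_on \<phi> U"
    using homeomorphic_imp_injective_map[OF hU] sub by (simp add: Int_absorb1)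
  define h where "h = (\<lambda>x. \<psi> (inv_into U \<phi> x))"
  have opW: "openin (Euclidean_space n) W"
  proof -
    have "openin (subtopology (torus n) U) (U \<inter> V)"
      using V by (simp add: openin_subtopology_Int2)
    then have "openin (subtopology (Euclidean_space n) (\<phi> ` U)) W"
      unfolding W_def using homeomorphic_imp_open_map[OF hU] by (auto simp: open_map_def)
    then show ?thesis using U(2) openin_trans_full by blast
  qed
  have cont_inv: "continuous_map (subtopology (Euclidean_space n) (\<phi> ` U)) (subtopology (torus n) U)
      (inv_into U \<phi>)"
  proof -
    obtain g where g: "homeomorphic_maps (subtopology (torus n) U)
        (subtopology (Euclidean_space n) (\<phi> ` U)) \<phi> g"
      using hU by (auto simp: homeomorphic_map_maps)
    then have "continuous_map (subtopology (Euclidean_space n) (\<phi> ` U)) (subtopology (torus n) U) g"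
      by (simp add: homeomorphic_maps_def)
    then show ?thesis
    proof (rule continuous_map_eq)
      fix x assume "x \<in> topspace (subtopology (Euclidean_space n) (\<phi> ` U))"
      then obtain u where u: "u \<in> U" "x = \<phi> u" by auto
      then show "g x = inv_into U \<phi> x"
        using g inj sub by (auto simp: homeomorphic_maps_def)
    qed
  qed
  have cont_h: "continuous_map (subtopology (Euclidean_space n) W) (Euclidean_space n) h"
  proof -
    have "continuous_map (subtopology (Euclidean_space n) W) (torus n) (inv_into U \<phi>)"
      using continuous_map_from_subtopology[OF cont_inv, of W]
      by (auto simp: subtopology_subtopology W_def continuous_map_in_subtopology Int_absorb1 image_mono)
    moreover have "inv_into U \<phi> ` W \<subseteq> V"
      using inj by (auto simp: W_def)
    ultimately have "continuous_map (subtopology (Euclidean_space n) W) (subtopology (torus n) V)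
        (inv_into U \<phi>)"
      by (auto simp: continuous_map_in_subtopology)
    moreover have "continuous_map (subtopology (torus n) V) (Euclidean_space n) \<psi>"
      using homeomorphic_imp_continuous_map[OF hV] by (simp add: continuous_map_in_subtopology)
    ultimately show ?thesis
      using continuous_map_compose unfolding h_def o_def by blast
  qed
  have cont_hi: "continuous_map (subtopology (Euclidean_space n) W) euclideanreal (\<lambda>x. h x i)" for i
    using cont_h by (auto simp: Euclidean_space_def continuous_map_in_subtopology
        continuous_map_componentwise_UNIV)
  have period: "\<exists>m::int. h x i - x i = 2 * pi * m" if "x \<in> W" "i < n" for x i
  proof -
    obtain u where u: "u \<in> U" "u \<in> V" "x = \<phi> u" using \<open>x \<in> W\<close> by (auto simp: W_def)
    have "cis (h x i) = cis (x i)"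
      using cU[OF u(1) \<open>i < n\<close>] cV[OF u(2) \<open>i < n\<close>] inj u by (simp add: h_def)
    then have "cis (h x i - x i) = 1"
      by (simp add: cis_divide[symmetric])
    then have "cos (h x i - x i) = 1"
      by (simp add: complex_eq_iff)
    then show ?thesis
      by (auto simp: cos_one_2pi_int mult.commute)
  qed
  have deriv: "((\<lambda>t. h (x(j := t)) i) has_real_derivative (if i = j then 1 else 0)) (at (x j))"
    if x: "x \<in> W" and ij: "i < n" "j < n" for x i j
  proof -
    define l where "l = (\<lambda>t. x(j := t))"
    define T where "T = {t. l t \<in> W}"
    have xE: "x \<in> topspace (Euclidean_space n)"
      using x opW openin_subset by blast
    have cl: "continuous_map euclideanreal (Euclidean_space n) l"
      unfolding Euclidean_space_def continuous_map_in_subtopology continuous_map_componentwise_UNIV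
    proof
      show "\<forall>k. continuous_map euclideanreal euclideanreal (\<lambda>t. l t k)"
        by (auto simp: l_def)
      show "l \<in> topspace euclideanreal \<rightarrow> {x. \<forall>i\<ge>n. x i = 0}"
        using xE ij by (auto simp: l_def topspace_Euclidean_space)
    qed
    have opT: "open T"
      using openin_continuous_map_preimage[OF cl opW] by (simp add: T_def)
    have xT: "x j \<in> T" using x by (simp add: T_def l_def)
    have "continuous_map (top_of_set T) (subtopology (Euclidean_space n) W) l"
      using continuous_map_from_subtopology[OF cl, of T]
      by (auto simp: continuous_map_in_subtopology T_def)
    from continuous_map_compose[OF this cont_hi[of i]]
    have "continuous_on T (\<lambda>t. h (l t) i)" by (simp add: o_def)
    then have "continuous_on T (\<lambda>t. h (l t) i - l t i)"
      by (cases "i = j") (auto simp: l_def intro!: continuous_intros)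
    then have "isCont (\<lambda>t. h (l t) i - l t i) (x j)"
      using opT xT continuous_on_eq_continuous_at by blast
    then have "\<exists>d>0. \<forall>t. dist t (x j) < d \<longrightarrow>
        dist (h (l t) i - l t i) (h (l (x j)) i - l (x j) i) < pi"
      unfolding continuous_at_eps_delta by (elim allE[where x = pi]) (simp only: pi_gt_zero simp_thms)
    then obtain d where d: "d > 0"
      "\<And>t. dist t (x j) < d \<Longrightarrow> dist (h (l t) i - l t i) (h (l (x j)) i - l (x j) i) < pi"
      by blast
    obtain d' where d': "d' > 0" "ball (x j) d' \<subseteq> T"
      using opT xT open_contains_ball by blast
    have loc: "h (l t) i = l t i + (h x i - x i)" if t: "dist t (x j) < min d d'" for t
    proof -
      have "t \<in> T" using t d' by (auto simp: dist_commute subset_iff)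
      then obtain m :: int where m: "h (l t) i - l t i = 2 * pi * m"
        using period[of "l t" i] ij by (auto simp: T_def)
      obtain m' :: int where m': "h (l (x j)) i - l (x j) i = 2 * pi * m'"
        using period[of "l (x j)" i] ij x by (auto simp: l_def)
      have "dist (2 * pi * m) (2 * pi * m') < pi"
        using d(2)[of t] t m m' by simp
      then have "pi * (2 * \<bar>real_of_int (m - m')\<bar>) < pi * 1"
        by (simp add: dist_real_def abs_mult flip: right_diff_distrib)
      then have "2 * \<bar>real_of_int (m - m')\<bar> < 1"
        by (simp only: mult_less_cancel_left_pos[OF pi_gt_zero])
      then have "\<bar>real_of_int (m - m')\<bar> < 1"
        using abs_ge_zero[of "real_of_int (m - m')"] by argo
      then have "real_of_int \<bar>m - m'\<bar> < 1" by (simp only: of_int_abs)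
      then have "\<bar>m - m'\<bar> < 1" by (simp only: of_int_less_1_iff)
      then have "m = m'" by simp
      then show ?thesis using m m' by (simp add: l_def)
    qed
    have "((\<lambda>t. l t i + (h x i - x i)) has_real_derivative (if i = j then 1 else 0)) (at (x j))"
      by (cases "i = j") (auto simp: l_def intro!: derivative_eq_intros)
    then have "((\<lambda>t. h (l t) i) has_real_derivative (if i = j then 1 else 0)) (at (x j))"
      by (rule DERIV_cong_ev[THEN iffD1, rotated -1, OF _ refl _ refl])
        (use loc d(1) d'(1) in \<open>auto simp: eventually_nhds_metric intro!: exI[of _ "min d d'"]\<close>)
    then show ?thesis by (simp add: l_def)
  qed
  have "C_diff n r W (\<lambda>x. h x i)" if "i < n" for r i
  proof (cases r)
    case 0
    then show ?thesis by (simp add: cont_hi)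
  next
    case (Suc r')
    have "\<exists>g. (\<forall>x\<in>W. ((\<lambda>t. h (x(j := t)) i) has_real_derivative g x) (at (x j))) \<and> C_diff n r' W g"
      if "j < n" for j
      using deriv \<open>i < n\<close> that C_diff_const[of n r' W "if i = j then 1 else 0"]
      by (intro exI[of _ "\<lambda>_. if i = j then 1 else 0"]) blast
    then show ?thesis using Suc cont_hi by simp
  qed
  then show ?thesis
    by (simp add: smooth_transition_def C_infinity_def W_def h_def)
qed

lemma smooth_manifold_torus: "smooth_manifold n (torus n) (torus_atlas n)"
  unfolding smooth_manifold_def
proof (intro conjI ballI subsetI)
  show "is_chart n (torus n) c" if "c \<in> torus_atlas n" for c
    using that by (auto simp: torus_atlas_def)
  show "z \<in> (\<Union>(U, \<phi>)\<in>torus_atlas n. U)" if "z \<in> topspace (torus n)" for z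
    using torus_charts_cover[OF that] by blast
qed (simp_all add: Hausdorff_space_torus second_countable_torus torus_transitions_smooth)

end

theory Submission
  imports Defs
begin

text \<open>
  Everything is lifted along the covering \<open>R^n \<rightarrow> T^n\<close>, \<open>x \<mapsto> (cis x\<^sub>0, \<dots>, cis x\<^sub>n\<^sub>-\<^sub>1)\<close>.

  \<^emph>\<open>At least \<open>n - k + 1\<close> critical submanifolds.\<close> Let a smooth function have critical submanifolds
  \<open>C\<^sub>1, \<dots>, C\<^sub>m\<close>, all homeomorphic to \<open>T^k\<close>, and suppose \<open>m + k \<le> n\<close>. A covector \<open>a\<close> of \<open>R^n\<close> is a closed
  one-form on \<open>T^n\<close>. It is exact on \<open>C\<^sub>s\<close> as soon as it annihilates the \<open>k\<close> displacements of the
  generating loops of \<open>C\<^sub>s\<close>, and then it has a primitive there, which becomes on the lift of \<open>C\<^sub>s\<close> a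
  locally constant function \<open>D\<^sub>s\<close> at bounded distance from the linear function \<open>a\<close>
  (\<open>annihilators_have_primitives\<close>). Each \<open>C\<^sub>s\<close> imposes only \<open>k\<close> linear conditions, so there are
  linearly independent covectors \<open>a\<^sub>1, \<dots>, a\<^sub>m\<close> with \<open>a\<^sub>s\<close> exact on \<open>C\<^sub>s\<close> (\<open>biorthogonal_annihilators\<close>).

  A discrete gradient descent now spreads \<open>D\<^sub>s\<close> to the set \<open>V\<^sub>s\<close> of all points whose orbit passes close
  to \<open>C\<^sub>s\<close>. The function is constant on \<open>C\<^sub>s\<close> (\<open>constant_on_critical_submanifold\<close>), and an orbit that
  leaves a neighbourhood of \<open>C\<^sub>s\<close> loses a fixed amount of height on its way out; it never comes back,
  and the value of \<open>D\<^sub>s\<close> does not depend on the moment of the visit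
  (\<open>critical_pieces_give_strips\<close>). By compactness every orbit visits some \<open>C\<^sub>s\<close>, so the \<open>V\<^sub>s\<close> cover
  \<open>R^n\<close>. But \<open>a\<^sub>s\<close> is bounded on each piece of \<open>V\<^sub>s\<close> on which \<open>D\<^sub>s\<close> is constant, and in the \<open>m\<close>
  coordinates \<open>a\<^sub>1, \<dots>, a\<^sub>m\<close> this contradicts Lebesgue's covering theorem for a large cube
  (\<open>no_cover_by_bounded_strips\<close>). This is the cup-length estimate, with Kuhn's lemma in place of
  cohomology.

  \<^emph>\<open>A function with \<open>n - k + 1\<close> critical submanifolds.\<close> Let \<open>N = n - k + 1\<close>. The last \<open>n - k\<close>
  coordinates of a point of \<open>T^n\<close> determine \<open>N\<close> points \<open>z\<^sub>i\<close> of the circle \<open>R/Z\<close> with sum \<open>1/2\<close>. Take a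
  strictly concave \<open>h\<close> on \<open>[0,1]\<close> with \<open>h(0) = h(1) = 0\<close> and put, for \<open>0 < u < 1\<close>,

  \<open>\<kappa>\<^sub>u(z) = - u h(z/u)\<close> on \<open>[0,u]\<close> and \<open>\<kappa>\<^sub>u(z) = (1-u) h((1-z)/(1-u))\<close> on \<open>[u,1]\<close>.

  The sum of the \<open>\<kappa>\<^sub>u(z\<^sub>i)\<close> is strictly decreasing in \<open>u\<close>, and the function is its zero \<open>u\<close>. As the sum of
  the \<open>z\<^sub>i\<close> is fixed, a point is critical iff the slopes of \<open>\<kappa>\<^sub>u\<close> at all \<open>z\<^sub>i\<close> agree. The slope of \<open>h\<close> is
  injective, so in that case there is one \<open>\<xi>\<close> such that each \<open>z\<^sub>i\<close> is \<open>u \<xi>\<close> or \<open>1 - (1-u) \<xi>\<close>. If the second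
  happens \<open>q\<close> times, then

  \<open>\<Sum> \<kappa>\<^sub>u(z\<^sub>i) = h(\<xi>) (q - N u) = 0\<close> and \<open>\<Sum> z\<^sub>i = \<xi> (N u - q) + q\<close>.

  The second sum is not an integer; hence \<open>q \<noteq> N u\<close> and \<open>\<xi> \<noteq> 0\<close>, so that \<open>\<xi> = 1\<close> and all points
  \<open>z\<^sub>i\<close> are equal to \<open>u\<close>. Then \<open>N u\<close> is \<open>1/2\<close> plus an integer, which leaves \<open>N\<close> values of \<open>u\<close>, each attained on
  a coordinate torus \<open>T^k\<close> (\<open>equal_slopes_iff\<close>). Flatness of \<open>h''\<close> at \<open>0\<close> and \<open>1\<close> makes \<open>\<kappa>\<close> smooth across
  \<open>z = 0\<close> and \<open>z = u\<close>.
\<close>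

section \<open>Compactness of the torus, covering the plane by strips, linear algebra\<close>

text \<open>
  Only the first \<open>n\<close> coordinates count. Functions on \<open>R^n\<close> are thus functions of arbitrary sequences
  that ignore the later entries, which avoids truncating after every change of a coordinate.
\<close>

abbreviation near :: "nat \<Rightarrow> real \<Rightarrow> (nat \<Rightarrow> real) \<Rightarrow> (nat \<Rightarrow> real) \<Rightarrow> bool" where
  "near n d x y \<equiv> \<forall>i<n. \<bar>x i - y i\<bar> < d"

definition period_shift :: "(nat \<Rightarrow> int) \<Rightarrow> (nat \<Rightarrow> real) \<Rightarrow> nat \<Rightarrow> real" where
  "period_shift v x = (\<lambda>i. x i + 2 * pi * of_int (v i))"

lemma near_period_shift: "near n d (period_shift v x) (period_shift v y) = near n d x y"
  by (simp add: period_shift_def)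

lemma near_mono: "near n d x y \<Longrightarrow> d \<le> e \<Longrightarrow> near n e x y"
  by force

lemma near_sym: "near n d x y \<Longrightarrow> near n d y x"
  by (simp add: abs_minus_commute)

lemma near_trans:
  assumes "near n d x y" "near n e y z" "d + e \<le> f" shows "near n f x z"
proof (intro allI impI)
  fix i assume "i < n"
  then have "\<bar>x i - y i\<bar> < d" "\<bar>y i - z i\<bar> < e" using assms by auto
  then show "\<bar>x i - z i\<bar> < f" using assms(3) by linarith
qed

text \<open>
  Lebesgue's number: a translate of any point lies in the compact cube of side \<open>2\<pi>\<close>, which finitely
  many boxes with local thresholds cover. This is the only use of compactness of the torus; every
  other passage from local to uniform statements quotes it with a suitable \<open>Q\<close>.
\<close>

lemma uniform_threshold:
  fixes Q :: "real \<Rightarrow> (nat \<Rightarrow> real) \<Rightarrow> (nat \<Rightarrow> real) \<Rightarrow> bool"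
  assumes mono: "\<And>d d' x y. Q d x y \<Longrightarrow> 0 < d' \<Longrightarrow> d' \<le> d \<Longrightarrow> Q d' x y"
    and shift: "\<And>d v x y. Q d (period_shift v x) (period_shift v y) \<Longrightarrow> Q d x y"
    and loc: "\<And>a. \<exists>d>0. \<forall>x y. near n d a x \<longrightarrow> near n d a y \<longrightarrow> Q d x y"
  shows "\<exists>d>0. \<forall>x y. near n d x y \<longrightarrow> Q d x y"
proof -
  obtain D where D: "\<And>a. D a > 0" "\<And>a x y. near n (D a) a x \<Longrightarrow> near n (D a) a y \<Longrightarrow> Q (D a) x y"
    using loc by metis
  define K :: "(nat \<Rightarrow> real) set" where "K = (\<Pi>\<^sub>E i\<in>UNIV. if i < n then {0..2*pi} else {0})"
  have "compactin (product_topology (\<lambda>_. euclideanreal) UNIV) K"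
    unfolding K_def compactin_PiE by auto
  then have K: "compact K" by (simp add: euclidean_product_topology)
  define U where "U = (\<lambda>a. {x. near n (D a / 2) a x})"
  have "open (U a)" for a
  proof -
    have "U a = (\<Pi>\<^sub>E i\<in>UNIV. if i < n then ball (a i) (D a / 2) else UNIV)"
      by (auto simp: U_def PiE_def Pi_iff dist_real_def split: if_splits)
    moreover have "open \<dots>"
      by (rule open_PiE) (auto intro: finite_subset[of _ "{..<n}"] split: if_splits)
    ultimately show ?thesis by simp
  qed
  moreover have "K \<subseteq> (\<Union>a\<in>K. U a)" using D(1) by (auto simp: U_def)
  ultimately obtain A where A: "A \<subseteq> K" "finite A" "K \<subseteq> (\<Union>a\<in>A. U a)"
    using compactE_image[OF K, of K U] by metis
  have "(\<lambda>_. 0) \<in> K" by (auto simp: K_def)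
  then have "A \<noteq> {}" using A(3) by blast
  define d where "d = Min ((\<lambda>a. D a / 2) ` A)"
  have dle: "d \<le> D a / 2" if "a \<in> A" for a
    unfolding d_def by (rule Min_le) (use that A(2) in auto)
  have dpos: "d > 0" using A(2) \<open>A \<noteq> {}\<close> D(1) by (simp add: d_def)
  have "Q d x y" if xy: "near n d x y" for x y
  proof -
    define v where "v = (\<lambda>i. - \<lfloor>x i / (2 * pi)\<rfloor>)"
    define x' where "x' = period_shift v x"
    define y' where "y' = period_shift v y"
    have "0 \<le> x' i \<and> x' i \<le> 2 * pi" for i
    proof -
      have "x' i = 2 * pi * frac (x i / (2 * pi))"
        by (simp add: x'_def period_shift_def v_def frac_def algebra_simps)
      moreover have "2 * pi * frac (x i / (2 * pi)) \<le> 2 * pi * 1"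
        using frac_lt_1[of "x i / (2 * pi)"] by (intro mult_left_mono) auto
      ultimately show ?thesis by simp
    qed
    then have "(\<lambda>i. if i < n then x' i else 0) \<in> K" by (auto simp: K_def)
    then obtain a where a: "a \<in> A" "(\<lambda>i. if i < n then x' i else 0) \<in> U a" using A(3) by blast
    then have ax: "near n (D a / 2) a x'" by (simp add: U_def)
    have xy': "near n d x' y'" using xy by (simp add: x'_def y'_def near_period_shift)
    have "near n (D a) a y'"
      using near_trans[OF ax xy', of "D a"] dle[OF a(1)] by simp
    moreover have "near n (D a) a x'" using near_mono[OF ax, of "D a"] D(1)[of a] by simp
    ultimately have "Q (D a) x' y'" by (rule D(2)[rotated])
    moreover have "d \<le> D a" using dle[OF a(1)] D(1)[of a] by simp
    ultimately have "Q d x' y'" using dpos mono by blast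
    then show ?thesis unfolding x'_def y'_def by (rule shift)
  qed
  then show ?thesis using dpos by blast
qed

lemma uniform_threshold_pointwise:
  fixes Q :: "real \<Rightarrow> (nat \<Rightarrow> real) \<Rightarrow> bool"
  assumes mono: "\<And>d d' x. Q d x \<Longrightarrow> 0 < d' \<Longrightarrow> d' \<le> d \<Longrightarrow> Q d' x"
    and shift: "\<And>d v x. Q d (period_shift v x) \<Longrightarrow> Q d x"
    and loc: "\<And>a. \<exists>d>0. \<forall>x. near n d a x \<longrightarrow> Q d x"
  shows "\<exists>d>0. \<forall>x. Q d x"
proof -
  have "\<exists>d>0. \<forall>x y. near n d x y \<longrightarrow> Q d x"
  proof (rule uniform_threshold[of "\<lambda>d x y. Q d x"])
    show "\<exists>d>0. \<forall>x y. near n d a x \<longrightarrow> near n d a y \<longrightarrow> Q d x" for a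
      using loc[of a] by fast
    show "Q d' x" if "Q d x" "0 < d'" "d' \<le> d" for d d' x using that by (rule mono)
    show "Q d x" if "Q d (period_shift v x)" for d v x using that by (rule shift)
  qed
  then obtain d where d: "d > 0" "\<And>x y. near n d x y \<Longrightarrow> Q d x" by blast
  have "Q d x" for x by (rule d(2)[of x x]) (use d(1) in simp)
  then show ?thesis using d(1) by blast
qed

text \<open>
  Along the span of the \<open>v\<^sub>t\<close> the linear functions \<open>a\<^sub>s\<close> are coordinates. Label the points of a large
  grid in this span, in the \<open>s\<close>-th coordinate, by whether \<open>D\<^sub>s\<close> lies above or below half the
  side of the grid. As \<open>D\<^sub>s\<close> is close to \<open>a\<^sub>s\<close>, the labels are right on the faces, and Kuhn's lemma
  finds a small cube on which every label changes, although the cube lies in one piece of some \<open>V\<^sub>s\<close>.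
\<close>

lemma no_cover_by_bounded_strips:
  fixes D :: "nat \<Rightarrow> (nat \<Rightarrow> real) \<Rightarrow> real" and a v :: "nat \<Rightarrow> nat \<Rightarrow> real"
  assumes biorth: "\<And>s t. s < m \<Longrightarrow> t < m \<Longrightarrow> (\<Sum>i<n. a s i * v t i) = (if s = t then 1 else 0)"
    and d: "d > 0"
    and cover: "\<And>x. \<exists>s<m. \<forall>y. near n d x y \<longrightarrow> y \<in> V s \<and> D s y = D s x"
    and bd: "\<And>s y. s < m \<Longrightarrow> y \<in> V s \<Longrightarrow> \<bar>D s y - (\<Sum>i<n. a s i * y i)\<bar> \<le> B"
  shows False
proof -
  \<comment> \<open>the mesh: a cube of this side has all its vertices within \<open>d\<close> of each other\<close>
  define c where "c = d / (1 + (\<Sum>t<m. \<Sum>i<n. \<bar>v t i\<bar>))"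
  have S0: "(\<Sum>t<m. \<Sum>i<n. \<bar>v t i\<bar>) \<ge> 0" by (intro sum_nonneg) auto
  then have c: "c > 0" using d by (simp add: c_def)
  obtain p :: nat where p: "real p > 2 * \<bar>B\<bar> / c" using reals_Archimedean2 by blast
  then have p0: "p > 0" using c by (metis abs_ge_zero divide_nonneg_pos gr0I mult_nonneg_nonneg not_le of_nat_0 zero_le_numeral)
  have pB: "c * real p / 2 > \<bar>B\<bar>" using p c by (simp add: field_simps)
  define X where "X = (\<lambda>(r :: nat \<Rightarrow> nat) i. \<Sum>t<m. c * real (r t) * v t i)"
  have aX: "(\<Sum>i<n. a s i * X r i) = c * real (r s)" if "s < m" for s r
  proof -
    have "(\<Sum>i<n. a s i * X r i) = (\<Sum>i<n. \<Sum>t<m. c * real (r t) * (a s i * v t i))"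
      by (simp add: X_def sum_distrib_left algebra_simps)
    also have "\<dots> = (\<Sum>t<m. c * real (r t) * (\<Sum>i<n. a s i * v t i))"
      by (subst sum.swap) (simp add: sum_distrib_left)
    also have "\<dots> = (\<Sum>t<m. if t = s then c * real (r t) else 0)"
      using that biorth by (intro sum.cong) auto
    also have "\<dots> = c * real (r s)" using that by simp
    finally show ?thesis .
  qed
  define label where "label = (\<lambda>r s. if X r \<in> V s then if D s (X r) > c * real p / 2 then 1 else 0
      else if r s = p then 1 else (0::nat))"
  have l0: "label r s = 0" if "s < m" "r s = 0" for r s
    using bd[OF that(1), of "X r"] aX[OF that(1), of r] that p0 pB by (auto simp: label_def)
  have l1: "label r s = 1" if "s < m" "r s = p" for r s
    using bd[OF that(1), of "X r"] aX[OF that(1), of r] that p0 pB by (auto simp: label_def)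
  have lab: "\<forall>x. (\<forall>i<m. x i \<le> p) \<longrightarrow> (\<forall>i<m. label x i = 0 \<or> label x i = 1)"
      "\<forall>x. (\<forall>i<m. x i \<le> p) \<longrightarrow> (\<forall>i<m. x i = 0 \<longrightarrow> label x i = 0)"
      "\<forall>x. (\<forall>i<m. x i \<le> p) \<longrightarrow> (\<forall>i<m. x i = p \<longrightarrow> label x i = 1)"
    subgoal by (simp add: label_def)
    subgoal using l0 by blast
    subgoal using l1 by blast
    done
  obtain q where q: "\<forall>i<m. \<exists>r s. (\<forall>j<m. q j \<le> r j \<and> r j \<le> q j + 1) \<and>
      (\<forall>j<m. q j \<le> s j \<and> s j \<le> q j + 1) \<and> label r i \<noteq> label s i"
    by (rule kuhn_lemma[OF p0 lab])
  obtain s where s: "s < m" "\<And>y. near n d (X q) y \<Longrightarrow> y \<in> V s \<and> D s y = D s (X q)"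
    using cover by blast
  have near: "near n d (X q) (X r)" if r: "\<forall>j<m. q j \<le> r j \<and> r j \<le> q j + 1" for r
  proof (intro allI impI)
    fix i assume i: "i < n"
    have "\<bar>X q i - X r i\<bar> = \<bar>\<Sum>t<m. c * (real (q t) - real (r t)) * v t i\<bar>"
      by (simp add: X_def sum_subtractf algebra_simps)
    also have "\<dots> \<le> (\<Sum>t<m. c * \<bar>v t i\<bar>)"
    proof (rule order.trans[OF sum_abs], rule sum_mono)
      fix t assume "t \<in> {..<m}"
      then have "\<bar>real (q t) - real (r t)\<bar> \<le> 1" using r by force
      then have "\<bar>real (q t) - real (r t)\<bar> * (c * \<bar>v t i\<bar>) \<le> 1 * (c * \<bar>v t i\<bar>)"
        using c by (intro mult_right_mono) auto
      then show "\<bar>c * (real (q t) - real (r t)) * v t i\<bar> \<le> c * \<bar>v t i\<bar>"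
        using c by (simp add: abs_mult ac_simps)
    qed
    also have "\<dots> = c * (\<Sum>t<m. \<bar>v t i\<bar>)" by (simp add: sum_distrib_left)
    also have "\<dots> \<le> c * (\<Sum>t<m. \<Sum>i<n. \<bar>v t i\<bar>)"
      using c i by (intro mult_left_mono sum_mono member_le_sum) auto
    also have "\<dots> < c * (1 + (\<Sum>t<m. \<Sum>i<n. \<bar>v t i\<bar>))" using c by simp
    also have "\<dots> = d" using S0 by (simp add: c_def)
    finally show "\<bar>X q i - X r i\<bar> < d" .
  qed
  obtain r r' where r: "\<forall>j<m. q j \<le> r j \<and> r j \<le> q j + 1" "\<forall>j<m. q j \<le> r' j \<and> r' j \<le> q j + 1"
    "label r s \<noteq> label r' s" using q s(1) by blast
  have "label r s = label r' s"
    using s(2)[OF near[OF r(1)]] s(2)[OF near[OF r(2)]] by (simp add: label_def)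
  then show False using r(3) by contradiction
qed

lemma homogeneous_system:
  fixes b :: "nat \<Rightarrow> nat \<Rightarrow> real"
  assumes "r < n"
  shows "\<exists>a. (\<exists>i<n. a i \<noteq> 0) \<and> (\<forall>l<r. (\<Sum>i<n. a i * b l i) = 0)"
  using assms
proof (induction r arbitrary: n b)
  case 0
  then show ?case by (intro exI[of _ "\<lambda>_. 1"]) auto
next
  case (Suc r)
  then obtain n' where n: "n = Suc n'" "r < n'" by (cases n) auto
  show ?case
  proof (cases "\<forall>l<Suc r. b l n' = 0")
    case True
    then show ?thesis
      unfolding n(1) by (intro exI[of _ "\<lambda>i. if i = n' then 1 else 0"]) auto
  next
    case False
    then obtain l where l: "l < Suc r" "b l n' \<noteq> 0" by blast
    \<comment> \<open>the equation \<open>l\<close> is used to eliminate the last unknown; \<open>\<pi>\<close> enumerates the others\<close>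
    define \<pi> where "\<pi> = (\<lambda>j. if j < l then j else Suc j)"
    define b' where "b' = (\<lambda>j i. b (\<pi> j) i - b (\<pi> j) n' / b l n' * b l i)"
    obtain a where a: "\<exists>i<n'. a i \<noteq> 0" "\<forall>j<r. (\<Sum>i<n'. a i * b' j i) = 0"
      using Suc.IH[OF n(2), of b'] by blast
    define a' where "a' = (\<lambda>i. if i < n' then a i else - (\<Sum>i<n'. a i * b l i) / b l n')"
    have sum: "(\<Sum>i<n. a' i * b j i) = (\<Sum>i<n'. a i * b j i) - b j n' / b l n' * (\<Sum>i<n'. a i * b l i)" for j
      unfolding n(1) by (simp add: a'_def field_simps)
    have "(\<Sum>i<n. a' i * b j i) = 0" if j: "j < Suc r" for j
    proof (cases "j = l")
      case True
      then show ?thesis using l(2) by (simp add: sum)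
    next
      case False
      define j' where "j' = (if j < l then j else j - 1)"
      have j': "j' < r" "\<pi> j' = j" using False j l(1) by (auto simp: j'_def \<pi>_def)
      have "0 = (\<Sum>i<n'. a i * b' j' i)" using a(2) j'(1) by simp
      also have "\<dots> = (\<Sum>i<n'. a i * b j i) - b j n' / b l n' * (\<Sum>i<n'. a i * b l i)"
        by (simp add: b'_def j'(2) sum_subtractf sum_distrib_left algebra_simps)
      finally show ?thesis by (simp add: sum)
    qed
    moreover have "\<exists>i<n. a' i \<noteq> 0" using a(1) n(1) by (auto simp: a'_def intro: less_SucI)
    ultimately show ?thesis by blast
  qed
qed

text \<open>
  The covector number \<open>m\<close> has to annihilate its own \<open>k\<close> vectors and the \<open>m\<close> dual vectors already
  chosen: fewer than \<open>n\<close> equations. A step of Gram-Schmidt then produces its dual vector.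
\<close>

lemma biorthogonal_annihilators:
  fixes w :: "nat \<Rightarrow> nat \<Rightarrow> nat \<Rightarrow> real"
  assumes "m + k \<le> n"
  shows "\<exists>a v. (\<forall>s<m. \<forall>j<k. (\<Sum>i<n. a s i * w s j i) = 0) \<and>
      (\<forall>s<m. \<forall>t<m. (\<Sum>i<n. a s i * v t i) = (if s = t then 1 else (0::real)))"
  using assms
proof (induction m)
  case 0
  then show ?case by simp
next
  case (Suc m)
  then obtain a v where av: "\<And>s j. s < m \<Longrightarrow> j < k \<Longrightarrow> (\<Sum>i<n. a s i * w s j i) = 0"
    "\<And>s t. s < m \<Longrightarrow> t < m \<Longrightarrow> (\<Sum>i<n. a s i * v t i) = (if s = t then 1 else (0::real))"
    by (metis Suc_leD add_Suc)
  define b where "b = (\<lambda>l. if l < k then w m l else v (l - k))"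
  have "m + k < n" using Suc.prems by simp
  then obtain e where e: "\<exists>i<n. e i \<noteq> 0" "\<And>l. l < m + k \<Longrightarrow> (\<Sum>i<n. e i * b l i) = 0"
    using homogeneous_system[of "m + k" n b] by blast
  have ew: "(\<Sum>i<n. e i * w m j i) = 0" if "j < k" for j
    using e(2)[of j] that by (simp add: b_def)
  have ev: "(\<Sum>i<n. e i * v t i) = 0" if "t < m" for t
    using e(2)[of "k + t"] that by (simp add: b_def)
  define q where "q = (\<Sum>i<n. e i * e i)"
  have q: "q > 0"
  proof -
    obtain i where "i < n" "e i \<noteq> 0" using e(1) by blast
    then have "0 < e i * e i" "i \<in> {..<n}" by (auto simp: zero_less_mult_iff linorder_neq_iff)
    then show ?thesis unfolding q_def by (intro sum_pos2[where i = i]) auto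
  qed
  define c where "c = (\<lambda>s. (\<Sum>i<n. a s i * e i))"
  define v' where "v' = (\<lambda>t. if t < m then v t else (\<lambda>i. (e i - (\<Sum>s<m. c s * v s i)) / q))"
  define a' where "a' = (\<lambda>s. if s < m then a s else e)"
  have pv: "(\<Sum>i<n. x i * v' m i) = ((\<Sum>i<n. x i * e i) - (\<Sum>s<m. c s * (\<Sum>i<n. x i * v s i))) / q" for x
  proof -
    have "(\<Sum>i<n. x i * v' m i) = (\<Sum>i<n. x i * e i - (\<Sum>s<m. c s * (x i * v s i))) / q"
      by (simp add: v'_def sum_divide_distrib algebra_simps sum_distrib_left)
    also have "(\<Sum>i<n. x i * e i - (\<Sum>s<m. c s * (x i * v s i))) =
        (\<Sum>i<n. x i * e i) - (\<Sum>s<m. c s * (\<Sum>i<n. x i * v s i))"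
      by (simp add: sum_subtractf sum_distrib_left sum.swap[of _ "{..<n}" "{..<m}"])
    finally show ?thesis .
  qed
  have "(\<Sum>i<n. a' s i * w s j i) = 0" if "s < Suc m" "j < k" for s j
    using that av(1) ew by (auto simp: a'_def less_Suc_eq)
  moreover have "(\<Sum>i<n. a' s i * v' t i) = (if s = t then 1 else 0)" if st: "s < Suc m" "t < Suc m" for s t
  proof (cases "t < m")
    case True
    then show ?thesis using st av(2)[of s t] ev[of t] by (auto simp: a'_def v'_def less_Suc_eq)
  next
    case False
    then have t: "t = m" using st by simp
    show ?thesis
    proof (cases "s < m")
      case True
      have "(\<Sum>t<m. c t * (\<Sum>i<n. a s i * v t i)) = (\<Sum>t<m. if t = s then c t else 0)"
        using True av(2) by (intro sum.cong) auto
      then show ?thesis using True t pv[of "a s"] by (simp add: a'_def c_def)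
    next
      case False
      then have "s = m" using st by simp
      then show ?thesis using t pv[of e] ev q by (simp add: a'_def q_def)
    qed
  qed
  ultimately show ?case by blast
qed

section \<open>Discrete gradient descent for a periodic function\<close>

text \<open>
  The lift \<open>G\<close> of a twice differentiable function on the torus, with its first partial derivatives \<open>p\<close>.
  The second derivatives are pure, because the descent below moves one coordinate at a time.
\<close>

locale periodic_C2 =
  fixes n :: nat and G :: "(nat \<Rightarrow> real) \<Rightarrow> real" and p :: "nat \<Rightarrow> (nat \<Rightarrow> real) \<Rightarrow> real"
  assumes G_dep: "\<And>x y. \<forall>i<n. x i = y i \<Longrightarrow> G x = G y"
    and G_shift: "\<And>v x. G (period_shift v x) = G x"
    and partial: "\<And>i x. i < n \<Longrightarrow> ((\<lambda>t. G (x(i := t))) has_real_derivative p i x) (at (x i))"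
    and p_cont: "\<And>i a e. i < n \<Longrightarrow> e > 0 \<Longrightarrow> \<exists>d>0. \<forall>x. near n d a x \<longrightarrow> \<bar>p i x - p i a\<bar> < e"
    and second: "\<And>i a. i < n \<Longrightarrow> \<exists>d>0. \<exists>L. \<forall>x. near n d a x \<longrightarrow>
        (\<exists>D. ((\<lambda>t. p i (x(i := t))) has_real_derivative D) (at (x i)) \<and> \<bar>D\<bar> \<le> L)"
begin

lemma partial_at: "i < n \<Longrightarrow> ((\<lambda>t. G (x(i := t))) has_real_derivative p i (x(i := s))) (at s)"
  using partial[of i "x(i := s)"] by simp

lemma p_dep:
  assumes "i < n" "\<forall>j<n. x j = y j" shows "p i x = p i y"
proof -
  have "(\<lambda>t. G (x(i := t))) = (\<lambda>t. G (y(i := t)))"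
    using assms by (intro ext G_dep) auto
  then show ?thesis using partial[OF assms(1), of x] partial[OF assms(1), of y] assms
    by (metis DERIV_unique)
qed

lemma p_shift:
  assumes "i < n" shows "p i (period_shift v x) = p i x"
proof -
  have eq: "G ((period_shift v x)(i := t + 2 * pi * of_int (v i))) = G (x(i := t))" for t
  proof -
    have "(period_shift v x)(i := t + 2 * pi * of_int (v i)) = period_shift v (x(i := t))"
      by (auto simp: period_shift_def)
    then show ?thesis by (simp add: G_shift)
  qed
  have "((\<lambda>t. G ((period_shift v x)(i := t))) has_real_derivative p i (period_shift v x))
      (at (x i + 2 * pi * of_int (v i)))"
    using partial[OF assms, of "period_shift v x"] by (simp add: period_shift_def)
  then have "((\<lambda>t. G ((period_shift v x)(i := t + 2 * pi * of_int (v i)))) has_real_derivative p i (period_shift v x))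
      (at (x i))"
    by (simp add: DERIV_shift)
  then show ?thesis using partial[OF assms, of x] unfolding eq by (metis DERIV_unique)
qed

lemma p_bounded: "\<exists>B>0. \<forall>i<n. \<forall>x. \<bar>p i x\<bar> \<le> B"
proof -
  have "\<exists>d>0. \<forall>x. \<forall>i<n. \<bar>p i x\<bar> \<le> 1 / d"
  proof (rule uniform_threshold_pointwise)
    fix d d' :: real and x assume "\<forall>i<n. \<bar>p i x\<bar> \<le> 1 / d" "0 < d'" "d' \<le> d"
    moreover then have "1 / d \<le> 1 / d'" by (intro divide_left_mono) auto
    ultimately show "\<forall>i<n. \<bar>p i x\<bar> \<le> 1 / d'" by fastforce
  next
    fix d v x assume "\<forall>i<n. \<bar>p i (period_shift v x)\<bar> \<le> 1 / d"
    then show "\<forall>i<n. \<bar>p i x\<bar> \<le> 1 / d" by (simp add: p_shift)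
  next
    fix a
    have "\<exists>d>0. \<forall>i<m. \<forall>x. near n d a x \<longrightarrow> \<bar>p i x\<bar> \<le> 1 / d" if "m \<le> n" for m
      using that
    proof (induction m)
      case 0 then show ?case by (intro exI[of _ 1]) auto
    next
      case (Suc m)
      then obtain d where d: "d > 0" "\<forall>i<m. \<forall>x. near n d a x \<longrightarrow> \<bar>p i x\<bar> \<le> 1 / d" by auto
      obtain e where e: "e > 0" "\<forall>x. near n e a x \<longrightarrow> \<bar>p m x - p m a\<bar> < 1"
        using p_cont[of m 1 a] Suc.prems by auto
      define f where "f = Min {d, e, 1 / (1 + \<bar>p m a\<bar>)}"
      have f: "f > 0" "f \<le> d" "f \<le> e" "f \<le> 1 / (1 + \<bar>p m a\<bar>)"
        using d(1) e(1) by (auto simp: f_def add_pos_nonneg)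
      have f4: "1 + \<bar>p m a\<bar> \<le> 1 / f" using f(1,4) by (simp add: field_simps)
      have "1 / d \<le> 1 / f" using f(1,2) by (intro divide_left_mono) auto
      have "\<bar>p i x\<bar> \<le> 1 / f" if i: "i < Suc m" and x: "near n f a x" for i x
      proof (cases "i = m")
        case True
        have "\<bar>p m x - p m a\<bar> < 1" using e(2) near_mono[OF x f(3)] by blast
        then show ?thesis using f4 True by simp
      next
        case False
        then have "\<bar>p i x\<bar> \<le> 1 / d" using d(2) near_mono[OF x f(2)] i by (metis less_antisym)
        then show ?thesis using \<open>1 / d \<le> 1 / f\<close> by simp
      qed
      then show ?case using f(1) by blast
    qed
    then show "\<exists>d>0. \<forall>x. near n d a x \<longrightarrow> (\<forall>i<n. \<bar>p i x\<bar> \<le> 1 / d)" by (metis order_refl)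
  qed
  then obtain d where "d > 0" "\<forall>x. \<forall>i<n. \<bar>p i x\<bar> \<le> 1 / d" by blast
  then show ?thesis by (intro exI[of _ "1 / d"]) auto
qed

lemma second_bounded: "\<exists>L>0. \<forall>i<n. \<forall>x. \<exists>D. ((\<lambda>t. p i (x(i := t))) has_real_derivative D) (at (x i)) \<and> \<bar>D\<bar> \<le> L"
proof -
  let ?P = "\<lambda>i x L. \<exists>D. ((\<lambda>t. p i (x(i := t))) has_real_derivative D) (at (x i)) \<and> \<bar>D\<bar> \<le> L"
  have le: "?P i x L'" if "?P i x L" "L \<le> L'" for i x L L' using that by fastforce
  have sh: "?P i x L" if i: "i < n" and P: "?P i (period_shift v x) L" for i x v L
  proof -
    obtain D where D: "((\<lambda>t. p i ((period_shift v x)(i := t))) has_real_derivative D) (at (x i + 2 * pi * of_int (v i)))" "\<bar>D\<bar> \<le> L"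
      using P by (auto simp: period_shift_def)
    have eq: "p i ((period_shift v x)(i := t + 2 * pi * of_int (v i))) = p i (x(i := t))" for t
    proof -
      have "(period_shift v x)(i := t + 2 * pi * of_int (v i)) = period_shift v (x(i := t))"
        by (auto simp: period_shift_def)
      then show ?thesis using i by (simp add: p_shift)
    qed
    from D(1) have "((\<lambda>t. p i ((period_shift v x)(i := t + 2 * pi * of_int (v i)))) has_real_derivative D) (at (x i))"
      by (simp add: DERIV_shift)
    then show ?thesis using D(2) unfolding eq by blast
  qed
  have one: "\<exists>d>0. \<forall>x. ?P i x (1 / d)" if i: "i < n" for i
  proof (rule uniform_threshold_pointwise)
    fix d d' :: real and x assume "?P i x (1 / d)" "0 < d'" "d' \<le> d"
    moreover then have "1 / d \<le> 1 / d'" by (intro divide_left_mono) auto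
    ultimately show "?P i x (1 / d')" using le by blast
  next
    fix d v x assume "?P i (period_shift v x) (1 / d)"
    then show "?P i x (1 / d)" using sh[OF i] by blast
  next
    fix a
    obtain d L where d: "d > 0" "\<forall>x. near n d a x \<longrightarrow> ?P i x L" using second[OF i, of a] by blast
    define f where "f = min d (1 / (1 + \<bar>L\<bar>))"
    have f: "f > 0" "f \<le> d" "f \<le> 1 / (1 + \<bar>L\<bar>)" using d(1) by (auto simp: f_def add_pos_nonneg)
    have "L \<le> 1 / f"
    proof -
      have "1 + \<bar>L\<bar> \<le> 1 / f" using f(1,3) by (simp add: field_simps)
      then show ?thesis by simp
    qed
    then have "?P i x (1 / f)" if "near n f a x" for x
      using d(2) near_mono[OF that f(2)] le by blast
    then show "\<exists>d>0. \<forall>x. near n d a x \<longrightarrow> ?P i x (1 / d)" using f(1) by blast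
  qed
  then obtain d where d: "\<And>i. i < n \<Longrightarrow> d i > 0" "\<And>i x. i < n \<Longrightarrow> ?P i x (1 / d i)" by metis
  define L where "L = 1 + (\<Sum>i<n. 1 / d i)"
  have "1 / d i \<le> L" if "i < n" for i
  proof -
    have "1 / d i \<le> (\<Sum>i<n. 1 / d i)" using that d(1) by (intro member_le_sum) (auto simp: less_imp_le)
    then show ?thesis by (simp add: L_def)
  qed
  then have "\<forall>i<n. \<forall>x. ?P i x L" using d(2) le by blast
  moreover have "L > 0"
  proof -
    have "(\<Sum>i<n. 1 / d i) \<ge> 0" using d(1) by (intro sum_nonneg) (simp add: less_imp_le)
    then show ?thesis by (simp add: L_def)
  qed
  ultimately show ?thesis by blast
qed

lemma mean_value_coordinate:
  assumes i: "i < n"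
  shows "\<exists>\<xi>. min (x i) s \<le> \<xi> \<and> \<xi> \<le> max (x i) s \<and> G (x(i := s)) - G x = (s - x i) * p i (x(i := \<xi>))"
proof -
  have d: "((\<lambda>t. G (x(i := t))) has_real_derivative p i (x(i := t))) (at t)" for t
    by (rule partial_at[OF i])
  consider "s = x i" | "s < x i" | "x i < s" by linarith
  then show ?thesis
  proof cases
    case 1 then show ?thesis by (intro exI[of _ s]) auto
  next
    case 2
    obtain \<xi> where "s < \<xi>" "\<xi> < x i" "G (x(i := x i)) - G (x(i := s)) = (x i - s) * p i (x(i := \<xi>))"
      using MVT2[OF 2, of "\<lambda>t. G (x(i := t))" "\<lambda>t. p i (x(i := t))"] d by blast
    then show ?thesis by (intro exI[of _ \<xi>]) (auto simp: algebra_simps)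
  next
    case 3
    obtain \<xi> where "x i < \<xi>" "\<xi> < s" "G (x(i := s)) - G (x(i := x i)) = (s - x i) * p i (x(i := \<xi>))"
      using MVT2[OF 3, of "\<lambda>t. G (x(i := t))" "\<lambda>t. p i (x(i := t))"] d by blast
    then show ?thesis by (intro exI[of _ \<xi>]) (auto simp: algebra_simps)
  qed
qed

text \<open>
  Change the coordinates from \<open>x\<close> to \<open>y\<close> one after the other; the intermediate points stay in the
  box, since a box is a product of intervals.
\<close>

lemma increment_bound:
  assumes B: "\<And>i z. i < n \<Longrightarrow> near n d a z \<Longrightarrow> \<bar>p i z\<bar> \<le> B"
    and x: "near n d a x" and y: "near n d a y"
  shows "\<bar>G y - G x\<bar> \<le> B * (\<Sum>i<n. \<bar>y i - x i\<bar>)"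
proof -
  define z where "z = (\<lambda>j i. if i < j then y i else x i)"
  have "\<bar>G (z j) - G x\<bar> \<le> B * (\<Sum>i<j. \<bar>y i - x i\<bar>)" if "j \<le> n" for j
    using that
  proof (induction j)
    case 0
    have "z 0 = x" by (simp add: z_def)
    then show ?case by simp
  next
    case (Suc j)
    have zj: "z (Suc j) = (z j)(j := y j)" "z j j = x j" by (auto simp: z_def)
    obtain \<xi> where \<xi>: "min (x j) (y j) \<le> \<xi>" "\<xi> \<le> max (x j) (y j)"
      "G (z (Suc j)) - G (z j) = (y j - x j) * p j ((z j)(j := \<xi>))"
      using mean_value_coordinate[of j "z j" "y j"] Suc.prems zj by auto
    have "near n d a ((z j)(j := \<xi>))"
    proof (intro allI impI)
      fix i assume i: "i < n"
      have "\<bar>a j - x j\<bar> < d" "\<bar>a j - y j\<bar> < d" using x y Suc.prems by auto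
      then have "\<bar>a j - \<xi>\<bar> < d" using \<xi>(1,2) by linarith
      then show "\<bar>a i - ((z j)(j := \<xi>)) i\<bar> < d" using x y i by (auto simp: z_def)
    qed
    then have "\<bar>p j ((z j)(j := \<xi>))\<bar> \<le> B" using B Suc.prems by simp
    then have "\<bar>G (z (Suc j)) - G (z j)\<bar> \<le> \<bar>y j - x j\<bar> * B"
      unfolding \<xi>(3) abs_mult by (intro mult_left_mono) auto
    then show ?case using Suc by (simp add: algebra_simps)
  qed
  from this[of n] have "\<bar>G (z n) - G x\<bar> \<le> B * (\<Sum>i<n. \<bar>y i - x i\<bar>)" by simp
  moreover have "G (z n) = G y" by (rule G_dep) (simp add: z_def)
  ultimately show ?thesis by simp
qed

lemma G_lipschitz: "\<exists>B>0. \<forall>x y. \<bar>G y - G x\<bar> \<le> B * (\<Sum>i<n. \<bar>y i - x i\<bar>)"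
proof -
  obtain B where B: "B > 0" "\<forall>i<n. \<forall>x. \<bar>p i x\<bar> \<le> B" using p_bounded by blast
  have "\<bar>G y - G x\<bar> \<le> B * (\<Sum>i<n. \<bar>y i - x i\<bar>)" for x y
  proof (rule increment_bound)
    show "near n (1 + (\<Sum>i<n. \<bar>y i - x i\<bar>)) x y"
    proof (intro allI impI)
      fix i assume "i < n"
      then have "\<bar>y i - x i\<bar> \<le> (\<Sum>i<n. \<bar>y i - x i\<bar>)" by (intro member_le_sum) auto
      then show "\<bar>x i - y i\<bar> < 1 + (\<Sum>i<n. \<bar>y i - x i\<bar>)" by linarith
    qed
    show "near n (1 + (\<Sum>i<n. \<bar>y i - x i\<bar>)) x x" by (auto intro!: add_pos_nonneg sum_nonneg)
  qed (use B in auto)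
  then show ?thesis using B(1) by blast
qed

lemma G_uniform: "e > 0 \<Longrightarrow> \<exists>d>0. \<forall>x y. near n d x y \<longrightarrow> \<bar>G x - G y\<bar> < e"
proof -
  assume e: "e > 0"
  obtain B where B: "B > 0" "\<And>x y. \<bar>G y - G x\<bar> \<le> B * (\<Sum>i<n. \<bar>y i - x i\<bar>)" using G_lipschitz by blast
  define d where "d = e / (B * (1 + real n))"
  have d: "d > 0" using e B(1) by (simp add: d_def add_pos_nonneg)
  have "\<bar>G x - G y\<bar> < e" if "near n d x y" for x y
  proof -
    have "\<bar>G x - G y\<bar> \<le> B * (\<Sum>i<n. \<bar>x i - y i\<bar>)" by (rule B(2))
    also have "\<dots> \<le> B * (\<Sum>i<n. d)" using that B(1) by (intro mult_left_mono sum_mono) (auto simp: less_imp_le)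
    also have "\<dots> = B * d * real n" by simp
    also have "\<dots> < B * d * (1 + real n)" using B(1) d by (intro mult_strict_left_mono) auto
    also have "\<dots> = e" using B(1) by (simp add: d_def add_nonneg_eq_0_iff)
    finally show ?thesis .
  qed
  then show ?thesis using d by blast
qed

lemma G_bounded: "\<exists>M. \<forall>x. \<bar>G x\<bar> \<le> M"
proof -
  obtain B where B: "B > 0" "\<And>x y. \<bar>G y - G x\<bar> \<le> B * (\<Sum>i<n. \<bar>y i - x i\<bar>)" using G_lipschitz by blast
  have "\<bar>G x\<bar> \<le> \<bar>G (\<lambda>_. 0)\<bar> + B * (\<Sum>i<n. 2 * pi)" for x
  proof -
    define y where "y = period_shift (\<lambda>i. - \<lfloor>x i / (2 * pi)\<rfloor>) x"
    have "\<bar>y i\<bar> \<le> 2 * pi" for i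
    proof -
      have "y i = 2 * pi * frac (x i / (2 * pi))"
        by (simp add: y_def period_shift_def frac_def algebra_simps)
      moreover have "2 * pi * frac (x i / (2 * pi)) \<le> 2 * pi * 1"
        using frac_lt_1[of "x i / (2 * pi)"] by (intro mult_left_mono) auto
      ultimately show ?thesis by simp
    qed
    then have "B * (\<Sum>i<n. \<bar>y i - 0\<bar>) \<le> B * (\<Sum>i<n. 2 * pi)" using B(1) by (intro mult_left_mono sum_mono) auto
    moreover have "\<bar>G y - G (\<lambda>_. 0)\<bar> \<le> B * (\<Sum>i<n. \<bar>y i - 0\<bar>)" by (rule B(2))
    moreover have "G y = G x" by (simp add: y_def G_shift)
    ultimately show ?thesis by linarith
  qed
  then show ?thesis by blast
qed

text \<open>
  A sweep of coordinate descent. Its fixed points are the critical points, and each of its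
  estimates is a statement about functions of one real variable. It replaces the gradient flow.
\<close>

primrec descent :: "real \<Rightarrow> nat \<Rightarrow> (nat \<Rightarrow> real) \<Rightarrow> nat \<Rightarrow> real" where
  "descent h 0 x = x"
| "descent h (Suc i) x = (descent h i x)(i := x i - h * p i (descent h i x))"

lemma descent_above: "j \<le> i \<Longrightarrow> descent h j x i = x i"
  by (induction j) auto

lemma descent_displacement:
  assumes h: "h > 0" "\<And>i z. i < n \<Longrightarrow> h * \<bar>p i z\<bar> < r" "r > 0"
  shows "j \<le> n \<Longrightarrow> near n r (descent h j x) x"
proof (induction j)
  case (Suc j)
  show ?case
  proof (intro allI impI)
    fix i assume i: "i < n"
    have "h * \<bar>p j (descent h j x)\<bar> < r" using h(2) Suc.prems by simp
    then have "\<bar>h * p j (descent h j x)\<bar> < r" using h(1) by (simp add: abs_mult)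
    then show "\<bar>descent h (Suc j) x i - x i\<bar> < r" using Suc i by auto
  qed
qed (use h in auto)

lemma descent_shift: "j \<le> n \<Longrightarrow> descent h j (period_shift v x) = period_shift v (descent h j x)"
proof (induction j)
  case (Suc j)
  then have "descent h j (period_shift v x) = period_shift v (descent h j x)" "j < n" by auto
  then have "descent h (Suc j) (period_shift v x) =
      (period_shift v (descent h j x))(j := period_shift v x j - h * p j (descent h j x))"
    by (simp add: p_shift)
  also have "\<dots> = period_shift v (descent h (Suc j) x)" by (auto simp: period_shift_def)
  finally show ?case .
qed simp

lemma descent_continuous:
  assumes h: "h > 0"
  shows "j \<le> n \<Longrightarrow> e > 0 \<Longrightarrow> \<exists>d>0. \<forall>x. near n d a x \<longrightarrow> near n e (descent h j a) (descent h j x)"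
proof (induction j arbitrary: e)
  case 0 then show ?case by auto
next
  case (Suc j)
  obtain d1 where d1: "d1 > 0" "\<forall>x. near n d1 (descent h j a) x \<longrightarrow> \<bar>p j x - p j (descent h j a)\<bar> < e / (2 * h)"
    using p_cont[of j "e / (2 * h)" "descent h j a"] Suc.prems h by auto
  obtain d where d: "d > 0" "\<forall>x. near n d a x \<longrightarrow> near n (min d1 e) (descent h j a) (descent h j x)"
    using Suc.IH[of "min d1 e"] Suc.prems d1(1) by auto
  have "near n e (descent h (Suc j) a) (descent h (Suc j) x)" if x: "near n (min d (e / 2)) a x" for x
  proof -
    have *: "near n (min d1 e) (descent h j a) (descent h j x)" using d(2) near_mono[OF x, of d] by auto
    then have "\<bar>p j (descent h j x) - p j (descent h j a)\<bar> < e / (2 * h)" using d1(2) near_mono[OF *, of d1] by auto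
    then have "h * \<bar>p j (descent h j x) - p j (descent h j a)\<bar> < h * (e / (2 * h))"
      using h by (intro mult_strict_left_mono) auto
    then have "\<bar>h * p j (descent h j x) - h * p j (descent h j a)\<bar> < e / 2"
      using h by (simp add: abs_mult flip: right_diff_distrib)
    moreover have "\<bar>a j - x j\<bar> < e / 2" using x Suc.prems by auto
    ultimately have "\<bar>(a j - h * p j (descent h j a)) - (x j - h * p j (descent h j x))\<bar> < e" by linarith
    then show ?thesis using * by auto
  qed
  then show ?case using d(1) Suc.prems by (intro exI[of _ "min d (e / 2)"]) auto
qed

text \<open>
  For \<open>h L < 1\<close> the partial derivative keeps its sign during a step, so a step against it decreases \<open>G\<close>.
  The first coordinate with nonzero derivative at \<open>x\<close> is reached with \<open>x\<close> unchanged.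
\<close>

lemma descent_decreasing:
  assumes h: "h > 0" "h * L < 1"
    and L: "\<And>i x. i < n \<Longrightarrow> \<exists>D. ((\<lambda>t. p i (x(i := t))) has_real_derivative D) (at (x i)) \<and> \<bar>D\<bar> \<le> L"
  shows "j \<le> n \<Longrightarrow> G (descent h j x) \<le> G x \<and> ((\<exists>i<j. p i x \<noteq> 0) \<longrightarrow> G (descent h j x) < G x)
    \<and> ((\<forall>i<j. p i x = 0) \<longrightarrow> descent h j x = x)"
proof (induction j)
  case (Suc j)
  define y where "y = descent h j x"
  have j: "j < n" using Suc.prems by simp
  have yj: "y j = x j" by (simp add: y_def descent_above)
  have step: "G (y(j := y j - h * p j y)) \<le> G y \<and> (p j y \<noteq> 0 \<longrightarrow> G (y(j := y j - h * p j y)) < G y)"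
  proof (cases "p j y = 0")
    case True then show ?thesis by simp
  next
    case False
    obtain \<xi> where \<xi>: "min (y j) (y j - h * p j y) \<le> \<xi>" "\<xi> \<le> max (y j) (y j - h * p j y)"
      "G (y(j := y j - h * p j y)) - G y = (y j - h * p j y - y j) * p j (y(j := \<xi>))"
      using mean_value_coordinate[OF j, of y "y j - h * p j y"] by blast
    have xi: "\<bar>\<xi> - y j\<bar> \<le> h * \<bar>p j y\<bar>"
    proof -
      have "\<bar>\<xi> - y j\<bar> \<le> \<bar>h * p j y\<bar>" using \<xi>(1,2) by linarith
      then show ?thesis using h(1) by (simp add: abs_mult)
    qed
    have "\<bar>p j (y(j := \<xi>)) - p j (y(j := y j))\<bar> \<le> L * \<bar>\<xi> - y j\<bar>"
    proof -
      obtain D where D: "\<And>t. ((\<lambda>t. p j (y(j := t))) has_real_derivative D t) (at t)" "\<And>t. \<bar>D t\<bar> \<le> L"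
      proof -
        have "\<exists>D. ((\<lambda>t. p j (y(j := t))) has_real_derivative D) (at s) \<and> \<bar>D\<bar> \<le> L" for s
          using L[OF j, of "y(j := s)"] by simp
        then show ?thesis using that by metis
      qed
      show ?thesis
        using field_differentiable_bound[of UNIV "\<lambda>t. p j (y(j := t))" D L \<xi> "y j"] D by auto
    qed
    also have "\<dots> \<le> L * (h * \<bar>p j y\<bar>)"
    proof -
      have "L \<ge> 0" using L[OF j, of y] by force
      then show ?thesis using xi by (intro mult_left_mono)
    qed
    also have "\<dots> = (h * L) * \<bar>p j y\<bar>" by simp
    also have "\<dots> < 1 * \<bar>p j y\<bar>" using False h(2) by (intro mult_strict_right_mono) auto
    finally have "\<bar>p j (y(j := \<xi>)) - p j y\<bar> < \<bar>p j y\<bar>" by simp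
    then have "p j y * p j (y(j := \<xi>)) > 0" using False by (auto simp: zero_less_mult_iff abs_if split: if_splits)
    then have "h * (p j y * p j (y(j := \<xi>))) > 0" using h(1) by simp
    then show ?thesis using \<xi>(3) by simp
  qed
  have d: "descent h (Suc j) x = y(j := y j - h * p j y)" by (simp add: y_def descent_above)
  have IH: "G y \<le> G x" "(\<exists>i<j. p i x \<noteq> 0) \<Longrightarrow> G y < G x" "(\<forall>i<j. p i x = 0) \<Longrightarrow> y = x"
    using Suc by (auto simp: y_def)
  show ?case unfolding d
  proof (intro conjI impI)
    show "G (y(j := y j - h * p j y)) \<le> G x" using step IH(1) by linarith
    show "G (y(j := y j - h * p j y)) < G x" if "\<exists>i<Suc j. p i x \<noteq> 0"
    proof (cases "\<exists>i<j. p i x \<noteq> 0")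
      case True then show ?thesis using step IH(2)[OF True] by linarith
    next
      case False
      then have "y = x" using IH(3) by blast
      moreover then have "p j y \<noteq> 0" using False that less_Suc_eq by auto
      ultimately show ?thesis using step by simp
    qed
    show "y(j := y j - h * p j y) = x" if "\<forall>i<Suc j. p i x = 0"
    proof -
      have "y = x" using that IH(3) by auto
      then show ?thesis using that by simp
    qed
  qed
qed simp

text \<open>
  The last clause is the quantitative form of strict decrease: away from the critical points a
  step loses a fixed amount of height, by compactness.
\<close>

lemma descent_map:
  assumes r: "r > 0"
  shows "\<exists>\<Phi>. (\<forall>x. near n r (\<Phi> x) x) \<and> (\<forall>x. G (\<Phi> x) \<le> G x) \<and>
    (\<forall>e>0. \<exists>d>0. \<forall>x y. near n d x y \<longrightarrow> near n e (\<Phi> x) (\<Phi> y)) \<and>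
    (\<forall>e>0. \<exists>\<beta>>0. \<forall>x. (\<forall>c. (\<forall>i<n. p i c = 0) \<longrightarrow> \<not> near n e x c) \<longrightarrow> G (\<Phi> x) \<le> G x - \<beta>)"
proof -
  obtain B where B: "B > 0" "\<forall>i<n. \<forall>x. \<bar>p i x\<bar> \<le> B" using p_bounded by blast
  obtain L where L: "L > 0" "\<forall>i<n. \<forall>x. \<exists>D. ((\<lambda>t. p i (x(i := t))) has_real_derivative D) (at (x i)) \<and> \<bar>D\<bar> \<le> L"
    using second_bounded by blast
  define h where "h = min (r / (2 * B)) (1 / (2 * L))"
  have h: "h > 0" "h \<le> r / (2 * B)" "h \<le> 1 / (2 * L)" using r B L by (auto simp: h_def)
  have hL: "h * L < 1" using h(3) L(1) by (simp add: field_simps)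
  have hB: "h * \<bar>p i z\<bar> < r" if "i < n" for i z
  proof -
    have "h * \<bar>p i z\<bar> \<le> h * B" using B that h(1) by (intro mult_left_mono) auto
    also have "\<dots> \<le> r / 2" using h(2) B(1) by (simp add: field_simps)
    also have "\<dots> < r" using r by simp
    finally show ?thesis .
  qed
  define \<Phi> where "\<Phi> = descent h n"
  have dec: "G (\<Phi> x) \<le> G x" "(\<exists>i<n. p i x \<noteq> 0) \<Longrightarrow> G (\<Phi> x) < G x" for x
    using descent_decreasing[OF h(1) hL, of n x] L(2) by (auto simp: \<Phi>_def)
  have sh: "\<Phi> (period_shift v x) = period_shift v (\<Phi> x)" for v x
    by (simp add: \<Phi>_def descent_shift)
  have loc: "\<exists>d>0. \<forall>x. near n d a x \<longrightarrow> near n e (\<Phi> a) (\<Phi> x)" if "e > 0" for a e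
    unfolding \<Phi>_def using descent_continuous[OF h(1), of n e a] that by simp
  have unif: "\<exists>d>0. \<forall>x y. near n d x y \<longrightarrow> near n e (\<Phi> x) (\<Phi> y)" if e: "e > 0" for e
  proof (rule uniform_threshold)
    fix d v x y assume "near n e (\<Phi> (period_shift v x)) (\<Phi> (period_shift v y))"
    then show "near n e (\<Phi> x) (\<Phi> y)" by (simp add: sh near_period_shift)
  next
    fix a
    obtain d where d: "d > 0" "\<forall>x. near n d a x \<longrightarrow> near n (e / 2) (\<Phi> a) (\<Phi> x)"
      using loc[of "e / 2" a] e by auto
    have "near n e (\<Phi> x) (\<Phi> y)" if "near n d a x" "near n d a y" for x y
    proof (rule near_trans)
      show "near n (e / 2) (\<Phi> x) (\<Phi> a)" using d(2) that near_sym by blast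
      show "near n (e / 2) (\<Phi> a) (\<Phi> y)" using d(2) that by blast
    qed simp
    then show "\<exists>d>0. \<forall>x y. near n d a x \<longrightarrow> near n d a y \<longrightarrow> near n e (\<Phi> x) (\<Phi> y)"
      using d(1) by blast
  qed
  have gap: "\<exists>\<beta>>0. \<forall>x. (\<forall>c. (\<forall>i<n. p i c = 0) \<longrightarrow> \<not> near n e x c) \<longrightarrow> G (\<Phi> x) \<le> G x - \<beta>" if e: "e > 0" for e
  proof (rule uniform_threshold_pointwise)
    fix d v x
    assume *: "(\<forall>c. (\<forall>i<n. p i c = 0) \<longrightarrow> \<not> near n e (period_shift v x) c) \<longrightarrow>
       G (\<Phi> (period_shift v x)) \<le> G (period_shift v x) - d"
    show "(\<forall>c. (\<forall>i<n. p i c = 0) \<longrightarrow> \<not> near n e x c) \<longrightarrow> G (\<Phi> x) \<le> G x - d"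
    proof
      assume n: "\<forall>c. (\<forall>i<n. p i c = 0) \<longrightarrow> \<not> near n e x c"
      have "\<not> near n e (period_shift v x) c" if c: "\<forall>i<n. p i c = 0" for c
      proof -
        have "\<forall>i<n. p i (period_shift (\<lambda>i. - v i) c) = 0" using c by (simp add: p_shift)
        then have "\<not> near n e x (period_shift (\<lambda>i. - v i) c)" using n by blast
        moreover have "near n e (period_shift v x) c = near n e x (period_shift (\<lambda>i. - v i) c)"
          by (simp add: period_shift_def algebra_simps)
        ultimately show ?thesis by simp
      qed
      then show "G (\<Phi> x) \<le> G x - d" using * by (simp add: sh G_shift)
    qed
  next
    fix a
    show "\<exists>d>0. \<forall>x. near n d a x \<longrightarrow> (\<forall>c. (\<forall>i<n. p i c = 0) \<longrightarrow> \<not> near n e x c) \<longrightarrow> G (\<Phi> x) \<le> G x - d"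
    proof (cases "\<forall>i<n. p i a = 0")
      case True
      then show ?thesis using e near_sym by blast
    next
      case False
      define g where "g = G a - G (\<Phi> a)"
      have g: "g > 0" using dec(2)[of a] False by (auto simp: g_def)
      obtain d1 where d1: "d1 > 0" "\<forall>x y. near n d1 x y \<longrightarrow> \<bar>G x - G y\<bar> < g / 4" using G_uniform[of "g / 4"] g by auto
      obtain d2 where d2: "d2 > 0" "\<forall>x. near n d2 a x \<longrightarrow> near n d1 (\<Phi> a) (\<Phi> x)" using loc[OF d1(1)] by blast
      define d where "d = Min {d1, d2, g / 4}"
      have d: "d > 0" "d \<le> d1" "d \<le> d2" "d \<le> g / 4" using d1(1) d2(1) g by (auto simp: d_def)
      have "G (\<Phi> x) \<le> G x - d" if x: "near n d a x" for x
      proof -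
        have "\<bar>G a - G x\<bar> < g / 4" using d1(2) near_mono[OF x d(2)] by blast
        moreover have "\<bar>G (\<Phi> a) - G (\<Phi> x)\<bar> < g / 4" using d1(2) d2(2) near_mono[OF x d(3)] by blast
        ultimately show ?thesis using d(4) g_def by linarith
      qed
      then show ?thesis using d(1) by blast
    qed
  qed force
  have "near n r (\<Phi> x) x" for x
    using descent_displacement[OF h(1) hB r, of n] by (simp add: \<Phi>_def)
  then show ?thesis using dec(1) unif gap by (intro exI[of _ \<Phi>] conjI) blast+
qed

end

context periodic_C2 begin

text \<open>
  The radius \<open>R\<close> is chosen first, then the step length, then the loss \<open>\<beta>\<close> of a step taken at
  distance at least \<open>R/2\<close> from the critical set, and last the radius \<open>r\<close> within which the height varies
  by less than \<open>\<beta>/2\<close>. An orbit that visits the \<open>r\<close>-neighbourhood of \<open>C s\<close> twice cannot leave the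
  \<open>R\<close>-neighbourhood in between: it would take a step at distance at least \<open>R/2\<close>, and end up too low.
  In the \<open>R\<close>-neighbourhood consecutive points of the orbit carry the same value of \<open>D s\<close>.
\<close>

theorem critical_pieces_give_strips:
  fixes C :: "nat \<Rightarrow> (nat \<Rightarrow> real) set" and D :: "nat \<Rightarrow> (nat \<Rightarrow> real) \<Rightarrow> real"
    and a :: "nat \<Rightarrow> nat \<Rightarrow> real" and c :: "nat \<Rightarrow> real"
  assumes crit: "\<And>x. (\<forall>i<n. p i x = 0) \<longleftrightarrow> (\<exists>s<m. x \<in> C s)"
    and eta: "\<eta> > 0"
    and sep: "\<And>s t x y. s < m \<Longrightarrow> t < m \<Longrightarrow> x \<in> C s \<Longrightarrow> y \<in> C t \<Longrightarrow> near n \<eta> x y \<Longrightarrow> s = t"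
    and val: "\<And>s x. s < m \<Longrightarrow> x \<in> C s \<Longrightarrow> G x = c s"
    and loc: "\<And>s x y. s < m \<Longrightarrow> x \<in> C s \<Longrightarrow> y \<in> C s \<Longrightarrow> near n \<eta> x y \<Longrightarrow> D s x = D s y"
    and bd: "\<And>s x. s < m \<Longrightarrow> x \<in> C s \<Longrightarrow> \<bar>D s x - (\<Sum>i<n. a s i * x i)\<bar> \<le> B"
  shows "\<exists>V E d B'. d > 0 \<and> (\<forall>x. \<exists>s<m. \<forall>y. near n d x y \<longrightarrow> y \<in> V s \<and> E s y = E s x) \<and>
      (\<forall>s<m. \<forall>y\<in>V s. \<bar>E s y - (\<Sum>i<n. a s i * y i)\<bar> \<le> (B' :: real))"
proof -
  define R where "R = \<eta> / 3"
  have R: "R > 0" "3 * R = \<eta>" using eta by (auto simp: R_def)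
  have R2: "R / 2 > 0" using R(1) by simp
  obtain \<Phi> where \<Phi>: "\<forall>x. near n (R / 2) (\<Phi> x) x" "\<forall>x. G (\<Phi> x) \<le> G x"
      "\<forall>e>0. \<exists>d>0. \<forall>x y. near n d x y \<longrightarrow> near n e (\<Phi> x) (\<Phi> y)"
      "\<forall>e>0. \<exists>\<beta>>0. \<forall>x. (\<forall>c. (\<forall>i<n. p i c = 0) \<longrightarrow> \<not> near n e x c) \<longrightarrow> G (\<Phi> x) \<le> G x - \<beta>"
    using descent_map[OF R2] by (elim exE conjE) (rule that)
  have move: "near n (R / 2) (\<Phi> x) x" for x using \<Phi>(1) by blast
  have dec: "G (\<Phi> x) \<le> G x" for x using \<Phi>(2) by blast
  have unif: "\<exists>d>0. \<forall>x y. near n d x y \<longrightarrow> near n e (\<Phi> x) (\<Phi> y)" if "e > 0" for e using \<Phi>(3) that by blast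
  have gap: "\<exists>\<beta>>0. \<forall>x. (\<forall>c. (\<forall>i<n. p i c = 0) \<longrightarrow> \<not> near n e x c) \<longrightarrow> G (\<Phi> x) \<le> G x - \<beta>" if "e > 0" for e
    using \<Phi>(4) that by blast
  define F where "F = (\<lambda>K. \<Phi> ^^ K)"
  have F_simps: "F 0 x = x" "F (Suc K) x = \<Phi> (F K x)" for K x by (simp_all add: F_def)
  define N where "N = (\<lambda>s e. {x. \<exists>y\<in>C s. near n e x y})"
  \<comment> \<open>the values of \<open>D s\<close> on a neighbourhood of \<open>C s\<close> are those at a nearby point of \<open>C s\<close>\<close>
  define D' where "D' = (\<lambda>s x. D s (SOME y. y \<in> C s \<and> near n R x y))"
  have some: "(SOME y. y \<in> C s \<and> near n R x y) \<in> C s" "near n R x (SOME y. y \<in> C s \<and> near n R x y)"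
    if "x \<in> N s R" for s x
    using someI_ex[of "\<lambda>y. y \<in> C s \<and> near n R x y"] that unfolding N_def by blast+
  have D'_eq: "D' s x = D' s y" if "s < m" "x \<in> N s R" "y \<in> N s R" "near n R x y" for s x y
  proof -
    define x' y' where "x' = (SOME z. z \<in> C s \<and> near n R x z)" and "y' = (SOME z. z \<in> C s \<and> near n R y z)"
    have x': "x' \<in> C s" "near n R x x'" and y': "y' \<in> C s" "near n R y y'"
      using some[OF that(2)] some[OF that(3)] by (auto simp: x'_def y'_def)
    have "near n (2 * R) x' y" by (rule near_trans[OF near_sym[OF x'(2)] that(4)]) simp
    then have "near n \<eta> x' y'" by (rule near_trans[OF _ y'(2)]) (use R in simp)
    then have "D s x' = D s y'" using loc that(1) x'(1) y'(1) by blast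
    then show ?thesis by (simp add: D'_def x'_def y'_def)
  qed
  obtain \<beta> where \<beta>: "\<beta> > 0" "\<And>x. (\<forall>c. (\<forall>i<n. p i c = 0) \<longrightarrow> \<not> near n (R / 2) x c) \<Longrightarrow> G (\<Phi> x) \<le> G x - \<beta>"
    using gap[OF R2] by blast
  have b2: "\<beta> / 2 > 0" using \<beta>(1) by simp
  obtain r0 where r0: "r0 > 0" "\<And>x y. near n r0 x y \<Longrightarrow> \<bar>G x - G y\<bar> < \<beta> / 2"
    using G_uniform[OF b2] by blast
  define r where "r = min r0 R"
  have r: "r > 0" "r \<le> r0" "r \<le> R" using r0(1) R(1) by (auto simp: r_def)
  have Nr: "x \<in> N s R" if xN: "x \<in> N s r" for s x
  proof -
    obtain y where y: "y \<in> C s" "near n r x y" using xN unfolding N_def by blast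
    show ?thesis unfolding N_def using y(1) near_mono[OF y(2) r(3)] by blast
  qed
  have Gr: "\<bar>G x - c s\<bar> < \<beta> / 2" if s: "s < m" and xN: "x \<in> N s r" for s x
  proof -
    obtain y where y: "y \<in> C s" "near n r x y" using xN unfolding N_def by blast
    show ?thesis using r0(2)[OF near_mono[OF y(2) r(2)]] val[OF s y(1)] by simp
  qed
  have G_mono: "G (F K x) \<le> G (F J x)" if "J \<le> K" for J K x
    using that
  proof (induction K)
    case (Suc K)
    then show ?case using dec[of "F K x"] by (cases "J = Suc K") (auto simp: F_simps)
  qed simp
  have stay: "F K x \<in> N s R" if s: "s < m" and J: "F J x \<in> N s r" and J': "F J' x \<in> N s r" and K: "J \<le> K" "K \<le> J'" for s x J J' K
    using K
  proof (induction K rule: dec_induct)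
    case base show ?case by (rule Nr[OF J])
  next
    case (step K)
    show ?case
    proof (rule ccontr)
      assume out: "F (Suc K) x \<notin> N s R"
      have inK: "F K x \<in> N s R" using step by simp
      have notC: "\<not> near n (R / 2) (F K x) e" if e: "\<forall>i<n. p i e = 0" for e
      proof
        assume ne: "near n (R / 2) (F K x) e"
        obtain t where t: "t < m" "e \<in> C t" using e crit by blast
        obtain y where y: "y \<in> C s" "near n R (F K x) y" using inK unfolding N_def by blast
        have "near n \<eta> y e" by (rule near_trans[OF near_sym[OF y(2)] ne]) (use R in simp)
        then have "s = t" using sep[OF s t(1) y(1) t(2)] by blast
        moreover have "near n R (F (Suc K) x) e"
          unfolding F_simps by (rule near_trans[OF move ne]) simp
        ultimately show False using out t(2) unfolding N_def by blast
      qed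
      have "G (F (Suc K) x) \<le> G (F K x) - \<beta>" unfolding F_simps using notC by (intro \<beta>(2)) blast
      moreover have "G (F J' x) \<le> G (F (Suc K) x)" using step by (intro G_mono) simp
      moreover have "G (F K x) \<le> G (F J x)" using step by (intro G_mono) simp
      ultimately show False using Gr[OF s J] Gr[OF s J'] \<beta>(1) by linarith
    qed
  qed
  have D'_const: "D' s (F K x) = D' s (F J x)"
    if s: "s < m" and J: "F J x \<in> N s r" and J': "F J' x \<in> N s r" and K: "J \<le> K" "K \<le> J'" for s x J J' K
    using K
  proof (induction K rule: dec_induct)
    case (step K)
    have "D' s (F (Suc K) x) = D' s (F K x)"
    proof (rule D'_eq[OF s])
      show "F (Suc K) x \<in> N s R" by (rule stay[OF s J J']) (use step in auto)
      show "F K x \<in> N s R" by (rule stay[OF s J J']) (use step in auto)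
      show "near n R (F (Suc K) x) (F K x)"
        unfolding F_simps by (rule near_mono[OF move]) (use R(1) in simp)
    qed
    then show ?case using step by simp
  qed simp
  have D'_unique: "D' s (F J' x) = D' s (F J x)" if "s < m" "F J x \<in> N s r" "F J' x \<in> N s r" for s x J J'
    using D'_const[OF that, of J'] D'_const[OF that(1,3,2), of J] by (cases "J \<le> J'") auto
  have r2: "r / 2 > 0" using r(1) by simp
  obtain \<beta>' where \<beta>': "\<beta>' > 0" "\<And>x. (\<forall>c. (\<forall>i<n. p i c = 0) \<longrightarrow> \<not> near n (r / 2) x c) \<Longrightarrow> G (\<Phi> x) \<le> G x - \<beta>'"
    using gap[OF r2] by blast
  obtain M where M: "\<And>x. \<bar>G x\<bar> \<le> M" using G_bounded by blast
  obtain K0 :: nat where K0: "real K0 > 2 * M / \<beta>'" using reals_Archimedean2 by blast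
  \<comment> \<open>otherwise the height would drop below the minimum of \<open>G\<close>\<close>
  have hit: "\<exists>K\<le>K0. \<exists>s<m. F K x \<in> N s (r / 2)" for x
  proof (rule ccontr)
    assume no: "\<not> ?thesis"
    have "G (F K x) \<le> G x - real K * \<beta>'" if "K \<le> K0" for K
      using that
    proof (induction K)
      case (Suc K)
      have "\<not> near n (r / 2) (F K x) e" if e: "\<forall>i<n. p i e = 0" for e
      proof -
        obtain s where s: "s < m" "e \<in> C s" using crit[of e] e by blast
        have "F K x \<notin> N s (r / 2)" using no Suc_leD[OF Suc.prems] s(1) by blast
        then show ?thesis using s(2) unfolding N_def by blast
      qed
      then have "G (F (Suc K) x) \<le> G (F K x) - \<beta>'" unfolding F_simps by (intro \<beta>'(2)) blast
      then show ?case using Suc by (simp add: algebra_simps)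
    qed (simp add: F_simps)
    from this[of K0] have "real K0 * \<beta>' \<le> 2 * M" using M[of "F K0 x"] M[of x] by simp
    then show False using K0 \<beta>'(1) by (simp add: field_simps)
  qed
  have iter: "\<exists>d>0. \<forall>J\<le>K. \<forall>x y. near n d x y \<longrightarrow> near n (r / 2) (F J x) (F J y)" for K
  proof (induction K)
    case 0
    then show ?case using r(1) by (intro exI[of _ "r / 2"]) (simp add: F_simps)
  next
    case (Suc K)
    obtain d where d: "d > 0" "\<And>J x y. J \<le> K \<Longrightarrow> near n d x y \<Longrightarrow> near n (r / 2) (F J x) (F J y)"
      using Suc.IH by blast
    have it: "\<exists>d>0. \<forall>x y. near n d x y \<longrightarrow> near n e (F J x) (F J y)" if "e > 0" for e J
      using that
    proof (induction J arbitrary: e)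
      case 0 then show ?case by (auto simp: F_simps)
    next
      case (Suc J)
      obtain d where "d > 0" "\<And>x y. near n d x y \<Longrightarrow> near n e (\<Phi> x) (\<Phi> y)" using unif[OF Suc.prems] by blast
      moreover obtain d' where "d' > 0" "\<And>x y. near n d' x y \<Longrightarrow> near n d (F J x) (F J y)"
        using Suc.IH[OF \<open>d > 0\<close>] by blast
      ultimately show ?case unfolding F_simps by blast
    qed
    have "r / 2 > 0" using r(1) by simp
    from it[OF this, of "Suc K"] obtain d' where d': "d' > 0"
      "\<And>x y. near n d' x y \<Longrightarrow> near n (r / 2) (F (Suc K) x) (F (Suc K) y)" by blast
    have "near n (r / 2) (F J x) (F J y)" if J: "J \<le> Suc K" and xy: "near n (min d d') x y" for J x y
    proof (cases "J = Suc K")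
      case True then show ?thesis using d'(2)[OF near_mono[OF xy]] by simp
    next
      case False then show ?thesis using d(2)[OF _ near_mono[OF xy], of J] J by simp
    qed
    then show ?case using d(1) d'(1) by (intro exI[of _ "min d d'"]) auto
  qed
  obtain d where d0: "d > 0" "\<forall>J\<le>K0. \<forall>x y. near n d x y \<longrightarrow> near n (r / 2) (F J x) (F J y)"
    using iter[of K0] by (elim exE conjE) (rule that)
  then have d: "d > 0" "near n (r / 2) (F J x) (F J y)" if "J \<le> K0" "near n d x y" for J x y
    using that by blast+
  define V where "V = (\<lambda>s. {x. \<exists>K\<le>K0. F K x \<in> N s r})"
  define E where "E = (\<lambda>s x. D' s (F (SOME K. K \<le> K0 \<and> F K x \<in> N s r) x))"
  have E_eq: "E s x = D' s (F K x)" if "s < m" "K \<le> K0" "F K x \<in> N s r" for s x K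
  proof -
    have "(SOME K. K \<le> K0 \<and> F K x \<in> N s r) \<le> K0 \<and> F (SOME K. K \<le> K0 \<and> F K x \<in> N s r) x \<in> N s r"
      by (rule someI[of _ K]) (use that in simp)
    then show ?thesis unfolding E_def using D'_unique that by blast
  qed
  have cover: "\<exists>s<m. \<forall>y. near n d x y \<longrightarrow> y \<in> V s \<and> E s y = E s x" for x
  proof -
    obtain K s where K: "K \<le> K0" "s < m" "F K x \<in> N s (r / 2)" using hit by blast
    obtain z where z: "z \<in> C s" "near n (r / 2) (F K x) z" using K(3) unfolding N_def by blast
    have in_r: "F K y \<in> N s r" if "near n d x y" for y
    proof -
      have "near n r (F K y) z"
        by (rule near_trans[OF near_sym[OF d(2)[OF K(1) that]] z(2)]) simp
      then show ?thesis using z(1) unfolding N_def by blast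
    qed
    have "y \<in> V s \<and> E s y = E s x" if y: "near n d x y" for y
    proof -
      have Ky: "F K y \<in> N s r" and Kx: "F K x \<in> N s r" using in_r[OF y] in_r[of x] d0(1) by auto
      have "D' s (F K y) = D' s (F K x)"
      proof (rule D'_eq[OF K(2) Nr[OF Ky] Nr[OF Kx]])
        show "near n R (F K y) (F K x)"
          by (rule near_mono[OF near_sym[OF d(2)[OF K(1) y]]]) (use r in simp)
      qed
      then show ?thesis using Ky E_eq[OF K(2,1) Ky] E_eq[OF K(2,1) Kx] K(1) unfolding V_def by auto
    qed
    then show ?thesis using K(2) by blast
  qed
  have disp: "near n (R * (real K + 1)) (F K x) x" for K x
  proof (induction K)
    case 0 then show ?case using R(1) by (simp add: F_simps)
  next
    case (Suc K)
    show ?case unfolding F_simps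
      by (rule near_trans[OF move Suc]) (use R in \<open>simp add: algebra_simps\<close>)
  qed
  define B' where "B' = B + (\<Sum>s<m. \<Sum>i<n. \<bar>a s i\<bar> * (R * (real K0 + 2)))"
  have bound: "\<bar>E s y - (\<Sum>i<n. a s i * y i)\<bar> \<le> B'" if s: "s < m" and y: "y \<in> V s" for s y
  proof -
    obtain K where K: "K \<le> K0" "F K y \<in> N s r" using y unfolding V_def by blast
    define z where "z = (SOME z. z \<in> C s \<and> near n R (F K y) z)"
    have z: "z \<in> C s" "near n R (F K y) z" using some[OF Nr[OF K(2)]] by (auto simp: z_def)
    have E: "E s y = D s z" using E_eq[OF s K] by (simp add: D'_def z_def)
    have near: "near n (R * (real K0 + 2)) y z"
    proof (rule near_trans[OF near_sym[OF disp[of K y]] z(2)])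
      have "R * (real K + 1) \<le> R * (real K0 + 1)" using K(1) R(1) by (intro mult_left_mono) auto
      then show "R * (real K + 1) + R \<le> R * (real K0 + 2)" by (simp add: algebra_simps)
    qed
    have "\<bar>(\<Sum>i<n. a s i * z i) - (\<Sum>i<n. a s i * y i)\<bar> = \<bar>\<Sum>i<n. a s i * (z i - y i)\<bar>"
      by (simp add: sum_subtractf algebra_simps)
    also have "\<dots> \<le> (\<Sum>i<n. \<bar>a s i\<bar> * (R * (real K0 + 2)))"
    proof (rule order.trans[OF sum_abs], rule sum_mono)
      fix i assume "i \<in> {..<n}"
      then have "\<bar>z i - y i\<bar> \<le> R * (real K0 + 2)" using near by (auto simp: abs_minus_commute less_imp_le)
      then show "\<bar>a s i * (z i - y i)\<bar> \<le> \<bar>a s i\<bar> * (R * (real K0 + 2))"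
        by (simp add: abs_mult mult_left_mono)
    qed
    also have "\<dots> \<le> (\<Sum>s<m. \<Sum>i<n. \<bar>a s i\<bar> * (R * (real K0 + 2)))"
      using s R(1) by (intro member_le_sum[of s "{..<m}"]) (auto intro!: sum_nonneg)
    finally show ?thesis using bd[OF s z(1)] unfolding E B'_def by linarith
  qed
  show ?thesis using d0(1) cover bound by blast
qed

end

section \<open>Lifting circle-valued maps\<close>

lemma open_near_box: "open {x. near n d a x}"
proof -
  have "{x. near n d a x} = (\<Pi>\<^sub>E i\<in>UNIV. if i < n then ball (a i) d else UNIV)"
    by (auto simp: PiE_def Pi_iff dist_real_def split: if_splits)
  moreover have "open \<dots>"
    by (rule open_PiE) (auto intro: finite_subset[of _ "{..<n}"] split: if_splits)
  ultimately show ?thesis by simp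
qed

lemma open_contains_near_box:
  assumes "open U" "y \<in> U"
  shows "\<exists>d>0. \<forall>x. near n d y x \<longrightarrow> (\<forall>i\<ge>n. x i = y i) \<longrightarrow> x \<in> U"
proof -
  have "openin (product_topology (\<lambda>_. euclideanreal) UNIV) U"
    using assms(1) by (simp add: euclidean_product_topology)
  from product_topology_open_contains_basis[OF this assms(2)]
  obtain X where X: "y \<in> (\<Pi>\<^sub>E i\<in>UNIV. X i)" "\<And>i. open (X i)" "(\<Pi>\<^sub>E i\<in>UNIV. X i) \<subseteq> U"
    by auto
  have "\<exists>e>0. ball (y i) e \<subseteq> X i" for i
    using X(1,2) open_contains_ball by (metis PiE_E UNIV_I)
  then obtain e where e: "\<And>i. e i > 0" "\<And>i. ball (y i) (e i) \<subseteq> X i" by metis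
  define d where "d = Min (insert 1 (e ` {..<n}))"
  have "d > 0" using e(1) by (auto simp: d_def)
  moreover have "x \<in> U" if x: "near n d y x" "\<forall>i\<ge>n. x i = y i" for x
  proof -
    have "x i \<in> X i" for i
    proof (cases "i < n")
      case True
      then have "d \<le> e i" unfolding d_def by (intro Min_le) auto
      then have "x i \<in> ball (y i) (e i)" using x(1) True by (auto simp: dist_real_def)
      then show ?thesis using e(2) by blast
    next
      case False
      then have "x i = y i" using x(2) by simp
      then show ?thesis using X(1) by auto
    qed
    then show ?thesis using X(3) by auto
  qed
  ultimately show ?thesis by blast
qed

lemma near_if_continuous_on:
  fixes f :: "(nat \<Rightarrow> real) \<Rightarrow> 'b::metric_space"
  assumes f: "continuous_on S f" and a: "a \<in> S" and e: "e > 0"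
    and dep: "\<And>x y. \<forall>i<n. x i = y i \<Longrightarrow> f x = f y" "\<And>x y. \<forall>i<n. x i = y i \<Longrightarrow> x \<in> S \<Longrightarrow> y \<in> S"
  shows "\<exists>d>0. \<forall>x\<in>S. near n d a x \<longrightarrow> dist (f x) (f a) < e"
proof -
  have "open (ball (f a) e)" by simp
  then obtain U where U: "open U" "U \<inter> S = f -` ball (f a) e \<inter> S"
    using f unfolding continuous_on_open_invariant by blast
  have "a \<in> U" using U(2) a e by auto
  then obtain d where d: "d > 0" "\<forall>x. near n d a x \<longrightarrow> (\<forall>i\<ge>n. x i = a i) \<longrightarrow> x \<in> U"
    using open_contains_near_box[OF U(1)] by blast
  have "dist (f x) (f a) < e" if x: "x \<in> S" "near n d a x" for x
  proof -
    define x' where "x' = (\<lambda>i. if i < n then x i else a i)"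
    have xx: "\<forall>i<n. x i = x' i" by (simp add: x'_def)
    have "x' \<in> S" using dep(2)[OF xx x(1)] .
    moreover have "x' \<in> U" using d(2) x(2) by (simp add: x'_def)
    ultimately have "f x' \<in> ball (f a) e" using U(2) by blast
    then show ?thesis using dep(1)[OF xx] by (simp add: dist_commute)
  qed
  then show ?thesis using d(1) by blast
qed

lemma continuous_integer_path_constant:
  fixes g :: "real \<Rightarrow> real"
  assumes "continuous_on {0..1} g" "\<And>t. t \<in> {0..1} \<Longrightarrow> g t \<in> \<int>"
  shows "g 1 = g 0"
proof -
  have "g constant_on {0..1}"
  proof (rule continuous_discrete_range_constant[OF _ assms(1)])
    fix x :: real assume x: "x \<in> {0..1}"
    show "\<exists>e>0. \<forall>y. y \<in> {0..1} \<and> g y \<noteq> g x \<longrightarrow> e \<le> norm (g y - g x)"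
    proof (intro exI[of _ 1] conjI allI impI)
      fix y assume y: "y \<in> {0..1} \<and> g y \<noteq> g x"
      then have "g y - g x \<in> \<int>" "g y - g x \<noteq> 0" using assms(2) x by auto
      then show "1 \<le> norm (g y - g x)" using Ints_nonzero_abs_ge1[of "g y - g x"] by simp
    qed simp
  qed simp
  then obtain c where "\<And>x. x \<in> {0..1} \<Longrightarrow> g x = c" unfolding constant_on_def by blast
  then show ?thesis by simp
qed

lemma cis_eq_cis_iff: "cis a = cis b \<longleftrightarrow> (\<exists>m::int. a - b = 2 * pi * of_int m)"
proof -
  have "cis a = cis b \<longleftrightarrow> cis (a - b) = 1" by (simp add: cis_divide[symmetric])
  also have "\<dots> \<longleftrightarrow> (\<exists>m::int. a - b = 2 * pi * of_int m)"
  proof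
    assume "cis (a - b) = 1"
    then have "cos (a - b) = 1" by (simp add: complex_eq_iff)
    then show "\<exists>m::int. a - b = 2 * pi * of_int m" by (auto simp: cos_one_2pi_int mult.commute)
  next
    assume "\<exists>m::int. a - b = 2 * pi * of_int m"
    then show "cis (a - b) = 1" using cis_multiple_2pi by auto
  qed
  finally show ?thesis .
qed

lemma cis_Arg_unit: "cmod z = 1 \<Longrightarrow> cis (Arg z) = z"
  by (subst cis_Arg) (auto simp: sgn_eq)

text \<open>
  On a box of half-side \<open>4\<pi>\<close> the angle of \<open>f y\<close> is the angle of \<open>f 0\<close> plus the sum of the small angles
  between the values of \<open>f\<close> at consecutive points of a fine subdivision of the segment from \<open>0\<close> to \<open>y\<close>.
  The change of the angle over a period is an integer multiple of \<open>2\<pi>\<close> that varies continuously with \<open>y\<close>, so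
  shrinking \<open>y\<close> to \<open>0\<close> does not change it. The box exceeds a period, so that a lift can
  follow a point across the boundary of a fundamental domain.
\<close>

lemma continuous_angle:
  fixes f :: "(nat \<Rightarrow> real) \<Rightarrow> complex"
  assumes dep: "\<And>x y. \<forall>j<k. x j = y j \<Longrightarrow> f x = f y"
    and shift: "\<And>v x. f (period_shift v x) = f x"
    and unit: "\<And>x. cmod (f x) = 1"
    and cont: "continuous_on UNIV f"
  shows "\<exists>\<theta> w B. (\<forall>y. (\<forall>j<k. \<bar>y j\<bar> \<le> 4 * pi) \<longrightarrow> cis (\<theta> y) = f y) \<and>
     (\<forall>y. \<bar>\<theta> y\<bar> \<le> (B :: real)) \<and>
     (\<forall>x y. (\<forall>j<k. x j = y j) \<longrightarrow> \<theta> x = \<theta> y) \<and>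
     continuous_on {y. \<forall>j<k. \<bar>y j\<bar> \<le> 4 * pi} \<theta> \<and>
     (\<forall>j<k. \<forall>y. (\<forall>j<k. \<bar>y j\<bar> \<le> 4 * pi) \<longrightarrow> \<bar>y j + 2 * pi\<bar> \<le> 4 * pi \<longrightarrow>
         \<theta> (y(j := y j + 2 * pi)) = \<theta> y + 2 * pi * of_int (w j))"
proof -
  let ?S = "{y. \<forall>j<k. \<bar>y j\<bar> \<le> 4 * pi}"
  have nz: "f x \<noteq> 0" for x using unit[of x] by auto
  have "\<exists>d>0. \<forall>x y. near k d x y \<longrightarrow> dist (f x) (f y) < 1"
  proof (rule uniform_threshold)
    fix a
    have "\<exists>d>0. \<forall>x\<in>UNIV. near k d a x \<longrightarrow> dist (f x) (f a) < 1 / 2"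
      by (rule near_if_continuous_on[OF cont]) (use dep in auto)
    then obtain d where d: "d > 0" "\<forall>x\<in>UNIV. near k d a x \<longrightarrow> dist (f x) (f a) < 1 / 2" by blast
    have "dist (f x) (f y) < 1" if "near k d a x" "near k d a y" for x y
    proof -
      have "dist (f x) (f a) < 1 / 2" "dist (f y) (f a) < 1 / 2" using d(2) that by auto
      then show ?thesis using dist_triangle2[of "f x" "f y" "f a"] by simp
    qed
    then show "\<exists>d>0. \<forall>x y. near k d a x \<longrightarrow> near k d a y \<longrightarrow> dist (f x) (f y) < 1" using d(1) by blast
  qed (use shift in auto)
  then obtain d where d: "d > 0" "\<forall>x y. near k d x y \<longrightarrow> dist (f x) (f y) < 1" by blast
  obtain M :: nat where M: "real M > 4 * pi / d" using reals_Archimedean2 by blast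
  then have M0: "real M > 0" using d(1) by (meson divide_nonneg_pos less_le_trans not_le order_less_imp_le pi_ge_zero mult_nonneg_nonneg zero_le_numeral)
  have Md: "4 * pi / real M < d" using M d(1) M0 by (simp add: field_simps)
  define g where "g = (\<lambda>l y. f (\<lambda>j. real l / real M * y j))"
  define \<theta> where "\<theta> = (\<lambda>y. Arg (f (\<lambda>_. 0)) + (\<Sum>l<M. Arg (g (Suc l) y / g l y)))"
  have near: "dist (g (Suc l) y) (g l y) < 1" if y: "y \<in> ?S" for l y
    unfolding g_def
  proof (rule d(2)[rule_format])
    fix j assume "j < k"
    then have "\<bar>y j\<bar> \<le> 4 * pi" using y by auto
    have "\<bar>real (Suc l) / real M * y j - real l / real M * y j\<bar> = \<bar>y j\<bar> / real M"
      using M0 by (simp add: abs_mult field_simps flip: left_diff_distrib)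
    also have "\<dots> \<le> 4 * pi / real M" using \<open>\<bar>y j\<bar> \<le> 4 * pi\<close> M0 by (simp add: divide_right_mono)
    finally show "\<bar>real (Suc l) / real M * y j - real l / real M * y j\<bar> < d" using Md by simp
  qed
  have nle: "g (Suc l) y / g l y \<notin> \<real>\<^sub>\<le>\<^sub>0" if y: "y \<in> ?S" for l y
  proof -
    have "cmod (g l y) = 1" by (simp add: g_def unit)
    moreover have "g l y \<noteq> 0" by (simp add: g_def nz)
    moreover from this have "g (Suc l) y / g l y - 1 = (g (Suc l) y - g l y) / g l y"
      by (simp add: diff_divide_distrib)
    ultimately have "cmod (g (Suc l) y / g l y - 1) = dist (g (Suc l) y) (g l y)"
      by (simp add: dist_norm norm_divide)
    then have "cmod (g (Suc l) y / g l y - 1) < 1" using near[OF y] by simp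
    then have "\<bar>Re (g (Suc l) y / g l y - 1)\<bar> < 1" using abs_Re_le_cmod le_less_trans by blast
    then have "Re (g (Suc l) y / g l y) > 0" by (simp only: minus_complex.sel one_complex.sel)
    then show ?thesis by (auto simp: complex_nonpos_Reals_iff)
  qed
  have c1: "cis (\<theta> y) = f y" for y
  proof -
    have "cis (Arg (f (\<lambda>_. 0)) + (\<Sum>l<m. Arg (g (Suc l) y / g l y))) = g m y" for m
    proof (induction m)
      case 0 then show ?case by (simp add: g_def cis_Arg_unit unit)
    next
      case (Suc m)
      have "cmod (g (Suc m) y / g m y) = 1" by (simp add: g_def unit norm_divide)
      then show ?case using Suc nz by (simp add: cis_mult[symmetric] cis_Arg_unit add.assoc[symmetric] g_def)
    qed
    from this[of M] show ?thesis using M0 by (simp add: \<theta>_def g_def)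
  qed
  have c2: "\<bar>\<theta> y\<bar> \<le> pi + (\<Sum>l<M. pi)" for y
  proof -
    have A: "\<bar>Arg z\<bar> \<le> pi" for z using Arg_bounded[of z] by auto
    have "\<bar>\<theta> y\<bar> \<le> \<bar>Arg (f (\<lambda>_. 0))\<bar> + \<bar>\<Sum>l<M. Arg (g (Suc l) y / g l y)\<bar>" unfolding \<theta>_def by (rule abs_triangle_ineq)
    also have "\<dots> \<le> pi + (\<Sum>l<M. pi)" by (intro add_mono A order.trans[OF sum_abs] sum_mono)
    finally show ?thesis .
  qed
  have c3: "\<theta> x = \<theta> y" if "\<forall>j<k. x j = y j" for x y
  proof -
    have "g l x = g l y" for l unfolding g_def by (rule dep) (use that in simp)
    then show ?thesis by (simp add: \<theta>_def)
  qed
  have gc: "continuous_on T (g l)" for l T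
    unfolding g_def
    by (rule continuous_on_compose2[OF cont]) (use M0 in \<open>auto intro!: continuous_intros intro: continuous_on_subset[OF continuous_on_product_coordinates]\<close>)
  have c4: "continuous_on ?S \<theta>"
    unfolding \<theta>_def
    by (intro continuous_intros gc) (use nle in \<open>auto simp: g_def nz\<close>)
  define w where "w = (\<lambda>j. SOME m :: int. \<theta> ((\<lambda>_. 0)(j := 2 * pi)) - \<theta> (\<lambda>_. 0) = 2 * pi * of_int m)"
  have c5: "\<theta> (y(j := y j + 2 * pi)) = \<theta> y + 2 * pi * of_int (w j)"
    if j: "j < k" and y: "y \<in> ?S" and yj: "\<bar>y j + 2 * pi\<bar> \<le> 4 * pi" for j y
  proof -
    \<comment> \<open>the ends of a period segment, moved towards the origin\<close>
    define P where "P = (\<lambda>(t::real) i. if i = j then t * y j + 2 * pi else t * y i)"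
    define Q where "Q = (\<lambda>(t::real) i. t * y i)"
    have tb: "\<bar>t * y i\<bar> \<le> 4 * pi" if "t \<in> {0..1}" "i < k" for t i
    proof -
      have "\<bar>t * y i\<bar> \<le> 1 * (4 * pi)" unfolding abs_mult using that y by (intro mult_mono) auto
      then show ?thesis by simp
    qed
    have QS: "Q t \<in> ?S" if "t \<in> {0..1}" for t using tb that by (auto simp: Q_def)
    have PS: "P t \<in> ?S" if t: "t \<in> {0..1}" for t
    proof -
      have "y j \<le> 2 * pi" using yj by linarith
      have "t * y j \<le> 2 * pi"
      proof (cases "y j \<ge> 0")
        case True
        then have "t * y j \<le> 1 * y j" using t by (intro mult_right_mono) auto
        then show ?thesis using \<open>y j \<le> 2 * pi\<close> by simp
      next
        case False
        then have "t * y j \<le> 0" using t by (simp add: mult_nonneg_nonpos)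
        then show ?thesis using pi_ge_zero by linarith
      qed
      moreover have "t * y j \<ge> - (4 * pi)" using tb[OF t j] by linarith
      ultimately have "\<bar>t * y j + 2 * pi\<bar> \<le> 4 * pi" using pi_ge_zero by linarith
      then show ?thesis using tb t by (auto simp: P_def)
    qed
    define h where "h = (\<lambda>t. (\<theta> (P t) - \<theta> (Q t)) / (2 * pi))"
    have fPQ: "f (P t) = f (Q t)" for t
    proof -
      have "P t = period_shift (\<lambda>i. if i = j then 1 else 0) (Q t)"
        by (auto simp: P_def Q_def period_shift_def)
      then show ?thesis by (simp add: shift)
    qed
    have "h t \<in> \<int>" for t
    proof -
      have "cis (\<theta> (P t)) = cis (\<theta> (Q t))" using c1 fPQ by simp
      then show ?thesis unfolding cis_eq_cis_iff by (auto simp: h_def)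
    qed
    moreover have "continuous_on {0..1} h"
      unfolding h_def
    proof (intro continuous_intros)
      have "continuous_on {0..1} (\<lambda>t. P t i)" for i
        unfolding P_def by (cases "i = j") (auto intro!: continuous_intros)
      then have "continuous_on {0..1} P" by (rule continuous_on_coordinatewise_then_product)
      then show "continuous_on {0..1} (\<lambda>t. \<theta> (P t))"
        by (rule continuous_on_compose2[OF c4]) (use PS in blast)
      have "continuous_on {0..1} Q" unfolding Q_def
        by (rule continuous_on_coordinatewise_then_product) (auto intro!: continuous_intros)
      then show "continuous_on {0..1} (\<lambda>t. \<theta> (Q t))"
        by (rule continuous_on_compose2[OF c4]) (use QS in blast)
    qed simp
    ultimately have "h 1 = h 0" by (intro continuous_integer_path_constant) auto
    moreover have "P 1 = y(j := y j + 2 * pi)" "Q 1 = y" "P 0 = (\<lambda>_. 0)(j := 2 * pi)" "Q 0 = (\<lambda>_. 0)"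
      by (auto simp: P_def Q_def)
    ultimately have e: "\<theta> (y(j := y j + 2 * pi)) - \<theta> y = \<theta> ((\<lambda>_. 0)(j := 2 * pi)) - \<theta> (\<lambda>_. 0)"
      by (simp add: h_def)
    have "cis (\<theta> (P 0)) = cis (\<theta> (Q 0))" using c1 fPQ by simp
    then obtain m :: int where "\<theta> ((\<lambda>_. 0)(j := 2 * pi)) - \<theta> (\<lambda>_. 0) = 2 * pi * of_int m"
      unfolding cis_eq_cis_iff using \<open>P 0 = _\<close> \<open>Q 0 = _\<close> by auto
    then have "\<theta> ((\<lambda>_. 0)(j := 2 * pi)) - \<theta> (\<lambda>_. 0) = 2 * pi * of_int (w j)"
      unfolding w_def by (rule someI)
    then show ?thesis using e by simp
  qed
  show ?thesis
    by (intro exI[of _ \<theta>] exI[of _ w] exI[of _ "pi + (\<Sum>l<M. pi)"] conjI) (use c1 c2 c3 c4 c5 in \<open>auto\<close>)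
qed

section \<open>One-forms that are exact on a submanifold\<close>

definition torus_exp :: "nat \<Rightarrow> (nat \<Rightarrow> real) \<Rightarrow> nat \<Rightarrow> complex" where
  "torus_exp n x = restrict (\<lambda>i. cis (x i)) {..<n}"

lemma torus_exp_apply: "i < n \<Longrightarrow> torus_exp n x i = cis (x i)"
  by (simp add: torus_exp_def)

lemma torus_exp_in: "torus_exp n x \<in> topspace (torus n)"
  by (auto simp: torus_exp_def topspace_torus)

lemma torus_exp_shift: "torus_exp n (period_shift v x) = torus_exp n x"
proof
  fix i
  have "cis (x i + 2 * pi * of_int (v i)) = cis (x i)" unfolding cis_eq_cis_iff by auto
  then show "torus_exp n (period_shift v x) i = torus_exp n x i"
    by (simp add: torus_exp_def period_shift_def)
qed

lemma torus_exp_cong: "\<forall>i<n. x i = y i \<Longrightarrow> torus_exp n x = torus_exp n y"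
  by (auto simp: torus_exp_def)

lemma torus_exp_eqI:
  assumes "z \<in> topspace (torus n)" "\<And>i. i < n \<Longrightarrow> cis (x i) = z i" shows "torus_exp n x = z"
  using assms by (auto simp: torus_exp_def topspace_torus PiE_def extensional_def fun_eq_iff)

lemma torus_exp_surj:
  assumes "z \<in> topspace (torus n)"
  shows "torus_exp n (\<lambda>i. if i < n then Arg (z i) else 0) = z"
proof (rule torus_exp_eqI[OF assms])
  fix i assume "i < n"
  then have "cmod (z i) = 1" using assms by (auto simp: topspace_torus PiE_def Pi_iff)
  then show "cis (if i < n then Arg (z i) else 0) = z i" using \<open>i < n\<close> by (simp add: cis_Arg_unit)
qed

lemma torus_exp_eq_iff: "torus_exp n x = torus_exp n y \<longleftrightarrow> (\<exists>v. \<forall>i<n. x i = period_shift v y i)"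
proof
  assume "torus_exp n x = torus_exp n y"
  then have "cis (x i) = cis (y i)" if "i < n" for i using that by (metis torus_exp_apply)
  then have "\<forall>i. \<exists>m::int. i < n \<longrightarrow> x i - y i = 2 * pi * of_int m" unfolding cis_eq_cis_iff by blast
  then obtain v :: "nat \<Rightarrow> int" where v: "\<And>i. i < n \<Longrightarrow> x i - y i = 2 * pi * of_int (v i)" by metis
  have "\<forall>i<n. x i = period_shift v y i" using v by (auto simp: period_shift_def algebra_simps)
  then show "\<exists>v. \<forall>i<n. x i = period_shift v y i" by blast
next
  assume "\<exists>v. \<forall>i<n. x i = period_shift v y i"
  then show "torus_exp n x = torus_exp n y" using torus_exp_cong torus_exp_shift by metis
qed

lemma continuous_map_torus_coordinate: "i < n \<Longrightarrow> continuous_map (torus n) euclidean (\<lambda>z. z i)"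
  using continuous_map_product_projection[of i "{..<n}" "\<lambda>_. circle"]
  by (auto simp: torus_def continuous_map_in_subtopology)

lemma continuous_torus_exp: "continuous_map euclidean (torus n) (torus_exp n)"
  unfolding torus_def continuous_map_componentwise
proof (intro conjI ballI)
  show "torus_exp n ` topspace euclidean \<subseteq> extensional {..<n}" by (auto simp: torus_exp_def)
  show "continuous_map euclidean circle (\<lambda>x. torus_exp n x i)" if "i \<in> {..<n}" for i
  proof -
    have "continuous_on UNIV (\<lambda>x :: nat \<Rightarrow> real. cis (x i))"
      by (auto intro!: continuous_intros)
    then show ?thesis using that by (auto simp: torus_exp_def continuous_map_in_subtopology)
  qed
qed

text \<open>
  The one-form with constant coefficients \<open>a\<close> is exact on \<open>S\<close>: a primitive is \<open>a \<cdot> x - D x\<close>, which is bounded and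
  descends to the torus, and \<open>D\<close> is locally constant on the lift of \<open>S\<close>.
\<close>

definition primitive_on ::
  "nat \<Rightarrow> (nat \<Rightarrow> complex) set \<Rightarrow> (nat \<Rightarrow> real) \<Rightarrow> ((nat \<Rightarrow> real) \<Rightarrow> real) \<Rightarrow> real \<Rightarrow> bool" where
  "primitive_on n S a D B \<longleftrightarrow>
     (\<forall>x. \<bar>D x - (\<Sum>i<n. a i * x i)\<bar> \<le> B) \<and>
     (\<forall>v x. D (period_shift v x) = D x + 2 * pi * (\<Sum>i<n. a i * of_int (v i))) \<and>
     (\<forall>x. torus_exp n x \<in> S \<longrightarrow> (\<exists>d>0. \<forall>x'. torus_exp n x' \<in> S \<longrightarrow> near n d x x' \<longrightarrow> D x' = D x))"

text \<open>
  The vectors \<open>w j\<close> are the periods, in units of \<open>2\<pi>\<close>, of a lift \<open>\<theta>\<close> of the parametrization of \<open>S\<close> by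
  the \<open>k\<close>-torus. If \<open>a\<close> annihilates them, then \<open>a \<cdot> \<theta>\<close> is periodic, hence a function on \<open>S\<close>, and it is
  the primitive: nearby points of the lift of \<open>S\<close> differ by the difference of their \<open>\<theta>\<close>, as the two
  differences agree modulo \<open>2\<pi>\<close> and both are small.
\<close>

lemma annihilators_have_primitives:
  assumes S: "S \<subseteq> topspace (torus n)" and hom: "subtopology (torus n) S homeomorphic_space torus k"
  shows "\<exists>w :: nat \<Rightarrow> nat \<Rightarrow> real. \<forall>a. (\<forall>j<k. (\<Sum>i<n. a i * w j i) = 0) \<longrightarrow> (\<exists>D B. primitive_on n S a D B)"
proof -
  obtain r q where rq: "homeomorphic_maps (subtopology (torus n) S) (torus k) r q"
    using hom unfolding homeomorphic_space_def by blast
  have topS: "topspace (subtopology (torus n) S) = S" using S by auto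
  have r: "continuous_map (subtopology (torus n) S) (torus k) r"
    and q: "continuous_map (torus k) (subtopology (torus n) S) q"
    and qr: "\<And>z. z \<in> S \<Longrightarrow> q (r z) = z"
    using rq topS by (auto simp: homeomorphic_maps_def)
  have qn: "continuous_map (torus k) (torus n) q" using q by (simp add: continuous_map_in_subtopology)
  define R where "R = {y :: nat \<Rightarrow> real. \<forall>j<k. \<bar>y j\<bar> \<le> 4 * pi}"
  define f where "f = (\<lambda>i y. q (torus_exp k y) i)"
  define P where "P = (\<lambda>i \<theta> w (B :: real). (\<forall>y. (\<forall>j<k. \<bar>y j\<bar> \<le> 4 * pi) \<longrightarrow> cis (\<theta> y) = f i y) \<and>
     (\<forall>y. \<bar>\<theta> y\<bar> \<le> B) \<and>
     (\<forall>x y. (\<forall>j<k. x j = y j) \<longrightarrow> \<theta> x = \<theta> y) \<and>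
     continuous_on {y. \<forall>j<k. \<bar>y j\<bar> \<le> 4 * pi} \<theta> \<and>
     (\<forall>j<k. \<forall>y. (\<forall>j<k. \<bar>y j\<bar> \<le> 4 * pi) \<longrightarrow> \<bar>y j + 2 * pi\<bar> \<le> 4 * pi \<longrightarrow>
         \<theta> (y(j := y j + 2 * pi)) = \<theta> y + 2 * pi * of_int (w j :: int)))"
  have "\<exists>\<theta> w B. P i \<theta> w B" if i: "i < n" for i
    unfolding P_def
  proof (rule continuous_angle)
    show "f i x = f i y" if "\<forall>j<k. x j = y j" for x y
      using torus_exp_cong[OF that] by (simp add: f_def)
    show "f i (period_shift v x) = f i x" for v x by (simp add: f_def torus_exp_shift)
    show "cmod (f i x) = 1" for x
      using continuous_map_image_subset_topspace[OF qn] torus_exp_in[of k x] i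
      by (force simp: f_def topspace_torus PiE_def Pi_iff)
    have "continuous_map euclidean euclidean ((\<lambda>z. z i) \<circ> (q \<circ> torus_exp k))"
      by (intro continuous_map_compose[OF _ continuous_map_torus_coordinate[OF i]]
          continuous_map_compose[OF continuous_torus_exp qn])
    then show "continuous_on UNIV (f i)" by (simp add: f_def o_def)
  qed
  then obtain \<theta> W Bd where P: "\<And>i. i < n \<Longrightarrow> P i (\<theta> i) (W i) (Bd i)" by metis
  have \<theta>: "y \<in> R \<Longrightarrow> cis (\<theta> i y) = f i y" "\<bar>\<theta> i y\<bar> \<le> Bd i"
      "\<forall>j<k. x j = y j \<Longrightarrow> \<theta> i x = \<theta> i y" "continuous_on R (\<theta> i)"
      "j < k \<Longrightarrow> y \<in> R \<Longrightarrow> \<bar>y j + 2 * pi\<bar> \<le> 4 * pi \<Longrightarrow>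
         \<theta> i (y(j := y j + 2 * pi)) = \<theta> i y + 2 * pi * of_int (W i j)"
    if "i < n" for i j x y
    using P[OF that] unfolding P_def R_def mem_Collect_eq by blast+
  define w :: "nat \<Rightarrow> nat \<Rightarrow> real" where "w = (\<lambda>j i. of_int (W i j))"
  define Y where "Y = (\<lambda>\<zeta> :: nat \<Rightarrow> complex. \<lambda>j. if j < k then Arg (\<zeta> j) else 0)"
  show ?thesis
  proof (intro exI[of _ w] allI impI)
    fix a :: "nat \<Rightarrow> real"
    assume a: "\<forall>j<k. (\<Sum>i<n. a i * w j i) = 0"
    define L where "L = (\<lambda>y. \<Sum>i<n. a i * \<theta> i y)"
    define D where "D = (\<lambda>x. (\<Sum>i<n. a i * x i) - L (Y (r (torus_exp n x))))"
    have Lstep: "L (y(j := y j + 2 * pi)) = L y" if "j < k" "y \<in> R" "\<bar>y j + 2 * pi\<bar> \<le> 4 * pi" for y j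
    proof -
      have "L (y(j := y j + 2 * pi)) = (\<Sum>i<n. a i * \<theta> i y + 2 * pi * (a i * w j i))"
        unfolding L_def using \<theta>(5) that by (intro sum.cong) (auto simp: w_def algebra_simps)
      also have "\<dots> = L y + 2 * pi * (\<Sum>i<n. a i * w j i)"
        by (simp add: L_def sum.distrib sum_distrib_left)
      finally show ?thesis using a that(1) by simp
    qed
    \<comment> \<open>two lifts of one point of the k-torus, close enough, differ by at most one period in each coordinate\<close>
    have Lper: "L y = L y'" if y: "\<forall>j<k. \<bar>y j\<bar> \<le> 2 * pi" and y': "\<forall>j<k. \<bar>y' j\<bar> \<le> pi" and e: "torus_exp k y = torus_exp k y'" for y y'
    proof -
      have diff: "y j = y' j \<or> y j = y' j + 2 * pi \<or> y' j = y j + 2 * pi" if j: "j < k" for j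
      proof -
        have "cis (y j) = cis (y' j)" using e j by (metis torus_exp_apply)
        then obtain m :: int where m: "y j - y' j = 2 * pi * of_int m" unfolding cis_eq_cis_iff by blast
        have "\<bar>y j - y' j\<bar> \<le> 3 * pi" using y y' j by (smt (verit))
        then have "2 * pi * \<bar>of_int m\<bar> \<le> 3 * pi" using m by (simp add: abs_mult)
        then have "2 * \<bar>real_of_int m\<bar> \<le> 3" using pi_gt_zero by (simp add: mult.assoc mult.left_commute)
        then have "\<bar>m\<bar> \<le> 1" by linarith
        then have "m = 0 \<or> m = 1 \<or> m = -1" by linarith
        then show ?thesis using m by auto
      qed
      define u where "u = (\<lambda>l j. if j < l then y j else y' j)"
      have uR: "\<forall>j<k. \<bar>u l j\<bar> \<le> 2 * pi" for l using y y' pi_ge_zero by (fastforce simp: u_def)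
      have "L (u l) = L y'" if "l \<le> k" for l
        using that
      proof (induction l)
        case 0 then show ?case by (simp add: u_def)
      next
        case (Suc l)
        have l: "l < k" using Suc.prems by simp
        have us: "u (Suc l) = (u l)(l := y l)" "u l l = y' l" by (auto simp: u_def)
        have b: "\<bar>y l\<bar> \<le> 2 * pi" "\<bar>y' l\<bar> \<le> 2 * pi" using y y' l pi_ge_zero by (fastforce)+
        have R4: "u m \<in> R" for m using uR[of m] pi_ge_zero by (fastforce simp: R_def)
        have "L (u (Suc l)) = L (u l)"
          using diff[OF l]
        proof (elim disjE)
          assume "y l = y' l"
          then have "u (Suc l) = u l" using us by auto
          then show ?thesis by simp
        next
          assume d: "y l = y' l + 2 * pi"
          have "\<bar>u l l + 2 * pi\<bar> \<le> 4 * pi" using us b by linarith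
          from Lstep[OF l R4 this] show ?thesis using us d by simp
        next
          assume d: "y' l = y l + 2 * pi"
          have v: "u (Suc l) l = y l" using us by simp
          have "\<bar>u (Suc l) l + 2 * pi\<bar> \<le> 4 * pi" using v b by linarith
          from Lstep[OF l R4 this] have "L ((u (Suc l))(l := y l + 2 * pi)) = L (u (Suc l))" using v by simp
          moreover have "(u (Suc l))(l := y l + 2 * pi) = u l" using us d by auto
          ultimately show ?thesis by simp
        qed
        then show ?case using Suc by simp
      qed
      from this[of k] have "L (u k) = L y'" by simp
      moreover have "L (u k) = L y" unfolding L_def using \<theta>(3) by (intro sum.cong) (auto simp: u_def)
      ultimately show ?thesis by simp
    qed
    have D1: "\<bar>D x - (\<Sum>i<n. a i * x i)\<bar> \<le> (\<Sum>i<n. \<bar>a i\<bar> * Bd i)" for x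
    proof -
      have "\<bar>L y\<bar> \<le> (\<Sum>i<n. \<bar>a i\<bar> * Bd i)" for y
        unfolding L_def by (rule order.trans[OF sum_abs]) (auto intro!: sum_mono mult_left_mono \<theta>(2) simp: abs_mult)
      then show ?thesis by (simp add: D_def)
    qed
    have D2: "D (period_shift v x) = D x + 2 * pi * (\<Sum>i<n. a i * of_int (v i))" for v x
      unfolding D_def torus_exp_shift
      by (simp add: period_shift_def algebra_simps sum.distrib sum_distrib_left)
    have D3: "\<exists>d>0. \<forall>x'. torus_exp n x' \<in> S \<longrightarrow> near n d x x' \<longrightarrow> D x' = D x" if x: "torus_exp n x \<in> S" for x
    proof -
      define T where "T = {x. torus_exp n x \<in> S}"
      define \<zeta> where "\<zeta> = (\<lambda>x. r (torus_exp n x))"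
      have \<zeta>top: "\<zeta> x' \<in> topspace (torus k)" if "x' \<in> T" for x'
        using continuous_map_image_subset_topspace[OF r] that topS by (auto simp: \<zeta>_def T_def)
      have unit: "cmod (\<zeta> x' j) = 1" if "x' \<in> T" "j < k" for x' j
        using \<zeta>top[OF that(1)] that(2) by (auto simp: topspace_torus PiE_def Pi_iff)
      have \<zeta>cont: "continuous_on T (\<lambda>x. \<zeta> x j)" if j: "j < k" for j
      proof -
        have "continuous_map (top_of_set T) (subtopology (torus n) S) (torus_exp n)"
          using continuous_map_from_subtopology[OF continuous_torus_exp, of T n]
          by (auto simp: continuous_map_in_subtopology T_def)
        from continuous_map_compose[OF continuous_map_compose[OF this r] continuous_map_torus_coordinate[OF j]]
        show ?thesis by (simp add: \<zeta>_def o_def)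
      qed
      define y where "y = Y (\<zeta> x)"
      have xT: "x \<in> T" using x by (simp add: T_def)
      have yb: "\<bar>Y z j\<bar> \<le> pi" if "j < k" for z j using that Arg_bounded[of "z j"] by (auto simp: Y_def)
      have eY: "torus_exp k (Y z) = z" if "z \<in> topspace (torus k)" for z
        unfolding Y_def by (rule torus_exp_surj[OF that])
      have yR: "y \<in> R" using yb[of _ "\<zeta> x"] pi_ge_zero by (fastforce simp: R_def y_def)
      \<comment> \<open>the lift of the moving point that stays close to the lift y of the fixed one\<close>
      define y' where "y' = (\<lambda>x' j. if j < k then y j + Arg (\<zeta> x' j / \<zeta> x j) else 0)"
      have lift_close: "\<exists>d>0. \<forall>x'\<in>T. near n d x x' \<longrightarrow> near k e y (y' x')" if e: "e > 0" for e
      proof -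
        have one: "\<exists>d>0. \<forall>x'\<in>T. near n d x x' \<longrightarrow> \<bar>Arg (\<zeta> x' j / \<zeta> x j)\<bar> < e" if j: "j < k" for j
        proof -
          have "isCont Arg 1" by (rule continuous_at_Arg) auto
          then obtain c where c: "c > 0" "\<And>z. dist z 1 < c \<Longrightarrow> \<bar>Arg z\<bar> < e"
            unfolding continuous_at_eps_delta using e by (metis Arg_1 dist_0_norm dist_commute real_norm_def)
          obtain d where d: "d > 0" "\<forall>x'\<in>T. near n d x x' \<longrightarrow> dist (\<zeta> x' j) (\<zeta> x j) < c"
          proof -
            have "\<exists>d>0. \<forall>x'\<in>T. near n d x x' \<longrightarrow> dist (\<zeta> x' j) (\<zeta> x j) < c"
              by (rule near_if_continuous_on[OF \<zeta>cont[OF j] xT c(1)])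
                 (auto simp: \<zeta>_def T_def dest: torus_exp_cong)
            then show ?thesis using that by blast
          qed
          have "\<bar>Arg (\<zeta> x' j / \<zeta> x j)\<bar> < e" if x': "x' \<in> T" "near n d x x'" for x'
          proof (rule c(2))
            have nz: "\<zeta> x j \<noteq> 0" using unit[OF xT j] by auto
            then have "\<zeta> x' j / \<zeta> x j - 1 = (\<zeta> x' j - \<zeta> x j) / \<zeta> x j" by (simp add: diff_divide_distrib)
            then have "dist (\<zeta> x' j / \<zeta> x j) 1 = dist (\<zeta> x' j) (\<zeta> x j)"
              using unit[OF xT j] by (simp add: dist_norm norm_divide)
            then show "dist (\<zeta> x' j / \<zeta> x j) 1 < c" using d(2) x' by simp
          qed
          then show ?thesis using d(1) by blast
        qed
        obtain d where d: "\<And>j. j < k \<Longrightarrow> d j > 0"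
          "\<And>j x'. j < k \<Longrightarrow> x' \<in> T \<Longrightarrow> near n (d j) x x' \<Longrightarrow> \<bar>Arg (\<zeta> x' j / \<zeta> x j)\<bar> < e"
          using one by metis
        define d' where "d' = Min (insert 1 (d ` {..<k}))"
        have d': "d' > 0" "\<And>j. j < k \<Longrightarrow> d' \<le> d j" using d(1) by (auto simp: d'_def)
        have "near k e y (y' x')" if x': "x' \<in> T" "near n d' x x'" for x'
        proof (intro allI impI)
          fix j assume j: "j < k"
          have "\<bar>Arg (\<zeta> x' j / \<zeta> x j)\<bar> < e" by (rule d(2)[OF j x'(1) near_mono[OF x'(2) d'(2)[OF j]]])
          then show "\<bar>y j - y' x' j\<bar> < e" using j by (simp add: y'_def)
        qed
        then show ?thesis using d'(1) by blast
      qed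
      have ey': "torus_exp k (y' x') = \<zeta> x'" if x': "x' \<in> T" for x'
      proof (rule torus_exp_eqI[OF \<zeta>top[OF x']])
        fix j assume j: "j < k"
        have u: "cmod (\<zeta> x' j / \<zeta> x j) = 1" using unit[OF xT j] unit[OF x' j] by (simp add: norm_divide)
        have "cis (y j) = \<zeta> x j" using j unit[OF xT j] by (simp add: y_def Y_def cis_Arg_unit)
        moreover have "\<zeta> x j \<noteq> 0" using unit[OF xT j] by auto
        ultimately show "cis (y' x' j) = \<zeta> x' j"
          using j cis_Arg_unit[OF u] by (simp add: y'_def cis_mult[symmetric])
      qed
      have \<theta>c: "\<exists>d>0. \<forall>y'\<in>R. near k d y y' \<longrightarrow> (\<forall>i<m. \<bar>\<theta> i y' - \<theta> i y\<bar> < 1)" if "m \<le> n" for m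
        using that
      proof (induction m)
        case 0 then show ?case by (intro exI[of _ 1]) auto
      next
        case (Suc m)
        then obtain d where d: "d > 0" "\<And>y' i. y'\<in>R \<Longrightarrow> near k d y y' \<Longrightarrow> i < m \<Longrightarrow> \<bar>\<theta> i y' - \<theta> i y\<bar> < 1" by force
        have m: "m < n" using Suc.prems by simp
        have "\<exists>d>0. \<forall>y'\<in>R. near k d y y' \<longrightarrow> dist (\<theta> m y') (\<theta> m y) < 1"
          by (rule near_if_continuous_on[OF \<theta>(4)[OF m] yR]) (use \<theta>(3)[OF m] in \<open>auto simp: R_def\<close>)
        then obtain d' where d': "d' > 0" "\<And>y'. y'\<in>R \<Longrightarrow> near k d' y y' \<Longrightarrow> \<bar>\<theta> m y' - \<theta> m y\<bar> < 1"
          unfolding dist_real_def by blast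
        have "\<bar>\<theta> i z - \<theta> i y\<bar> < 1" if "z \<in> R" "near k (min d d') y z" "i < Suc m" for z i
          using d(2)[OF that(1) near_mono[OF that(2)]] d'(2)[OF that(1) near_mono[OF that(2)]] that(3)
          by (cases "i = m") auto
        then show ?case using d(1) d'(1) by (intro exI[of _ "min d d'"]) auto
      qed
      obtain d1 where d1: "d1 > 0" "\<And>y' i. y'\<in>R \<Longrightarrow> near k d1 y y' \<Longrightarrow> i < n \<Longrightarrow> \<bar>\<theta> i y' - \<theta> i y\<bar> < 1"
        using \<theta>c[of n] by blast
      define e where "e = min d1 pi"
      have e: "e > 0" "e \<le> d1" "e \<le> pi" using d1(1) by (auto simp: e_def)
      obtain d2 where d2: "d2 > 0" "\<And>x'. x' \<in> T \<Longrightarrow> near n d2 x x' \<Longrightarrow> near k e y (y' x')"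
        using lift_close[OF e(1)] by blast
      have "D x' = D x" if x': "x' \<in> T" "near n (min d2 1) x x'" for x'
      proof -
        have cl: "near k e y (y' x')" by (rule d2(2)[OF x'(1) near_mono[OF x'(2)]]) simp
        have b2: "\<forall>j<k. \<bar>y' x' j\<bar> \<le> 2 * pi"
        proof (intro allI impI)
          fix j assume j: "j < k"
          have "\<bar>y j - y' x' j\<bar> < e" "\<bar>y j\<bar> \<le> pi" using cl j yb[OF j, of "\<zeta> x"] by (auto simp: y_def)
          then show "\<bar>y' x' j\<bar> \<le> 2 * pi" using e(3) by linarith
        qed
        then have y'R: "y' x' \<in> R" using pi_ge_zero by (fastforce simp: R_def)
        have eq: "\<theta> i (y' x') - \<theta> i y = x' i - x i" if i: "i < n" for i
        proof -
          have "cis (\<theta> i (y' x')) = torus_exp n x' i"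
            using \<theta>(1)[OF i y'R] ey'[OF x'(1)] qr[of "torus_exp n x'"] x'(1) by (simp add: f_def \<zeta>_def T_def)
          then have "cis (\<theta> i (y' x')) = cis (x' i)" using i by (simp add: torus_exp_apply)
          then obtain m' :: int where m': "\<theta> i (y' x') - x' i = 2 * pi * of_int m'" unfolding cis_eq_cis_iff by blast
          have "cis (\<theta> i y) = torus_exp n x i"
            using \<theta>(1)[OF i yR] eY[OF \<zeta>top[OF xT]] qr[of "torus_exp n x"] x by (simp add: f_def \<zeta>_def y_def)
          then have "cis (\<theta> i y) = cis (x i)" using i by (simp add: torus_exp_apply)
          then obtain m :: int where m: "\<theta> i y - x i = 2 * pi * of_int m" unfolding cis_eq_cis_iff by blast
          have "\<bar>\<theta> i (y' x') - \<theta> i y\<bar> < 1" by (rule d1(2)[OF y'R near_mono[OF cl e(2)] i])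
          moreover have "\<bar>x i - x' i\<bar> < 1" using x'(2) i by auto
          moreover have "2 * pi * of_int (m' - m) = (\<theta> i (y' x') - \<theta> i y) - (x' i - x i)"
            using m m' by (simp add: algebra_simps)
          ultimately have "\<bar>2 * pi * of_int (m' - m)\<bar> < 2" by linarith
          then have "2 * pi * \<bar>real_of_int (m' - m)\<bar> < 2" by (simp add: abs_mult)
          moreover have "2 * 1 * \<bar>real_of_int (m' - m)\<bar> \<le> 2 * pi * \<bar>real_of_int (m' - m)\<bar>"
            using pi_gt3 by (intro mult_right_mono) auto
          ultimately have "\<bar>real_of_int (m' - m)\<bar> < 1" by argo
          then have "m' = m" by linarith
          then show ?thesis using m m' by simp
        qed
        have "L (y' x') - L y = (\<Sum>i<n. a i * (x' i - x i))"
          unfolding L_def using eq by (simp add: sum_subtractf[symmetric] right_diff_distrib[symmetric])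
        moreover have "L (y' x') = L (Y (\<zeta> x'))"
        proof (rule Lper[OF b2])
          show "\<forall>j<k. \<bar>Y (\<zeta> x') j\<bar> \<le> pi" using yb by blast
          show "torus_exp k (y' x') = torus_exp k (Y (\<zeta> x'))"
            using ey'[OF x'(1)] eY[OF \<zeta>top[OF x'(1)]] by simp
        qed
        ultimately show ?thesis
          by (simp add: D_def \<zeta>_def y_def right_diff_distrib sum_subtractf)
      qed
      then show ?thesis using d2(1) unfolding T_def by (intro exI[of _ "min d2 1"]) auto
    qed
    show "\<exists>D B. primitive_on n S a D B"
      unfolding primitive_on_def
      using D1 D2 D3 by (intro exI[of _ D] exI[of _ "\<Sum>i<n. \<bar>a i\<bar> * Bd i"] conjI) blast+
  qed
qed

section \<open>Charts of the torus and lifts of smooth functions\<close>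

lemma Euclidean_space_top_of_set: "Euclidean_space n = top_of_set {x. \<forall>i\<ge>n. x i = 0}"
  by (simp add: Euclidean_space_def euclidean_product_topology)

lemma continuous_map_Euclidean_subset:
  assumes "W \<subseteq> topspace (Euclidean_space n)"
  shows "continuous_map (subtopology (Euclidean_space n) W) euclideanreal f \<longleftrightarrow> continuous_on W f"
proof -
  have "subtopology (Euclidean_space n) W = top_of_set W"
    using assms by (simp add: Euclidean_space_top_of_set subtopology_subtopology topspace_Euclidean_space Int_absorb1)
  then show ?thesis by simp
qed

lemma openin_Euclidean_box:
  assumes "openin (Euclidean_space n) W" "y \<in> W"
  shows "\<exists>d>0. \<forall>x. near n d y x \<longrightarrow> (\<forall>i\<ge>n. x i = 0) \<longrightarrow> x \<in> W"
proof -
  obtain V where V: "open V" "W = {x. \<forall>i\<ge>n. x i = 0} \<inter> V"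
    using assms(1) unfolding Euclidean_space_top_of_set openin_open by blast
  then have "y \<in> V" "\<forall>i\<ge>n. y i = 0" using assms(2) by auto
  then obtain d where "d > 0" "\<forall>x. near n d y x \<longrightarrow> (\<forall>i\<ge>n. x i = y i) \<longrightarrow> x \<in> V"
    using open_contains_near_box[OF V(1)] by blast
  then show ?thesis using \<open>\<forall>i\<ge>n. y i = 0\<close> V(2) by (intro exI[of _ d]) auto
qed

lemma eventually_update_in:
  assumes "openin (Euclidean_space n) W" "x \<in> W" "i < n"
  shows "\<forall>\<^sub>F t in nhds (x i). x(i := t) \<in> W"
proof -
  obtain d where d: "d > 0" "\<forall>y. near n d x y \<longrightarrow> (\<forall>i\<ge>n. y i = 0) \<longrightarrow> y \<in> W"
    using openin_Euclidean_box[OF assms(1,2)] by blast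
  have x0: "\<forall>i\<ge>n. x i = 0" using openin_subset[OF assms(1)] assms(2) by (auto simp: topspace_Euclidean_space)
  have "x(i := t) \<in> W" if "dist t (x i) < d" for t
    using that d x0 assms(3) by (auto simp: dist_real_def abs_minus_commute)
  then show ?thesis unfolding eventually_nhds_metric using d(1) by blast
qed

lemma has_real_derivative_cong_nhds:
  "\<forall>\<^sub>F t in nhds a. f t = g t \<Longrightarrow>
    (f has_real_derivative D) (at a) \<longleftrightarrow> (g has_real_derivative D) (at a)"
  by (rule DERIV_cong_ev) simp_all

lemma C_diff_cong:
  assumes W: "openin (Euclidean_space n) W"
  shows "C_diff n r W f \<Longrightarrow> (\<And>x. x \<in> W \<Longrightarrow> f x = h x) \<Longrightarrow> C_diff n r W h"
proof (cases r)
  case 0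
  assume *: "C_diff n r W f" "\<And>x. x \<in> W \<Longrightarrow> f x = h x"
  have "continuous_map (subtopology (Euclidean_space n) W) euclideanreal h"
    by (rule continuous_map_eq[of _ _ f]) (use * 0 in auto)
  then show ?thesis using 0 by simp
next
  case (Suc s)
  assume *: "C_diff n r W f" "\<And>x. x \<in> W \<Longrightarrow> f x = h x"
  have "continuous_map (subtopology (Euclidean_space n) W) euclideanreal h"
    by (rule continuous_map_eq[of _ _ f]) (use * Suc in auto)
  moreover have "\<exists>g. (\<forall>x\<in>W. ((\<lambda>t. h (x(i := t))) has_real_derivative g x) (at (x i))) \<and> C_diff n s W g"
    if i: "i < n" for i
  proof -
    obtain g where g: "\<forall>x\<in>W. ((\<lambda>t. f (x(i := t))) has_real_derivative g x) (at (x i))" "C_diff n s W g"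
      using * Suc i by auto
    have "((\<lambda>t. h (x(i := t))) has_real_derivative g x) (at (x i))" if x: "x \<in> W" for x
    proof -
      have "\<forall>\<^sub>F t in nhds (x i). f (x(i := t)) = h (x(i := t))"
        using eventually_update_in[OF W x i] by eventually_elim (use * in auto)
      from has_real_derivative_cong_nhds[OF this] show ?thesis using g(1) x by blast
    qed
    then show ?thesis using g(2) by blast
  qed
  ultimately show ?thesis using Suc by simp
qed

definition trunc :: "nat \<Rightarrow> (nat \<Rightarrow> real) \<Rightarrow> nat \<Rightarrow> real" where
  "trunc n x = (\<lambda>i. if i < n then x i else 0)"

lemma trunc_update: "i < n \<Longrightarrow> trunc n (x(i := t)) = (trunc n x)(i := t)"
  by (auto simp: trunc_def)

lemma continuous_on_trunc: "continuous_on S (trunc n)"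
proof -
  have "continuous_on UNIV (\<lambda>x. trunc n x i)" for i
    by (cases "i < n") (auto simp: trunc_def)
  then have "continuous_on UNIV (trunc n)" by (rule continuous_on_coordinatewise_then_product)
  then show ?thesis by (rule continuous_on_subset) simp
qed

definition translate :: "nat \<Rightarrow> (nat \<Rightarrow> real) \<Rightarrow> (nat \<Rightarrow> real) \<Rightarrow> nat \<Rightarrow> real" where
  "translate n c x = (\<lambda>i. if i < n then x i + c i else 0)"

lemma homeomorphic_translate: "homeomorphic_map (Euclidean_space n) (Euclidean_space n) (translate n c)"
proof -
  have cont: "continuous_map (Euclidean_space n) (Euclidean_space n) (translate n c)" for c
  proof -
    have "continuous_on UNIV (\<lambda>x. translate n c x i)" for i
      by (cases "i < n") (auto simp: translate_def intro!: continuous_intros)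
    then have "continuous_on UNIV (translate n c)" by (rule continuous_on_coordinatewise_then_product)
    then have "continuous_on {x. \<forall>i\<ge>n. x i = 0} (translate n c)" by (rule continuous_on_subset) simp
    then show ?thesis
      unfolding Euclidean_space_top_of_set by (auto simp: continuous_map_in_subtopology translate_def)
  qed
  have "homeomorphic_maps (Euclidean_space n) (Euclidean_space n) (translate n c) (translate n (\<lambda>i. - c i))"
    unfolding homeomorphic_maps_def using cont by (auto simp: translate_def topspace_Euclidean_space)
  then show ?thesis using homeomorphic_map_maps by blast
qed

lemma is_chart_translate:
  assumes "is_chart n X (U, \<phi>)" shows "is_chart n X (U, translate n c \<circ> \<phi>)"
proof -
  have U: "openin X U" "openin (Euclidean_space n) (\<phi> ` U)"
    and h: "homeomorphic_map (subtopology X U) (subtopology (Euclidean_space n) (\<phi> ` U)) \<phi>"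
    using assms by (auto simp: is_chart_def)
  let ?W = "translate n c ` \<phi> ` U"
  have oW: "openin (Euclidean_space n) ?W"
    using homeomorphic_imp_open_map[OF homeomorphic_translate] U(2) by (auto simp: open_map_def)
  have "homeomorphic_map (subtopology (Euclidean_space n) (\<phi> ` U)) (subtopology (Euclidean_space n) ?W) (translate n c)"
    by (rule homeomorphic_map_subtopologies[OF homeomorphic_translate])
       (use openin_subset[OF U(2)] openin_subset[OF oW] in blast)
  from homeomorphic_map_compose[OF h this] show ?thesis
    using U(1) oW by (simp add: is_chart_def image_comp)
qed

lemma openin_chart_box:
  assumes "is_chart n X (U, \<phi>)"
  shows "openin X {w \<in> U. near n e x (\<phi> w)}"
proof -
  have U: "openin X U" "openin (Euclidean_space n) (\<phi> ` U)"
    and h: "homeomorphic_map (subtopology X U) (subtopology (Euclidean_space n) (\<phi> ` U)) \<phi>"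
    using assms by (auto simp: is_chart_def)
  let ?E = "subtopology (Euclidean_space n) (\<phi> ` U)"
  have "openin ?E {y \<in> topspace ?E. near n e x y}"
  proof -
    have "openin (Euclidean_space n) ({x. \<forall>i\<ge>n. x i = 0} \<inter> {y. near n e x y})"
      unfolding Euclidean_space_top_of_set by (intro openin_open_Int open_near_box)
    then have "openin ?E (({x. \<forall>i\<ge>n. x i = 0} \<inter> {y. near n e x y}) \<inter> \<phi> ` U)"
      by (auto simp: openin_subtopology)
    moreover have "({x. \<forall>i\<ge>n. x i = 0} \<inter> {y. near n e x y}) \<inter> \<phi> ` U = {y \<in> topspace ?E. near n e x y}"
      by (auto simp: topspace_Euclidean_space)
    ultimately show ?thesis by simp
  qed
  from openin_continuous_map_preimage[OF homeomorphic_imp_continuous_map[OF h] this]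
  have "openin (subtopology X U) {w \<in> topspace (subtopology X U). \<phi> w \<in> {y \<in> topspace ?E. near n e x y}}" .
  moreover have "{w \<in> topspace (subtopology X U). \<phi> w \<in> {y \<in> topspace ?E. near n e x y}} = {w \<in> U. near n e x (\<phi> w)}"
    using openin_subset[OF U(1)] openin_subset[OF U(2)] by auto
  ultimately show ?thesis using openin_trans_full[OF _ U(1)] by (simp only:)
qed

text \<open>
  A chart of the atlas may be translated by a period; therefore every lift of a point occurs as its
  coordinates in some chart.
\<close>

lemma torus_chart_at:
  assumes x: "x \<in> topspace (Euclidean_space n)"
  obtains U \<phi> where "(U, \<phi>) \<in> torus_atlas n" "torus_exp n x \<in> U" "\<phi> (torus_exp n x) = x"
proof -
  obtain U \<phi> where U: "(U, \<phi>) \<in> torus_atlas n" "torus_exp n x \<in> U"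
    using torus_charts_cover[OF torus_exp_in] by blast
  let ?z = "torus_exp n x"
  have ch: "is_chart n (torus n) (U, \<phi>)" and c: "\<And>z i. z \<in> U \<Longrightarrow> i < n \<Longrightarrow> cis (\<phi> z i) = z i"
    using U(1) by (auto simp: torus_atlas_def)
  define c where "c = (\<lambda>i. x i - \<phi> ?z i)"
  let ?\<psi> = "translate n c \<circ> \<phi>"
  have "cis (?\<psi> z i) = z i" if "z \<in> U" "i < n" for z i
  proof -
    have "cis (\<phi> ?z i) = cis (x i)" using c[OF U(2) that(2)] that(2) by (simp add: torus_exp_apply)
    then have "cis (c i) = 1" by (simp add: c_def cis_divide[symmetric])
    then show ?thesis using c[OF that] that(2) by (simp add: translate_def cis_mult[symmetric])
  qed
  then have "(U, ?\<psi>) \<in> torus_atlas n" using is_chart_translate[OF ch] by (auto simp: torus_atlas_def)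
  moreover have "?\<psi> ?z = x" using x by (auto simp: translate_def c_def topspace_Euclidean_space)
  ultimately show thesis using that U(2) by blast
qed

lemma torus_chart:
  assumes "(U, \<phi>) \<in> torus_atlas n"
  shows "openin (torus n) U" "openin (Euclidean_space n) (\<phi> ` U)" "inj_on \<phi> U"
    "homeomorphic_map (subtopology (torus n) U) (subtopology (Euclidean_space n) (\<phi> ` U)) \<phi>"
    "\<And>z. z \<in> U \<Longrightarrow> torus_exp n (\<phi> z) = z"
    "\<And>y. y \<in> \<phi> ` U \<Longrightarrow> inv_into U \<phi> y = torus_exp n y"
proof -
  show U: "openin (torus n) U" "openin (Euclidean_space n) (\<phi> ` U)"
    and h: "homeomorphic_map (subtopology (torus n) U) (subtopology (Euclidean_space n) (\<phi> ` U)) \<phi>"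
    using assms by (auto simp: torus_atlas_def is_chart_def)
  show inj: "inj_on \<phi> U"
    using homeomorphic_imp_injective_map[OF h] openin_subset[OF U(1)] by (simp add: Int_absorb1)
  show e: "torus_exp n (\<phi> z) = z" if "z \<in> U" for z
    using assms that openin_subset[OF U(1)] by (intro torus_exp_eqI) (auto simp: torus_atlas_def)
  show "inv_into U \<phi> y = torus_exp n y" if "y \<in> \<phi> ` U" for y
    using that e inj by auto
qed

locale smooth_on_torus =
  fixes n :: nat and g :: "(nat \<Rightarrow> complex) \<Rightarrow> real"
  assumes smooth: "smooth_function n (torus_atlas n) g"
begin

definition G :: "(nat \<Rightarrow> real) \<Rightarrow> real" where "G x = g (torus_exp n x)"

definition p :: "nat \<Rightarrow> (nat \<Rightarrow> real) \<Rightarrow> real" where "p i x = deriv (\<lambda>t. G (x(i := t))) (x i)"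

lemma G_cong: assumes "\<forall>i<n. x i = y i" shows "G x = G y"
  using torus_exp_cong[OF assms] by (simp add: G_def)

lemma chart_C_diff:
  assumes "(U, \<phi>) \<in> torus_atlas n" shows "C_diff n r (\<phi> ` U) G"
proof (rule C_diff_cong)
  show "openin (Euclidean_space n) (\<phi> ` U)" by (rule torus_chart(2)[OF assms])
  show "C_diff n r (\<phi> ` U) (\<lambda>x. g (inv_into U \<phi> x))"
    using smooth assms by (auto simp: smooth_function_def C_infinity_def)
  show "g (inv_into U \<phi> x) = G x" if "x \<in> \<phi> ` U" for x
    using torus_chart(6)[OF assms that] by (simp add: G_def)
qed

text \<open>
  In a chart the lift \<open>G\<close> is the coordinate expression of \<open>g\<close>.
\<close>

lemma local_partials:
  assumes i: "i < n"
  shows "\<exists>d>0. \<exists>P q. (\<forall>x. near n d a x \<longrightarrow>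
      ((\<lambda>t. G (x(i := t))) has_real_derivative P x) (at (x i)) \<and>
      ((\<lambda>t. P (x(i := t))) has_real_derivative q x) (at (x i))) \<and>
    continuous_on {x. near n d a x} P \<and> continuous_on {x. near n d a x} q \<and>
    (\<forall>x y. (\<forall>i<n. x i = y i) \<longrightarrow> P x = P y \<and> q x = q y)"
proof -
  have a: "trunc n a \<in> topspace (Euclidean_space n)" by (auto simp: trunc_def topspace_Euclidean_space)
  obtain U \<phi> where U: "(U, \<phi>) \<in> torus_atlas n" "torus_exp n (trunc n a) \<in> U" "\<phi> (torus_exp n (trunc n a)) = trunc n a"
    using torus_chart_at[OF a] by blast
  define W where "W = \<phi> ` U"
  have W: "openin (Euclidean_space n) W" unfolding W_def by (rule torus_chart(2)[OF U(1)])
  have WE: "W \<subseteq> topspace (Euclidean_space n)" using openin_subset[OF W] .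
  have aW: "trunc n a \<in> W" using U(2,3) unfolding W_def by force
  have "C_diff n (Suc (Suc 0)) W G" unfolding W_def by (rule chart_C_diff[OF U(1)])
  then obtain P0 where P0: "\<forall>x\<in>W. ((\<lambda>t. G (x(i := t))) has_real_derivative P0 x) (at (x i))" "C_diff n (Suc 0) W P0"
    using i by auto
  then obtain q0 where q0: "\<forall>x\<in>W. ((\<lambda>t. P0 (x(i := t))) has_real_derivative q0 x) (at (x i))"
      "continuous_on W q0" "continuous_on W P0"
    using i WE by (auto simp: continuous_map_Euclidean_subset)
  obtain d where d: "d > 0" "\<forall>x. near n d (trunc n a) x \<longrightarrow> (\<forall>i\<ge>n. x i = 0) \<longrightarrow> x \<in> W"
    using openin_Euclidean_box[OF W aW] by blast
  have tW: "trunc n x \<in> W" if "near n d a x" for x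
    using d(2) that by (auto simp: trunc_def)
  have A: "((\<lambda>t. G (x(i := t))) has_real_derivative P0 (trunc n x)) (at (x i)) \<and>
      ((\<lambda>t. P0 (trunc n (x(i := t)))) has_real_derivative q0 (trunc n x)) (at (x i))"
    if x: "near n d a x" for x
  proof
    have eq: "G (x(i := t)) = G ((trunc n x)(i := t))" for t by (rule G_cong) (auto simp: trunc_def)
    have "((\<lambda>t. G ((trunc n x)(i := t))) has_real_derivative P0 (trunc n x)) (at (trunc n x i))"
      using P0(1) tW[OF x] by blast
    then show "((\<lambda>t. G (x(i := t))) has_real_derivative P0 (trunc n x)) (at (x i))"
      unfolding eq using i by (simp add: trunc_def)
    have "((\<lambda>t. P0 ((trunc n x)(i := t))) has_real_derivative q0 (trunc n x)) (at (trunc n x i))"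
      using q0(1) tW[OF x] by blast
    then show "((\<lambda>t. P0 (trunc n (x(i := t)))) has_real_derivative q0 (trunc n x)) (at (x i))"
      unfolding trunc_update[OF i] using i by (simp add: trunc_def)
  qed
  have B: "continuous_on {x. near n d a x} (\<lambda>x. P0 (trunc n x))"
    by (rule continuous_on_compose2[OF q0(3) continuous_on_trunc]) (use tW in auto)
  have C: "continuous_on {x. near n d a x} (\<lambda>x. q0 (trunc n x))"
    by (rule continuous_on_compose2[OF q0(2) continuous_on_trunc]) (use tW in auto)
  have D: "\<forall>x y. (\<forall>i<n. x i = y i) \<longrightarrow> P0 (trunc n x) = P0 (trunc n y) \<and> q0 (trunc n x) = q0 (trunc n y)"
  proof (intro allI impI)
    fix x y :: "nat \<Rightarrow> real" assume "\<forall>i<n. x i = y i"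
    then have "trunc n x = trunc n y" by (auto simp: trunc_def)
    then show "P0 (trunc n x) = P0 (trunc n y) \<and> q0 (trunc n x) = q0 (trunc n y)" by simp
  qed
  show ?thesis
    by (rule exI[of _ d], rule conjI[OF d(1)], rule exI[of _ "\<lambda>x. P0 (trunc n x)"],
        rule exI[of _ "\<lambda>x. q0 (trunc n x)"]) (intro conjI B C D allI impI; use A in blast)
qed

sublocale periodic_C2 n G p
proof
  show "G x = G y" if "\<forall>i<n. x i = y i" for x y by (rule G_cong[OF that])
  show "G (period_shift v x) = G x" for v x by (simp add: G_def torus_exp_shift)
  fix i a assume i: "i < n"
  obtain d P q where d: "d > 0"
    and der': "\<forall>x. near n d a x \<longrightarrow> ((\<lambda>t. G (x(i := t))) has_real_derivative P x) (at (x i)) \<and>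
      ((\<lambda>t. P (x(i := t))) has_real_derivative q x) (at (x i))"
    and cont: "continuous_on {x. near n d a x} P" "continuous_on {x. near n d a x} q"
    and dep: "\<forall>x y. (\<forall>i<n. x i = y i) \<longrightarrow> P x = P y \<and> q x = q y"
    using local_partials[OF i, of a] by (elim exE conjE) (rule that)
  have der: "((\<lambda>t. G (x(i := t))) has_real_derivative P x) (at (x i))"
      "((\<lambda>t. P (x(i := t))) has_real_derivative q x) (at (x i))" if "near n d a x" for x
    using der' that by blast+
  have pP: "p i x = P x" if "near n d a x" for x
    unfolding p_def by (rule DERIV_imp_deriv[OF der(1)[OF that]])
  have aa: "near n d a a" using d by simp
  show "((\<lambda>t. G (a(i := t))) has_real_derivative p i a) (at (a i))"
    using der(1)[OF aa] pP[OF aa] by simp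
  have box: "x \<in> {x. near n d a x} \<Longrightarrow> \<forall>i<n. x i = y i \<Longrightarrow> y \<in> {x. near n d a x}" for x y by auto
  show "\<exists>d>0. \<forall>x. near n d a x \<longrightarrow> \<bar>p i x - p i a\<bar> < e" if e: "e > 0" for e
  proof -
    have "\<exists>c>0. \<forall>x\<in>{x. near n d a x}. near n c a x \<longrightarrow> dist (P x) (P a) < e"
    proof (rule near_if_continuous_on[OF cont(1)])
      show "a \<in> {x. near n d a x}" using aa by simp
      show "e > 0" by (rule e)
      show "P x = P y" if "\<forall>i<n. x i = y i" for x y using dep that by blast
      show "y \<in> {x. near n d a x}" if "\<forall>i<n. x i = y i" "x \<in> {x. near n d a x}" for x y
        by (rule box[OF that(2,1)])
    qed
    then obtain c where c: "c > 0" "\<forall>x\<in>{x. near n d a x}. near n c a x \<longrightarrow> dist (P x) (P a) < e" by blast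
    have "\<bar>p i x - p i a\<bar> < e" if x: "near n (min c d) a x" for x
    proof -
      have xd: "near n d a x" by (rule near_mono[OF x]) simp
      have xc: "near n c a x" by (rule near_mono[OF x]) simp
      show ?thesis using c(2) xd xc pP[OF xd] pP[OF aa] by (simp add: dist_real_def)
    qed
    then show ?thesis using c(1) d by (intro exI[of _ "min c d"]) auto
  qed
  show "\<exists>d>0. \<exists>L. \<forall>x. near n d a x \<longrightarrow>
        (\<exists>D. ((\<lambda>t. p i (x(i := t))) has_real_derivative D) (at (x i)) \<and> \<bar>D\<bar> \<le> L)"
  proof -
    have "\<exists>c>0. \<forall>x\<in>{x. near n d a x}. near n c a x \<longrightarrow> dist (q x) (q a) < 1"
    proof (rule near_if_continuous_on[OF cont(2)])
      show "a \<in> {x. near n d a x}" using aa by simp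
      show "(1::real) > 0" by simp
      show "q x = q y" if "\<forall>i<n. x i = y i" for x y using dep that by blast
      show "y \<in> {x. near n d a x}" if "\<forall>i<n. x i = y i" "x \<in> {x. near n d a x}" for x y
        by (rule box[OF that(2,1)])
    qed
    then obtain c where c: "c > 0" "\<forall>x\<in>{x. near n d a x}. near n c a x \<longrightarrow> dist (q x) (q a) < 1" by blast
    have "\<exists>D. ((\<lambda>t. p i (x(i := t))) has_real_derivative D) (at (x i)) \<and> \<bar>D\<bar> \<le> 1 + \<bar>q a\<bar>"
      if x: "near n (min c d) a x" for x
    proof (intro exI[of _ "q x"] conjI)
      have xd: "near n d a x" by (rule near_mono[OF x]) simp
      have xc: "near n c a x" by (rule near_mono[OF x]) simp
      have "dist (q x) (q a) < 1" using c(2) xd xc by blast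
      then show "\<bar>q x\<bar> \<le> 1 + \<bar>q a\<bar>" unfolding dist_real_def by linarith
      have "\<forall>\<^sub>F t in nhds (x i). P (x(i := t)) = p i (x(i := t))"
      proof -
        have "0 < d - \<bar>a i - x i\<bar>" using xd i by simp
        moreover have "P (x(i := t)) = p i (x(i := t))" if "dist t (x i) < d - \<bar>a i - x i\<bar>" for t
        proof -
          have "\<bar>a i - t\<bar> < d" using that unfolding dist_real_def by linarith
          then have "near n d a (x(i := t))" using xd by simp
          then show ?thesis using pP by simp
        qed
        ultimately show ?thesis unfolding eventually_nhds_metric by blast
      qed
      from has_real_derivative_cong_nhds[OF this]
      show "((\<lambda>t. p i (x(i := t))) has_real_derivative q x) (at (x i))"
        using der(2)[OF xd] by blast
    qed
    then show ?thesis using c(1) d by (intro exI[of _ "min c d"] exI[of _ "1 + \<bar>q a\<bar>"]) auto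
  qed
qed

lemma critical_set_iff:
  "torus_exp n x \<in> critical_set n (torus n) (torus_atlas n) g \<longleftrightarrow> (\<forall>i<n. p i x = 0)"
proof -
  have der: "((\<lambda>t. g (inv_into U \<phi> ((\<phi> z)(i := t)))) has_real_derivative D) (at (\<phi> z i)) \<longleftrightarrow> D = p i x"
    if U: "(U, \<phi>) \<in> torus_atlas n" and z: "z \<in> U" "z = torus_exp n x" and i: "i < n" for U \<phi> z i D
  proof -
    have fz: "\<phi> z \<in> \<phi> ` U" using z by simp
    have "\<forall>\<^sub>F t in nhds (\<phi> z i). g (inv_into U \<phi> ((\<phi> z)(i := t))) = G ((\<phi> z)(i := t))"
      using eventually_update_in[OF torus_chart(2)[OF U] fz i]
      by eventually_elim (simp add: torus_chart(6)[OF U] G_def)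
    then have 1: "((\<lambda>t. g (inv_into U \<phi> ((\<phi> z)(i := t)))) has_real_derivative D) (at (\<phi> z i)) \<longleftrightarrow>
       ((\<lambda>t. G ((\<phi> z)(i := t))) has_real_derivative D) (at (\<phi> z i))"
      by (rule has_real_derivative_cong_nhds)
    have "torus_exp n (\<phi> z) = torus_exp n x" using torus_chart(5)[OF U z(1)] z(2) by simp
    then obtain v where "\<forall>i<n. \<phi> z i = period_shift v x i" unfolding torus_exp_eq_iff by blast
    then have "p i (\<phi> z) = p i x" using p_dep[OF i] p_shift[OF i] by metis
    then have "((\<lambda>t. G ((\<phi> z)(i := t))) has_real_derivative p i x) (at (\<phi> z i))"
      using partial[OF i, of "\<phi> z"] by simp
    then show ?thesis unfolding 1 using DERIV_unique by blast
  qed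
  show ?thesis
  proof
    assume L: "torus_exp n x \<in> critical_set n (torus n) (torus_atlas n) g"
    obtain U \<phi> where U: "(U, \<phi>) \<in> torus_atlas n" "torus_exp n x \<in> U"
      using torus_charts_cover[OF torus_exp_in] by blast
    show "\<forall>i<n. p i x = 0" using L U der[OF U refl] by (fastforce simp: critical_set_def)
  next
    assume R: "\<forall>i<n. p i x = 0"
    show "torus_exp n x \<in> critical_set n (torus n) (torus_atlas n) g"
      unfolding critical_set_def using torus_exp_in der R by auto
  qed
qed

end

context periodic_C2 begin

text \<open>
  The chain rule at a critical point; differentiability of \<open>G\<close> there follows from the
  continuity of its partial derivatives.
\<close>

lemma curve_through_critical_point:
  assumes c: "\<And>j. j < n \<Longrightarrow> ((\<lambda>t. c t j) has_real_derivative D j) (at s)"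
    and crit: "\<And>i. i < n \<Longrightarrow> p i (c s) = 0"
  shows "((\<lambda>t. G (c t)) has_real_derivative 0) (at s)"
  unfolding has_field_derivative_iff tendsto_iff
proof (intro allI impI)
  fix e :: real assume e: "e > 0"
  define M where "M = (\<Sum>j<n. \<bar>D j\<bar> + 1)"
  have M: "M \<ge> 0" unfolding M_def by (intro sum_nonneg) auto
  define N where "N = 1 + M"
  have N: "N > 0" "M \<le> N" using M by (auto simp: N_def)
  define e' where "e' = e / 2 / N"
  have e': "e' > 0" using e N by (simp add: e'_def)
  have "e' * M \<le> e' * N" using e' N by (intro mult_left_mono) auto
  also have "\<dots> = e / 2" using N by (simp add: e'_def)
  finally have e'M: "e' * M < e" using e by simp
  have "\<exists>d>0. \<forall>i<m. \<forall>z. near n d (c s) z \<longrightarrow> \<bar>p i z\<bar> \<le> e'" if "m \<le> n" for m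
    using that
  proof (induction m)
    case 0 then show ?case by (intro exI[of _ 1]) auto
  next
    case (Suc m)
    then obtain d where d: "d > 0" "\<And>i z. i < m \<Longrightarrow> near n d (c s) z \<Longrightarrow> \<bar>p i z\<bar> \<le> e'" by force
    obtain d' where d': "d' > 0" "\<And>z. near n d' (c s) z \<Longrightarrow> \<bar>p m z\<bar> \<le> e'"
      using p_cont[of m e' "c s"] crit[of m] e' Suc.prems by fastforce
    have "\<bar>p i z\<bar> \<le> e'" if "i < Suc m" "near n (min d d') (c s) z" for i z
      using d(2)[OF _ near_mono[OF that(2)]] d'(2)[OF near_mono[OF that(2)]] that(1) by (cases "i = m") auto
    then show ?case using d(1) d'(1) by (intro exI[of _ "min d d'"]) auto
  qed
  from this[of n] obtain d where d: "d > 0" "\<And>i z. i < n \<Longrightarrow> near n d (c s) z \<Longrightarrow> \<bar>p i z\<bar> \<le> e'" by blast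
  have "\<forall>\<^sub>F t in at s. \<bar>c t j - c s j\<bar> \<le> (\<bar>D j\<bar> + 1) * \<bar>t - s\<bar> \<and> \<bar>c t j - c s j\<bar> < d" if j: "j < n" for j
  proof -
    have "((\<lambda>t. (c t j - c s j) / (t - s)) \<longlongrightarrow> D j) (at s)" using c[OF j] by (simp add: has_field_derivative_iff)
    then have 1: "\<forall>\<^sub>F t in at s. dist ((c t j - c s j) / (t - s)) (D j) < 1" by (rule tendstoD) simp
    have "isCont (\<lambda>t. c t j) s" using DERIV_isCont[OF c[OF j]] .
    then have 2: "\<forall>\<^sub>F t in at s. dist (c t j) (c s j) < d" unfolding isCont_def by (rule tendstoD) (rule d(1))
    have 3: "\<forall>\<^sub>F t in at s. t \<noteq> s" by (auto simp: eventually_at_filter)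
    show ?thesis using 1 2 3
    proof eventually_elim
      case (elim t)
      have "\<bar>(c t j - c s j) / (t - s)\<bar> \<le> \<bar>D j\<bar> + 1" using elim(1) unfolding dist_real_def by linarith
      then have "\<bar>c t j - c s j\<bar> \<le> (\<bar>D j\<bar> + 1) * \<bar>t - s\<bar>" using elim(3) by (simp add: abs_divide pos_divide_le_eq)
      then show ?case using elim(2) by (simp add: dist_real_def)
    qed
  qed
  then have "\<forall>\<^sub>F t in at s. \<forall>j\<in>{..<n}. \<bar>c t j - c s j\<bar> \<le> (\<bar>D j\<bar> + 1) * \<bar>t - s\<bar> \<and> \<bar>c t j - c s j\<bar> < d"
    by (subst eventually_ball_finite_distrib) auto
  moreover have "\<forall>\<^sub>F t in at s. t \<noteq> s" by (auto simp: eventually_at_filter)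
  ultimately show "\<forall>\<^sub>F t in at s. dist ((G (c t) - G (c s)) / (t - s)) 0 < e"
  proof eventually_elim
    case (elim t)
    have "\<bar>G (c t) - G (c s)\<bar> \<le> e' * (\<Sum>j<n. \<bar>c t j - c s j\<bar>)"
    proof (rule increment_bound)
      show "near n d (c s) (c s)" using d(1) by simp
      show "near n d (c s) (c t)" using elim(1) by (auto simp: abs_minus_commute)
    qed (rule d(2))
    also have "\<dots> \<le> e' * (\<Sum>j<n. (\<bar>D j\<bar> + 1) * \<bar>t - s\<bar>)"
      using elim(1) e' by (intro mult_left_mono sum_mono) auto
    also have "\<dots> = e' * M * \<bar>t - s\<bar>" by (simp add: M_def sum_distrib_right)
    finally have "\<bar>(G (c t) - G (c s)) / (t - s)\<bar> \<le> e' * M"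
      using elim(2) by (simp add: abs_divide pos_divide_le_eq)
    then show ?case using e'M by simp
  qed
qed

end

context smooth_on_torus begin

text \<open>
  In a slice chart the restriction of \<open>g\<close> has vanishing partial derivatives, so moving the coordinates
  one after the other shows that \<open>g\<close> is locally constant. The slice chart is only compatible with the
  atlas of the torus, which is why the derivative is taken along the image of a coordinate line.
\<close>

lemma constant_on_critical_submanifold:
  assumes sub: "smooth_submanifold n (torus n) (torus_atlas n) d S"
    and crit: "S \<subseteq> critical_set n (torus n) (torus_atlas n) g"
    and conn: "connected_space (subtopology (torus n) S)"
    and z: "z \<in> S" "z' \<in> S"
  shows "g z = g z'"
proof -
  have dn: "d \<le> n" and ST: "S \<subseteq> topspace (torus n)" using sub by (auto simp: smooth_submanifold_def)
  have loc: "\<exists>Nb. openin (subtopology (torus n) S) Nb \<and> z \<in> Nb \<and> (\<forall>z'\<in>Nb. g z' = g z)" if z: "z \<in> S" for z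
  proof -
    obtain U \<phi> where U: "(U, \<phi>) \<in> maximal_atlas n (torus n) (torus_atlas n)" "z \<in> U"
      "\<phi> ` (U \<inter> S) = \<phi> ` U \<inter> topspace (Euclidean_space d)"
      using sub z unfolding smooth_submanifold_def by blast
    have oU: "openin (torus n) U" "openin (Euclidean_space n) (\<phi> ` U)"
      and h: "homeomorphic_map (subtopology (torus n) U) (subtopology (Euclidean_space n) (\<phi> ` U)) \<phi>"
      and tr: "\<And>V \<psi>. (V, \<psi>) \<in> torus_atlas n \<Longrightarrow> smooth_transition n (U, \<phi>) (V, \<psi>)"
      using U(1) by (auto simp: maximal_atlas_def is_chart_def)
    have inj: "inj_on \<phi> U"
      using homeomorphic_imp_injective_map[OF h] openin_subset[OF oU(1)] by (simp add: Int_absorb1)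
    have der: "((\<lambda>t. g (inv_into U \<phi> (y(i := t)))) has_real_derivative 0) (at (y i))"
      if y: "y \<in> \<phi> ` (U \<inter> S)" and i: "i < n" for y i
    proof -
      obtain z1 where z1: "z1 \<in> U" "z1 \<in> S" "y = \<phi> z1" using y by blast
      have inv1: "inv_into U \<phi> y = z1" using z1 inj by simp
      obtain V \<psi> where V: "(V, \<psi>) \<in> torus_atlas n" "z1 \<in> V"
        using torus_charts_cover z1(2) ST by blast
      have oUV: "openin (Euclidean_space n) (\<phi> ` (U \<inter> V))"
      proof -
        have "openin (subtopology (torus n) U) (U \<inter> V)"
          using torus_chart(1)[OF V(1)] by (simp add: openin_subtopology_Int2)
        then have "openin (subtopology (Euclidean_space n) (\<phi> ` U)) (\<phi> ` (U \<inter> V))"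
          using homeomorphic_imp_open_map[OF h] by (auto simp: open_map_def)
        then show ?thesis using oU(2) openin_trans_full by blast
      qed
      have yUV: "y \<in> \<phi> ` (U \<inter> V)" using z1 V(2) by blast
      define c where "c = (\<lambda>t. \<psi> (inv_into U \<phi> (y(i := t))))"
      have "\<exists>D. ((\<lambda>t. c t j) has_real_derivative D) (at (y i))" if j: "j < n" for j
      proof -
        have "C_diff n (Suc 0) (\<phi> ` (U \<inter> V)) (\<lambda>x. \<psi> (inv_into U \<phi> x) j)"
          using tr[OF V(1)] j unfolding smooth_transition_def C_infinity_def by blast
        then show ?thesis using i yUV unfolding c_def by auto
      qed
      then obtain D where D: "\<And>j. j < n \<Longrightarrow> ((\<lambda>t. c t j) has_real_derivative D j) (at (y i))" by metis
      have cy: "c (y i) = \<psi> z1" using inv1 by (simp add: c_def)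
      have "torus_exp n (c (y i)) \<in> critical_set n (torus n) (torus_atlas n) g"
        using cy torus_chart(5)[OF V] z1(2) crit by auto
      then have der0: "((\<lambda>t. G (c t)) has_real_derivative 0) (at (y i))"
        by (intro curve_through_critical_point[OF D]) (simp_all add: critical_set_iff)
      have "\<forall>\<^sub>F t in nhds (y i). G (c t) = g (inv_into U \<phi> (y(i := t)))"
        using eventually_update_in[OF oUV yUV i]
      proof eventually_elim
        case (elim t)
        then have "inv_into U \<phi> (y(i := t)) \<in> V" using inj by auto
        then show ?case by (simp add: c_def G_def torus_chart(5)[OF V(1)])
      qed
      from has_real_derivative_cong_nhds[OF this] show ?thesis using der0 by blast
    qed
    define x where "x = \<phi> z"
    have xW: "x \<in> \<phi> ` U" using U(2) by (simp add: x_def)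
    obtain e where e: "e > 0" "\<forall>y. near n e x y \<longrightarrow> (\<forall>i\<ge>n. y i = 0) \<longrightarrow> y \<in> \<phi> ` U"
      using openin_Euclidean_box[OF oU(2) xW] by blast
    have xd: "x \<in> \<phi> ` (U \<inter> S)" using U(2) z by (simp add: x_def)
    then have xE: "\<forall>i\<ge>d. x i = 0" unfolding U(3) by (auto simp: topspace_Euclidean_space)
    define Box where "Box = {w \<in> U. near n e x (\<phi> w)}"
    have oO: "openin (torus n) Box"
      using openin_chart_box[of n "torus n" U \<phi> x e] U(1) by (simp add: Box_def maximal_atlas_def)
    have "g z' = g z" if z': "z' \<in> Box \<inter> S" for z'
    proof -
      define x' where "x' = \<phi> z'"
      have x'n: "near n e x x'" using z' by (simp add: Box_def x'_def)
      have "x' \<in> \<phi> ` (U \<inter> S)" using z' by (simp add: Box_def x'_def)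
      then have x'E: "\<forall>i\<ge>d. x' i = 0" unfolding U(3) by (auto simp: topspace_Euclidean_space)
      define u where "u = (\<lambda>l i. if i < l then x' i else x i)"
      define F where "F = (\<lambda>y. g (inv_into U \<phi> y))"
      have in_slice: "(u l)(l := s) \<in> \<phi> ` (U \<inter> S)" if l: "l < d" and s: "s \<in> closed_segment (x l) (x' l)" for l s
      proof -
        have sl: "\<bar>x l - s\<bar> < e"
        proof -
          have "\<bar>x l - s\<bar> \<le> \<bar>x l - x' l\<bar>"
            using segment_bound(1)[OF s] by (simp add: abs_minus_commute)
          then show ?thesis using x'n l dn by (meson le_less_trans less_le_trans)
        qed
        have "near n e x ((u l)(l := s))" using sl x'n e(1) by (auto simp: u_def)
        moreover have "\<forall>i\<ge>d. ((u l)(l := s)) i = 0" using l xE x'E by (auto simp: u_def)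
        ultimately have "(u l)(l := s) \<in> \<phi> ` U \<inter> topspace (Euclidean_space d)"
          using e(2) dn by (auto simp: topspace_Euclidean_space)
        then show ?thesis using U(3) by simp
      qed
      have "F (u l) = F x" if "l \<le> d" for l
        using that
      proof (induction l)
        case 0 then show ?case by (simp add: u_def)
      next
        case (Suc l)
        have l: "l < d" "l < n" using Suc.prems dn by auto
        have "norm (F ((u l)(l := x' l)) - F ((u l)(l := x l))) \<le> 0 * norm (x' l - x l)"
        proof (rule field_differentiable_bound[of "closed_segment (x l) (x' l)" "\<lambda>s. F ((u l)(l := s))" "\<lambda>_. 0"])
          fix s assume s: "s \<in> closed_segment (x l) (x' l)"
          have "((\<lambda>t. F (((u l)(l := s))(l := t))) has_real_derivative 0) (at (((u l)(l := s)) l))"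
            unfolding F_def by (rule der[OF in_slice[OF l(1) s] l(2)])
          then show "((\<lambda>s. F ((u l)(l := s))) has_real_derivative 0) (at s within closed_segment (x l) (x' l))"
            by (simp add: has_field_derivative_at_within)
        qed auto
        moreover have "(u l)(l := x' l) = u (Suc l)" "(u l)(l := x l) = u l" by (auto simp: u_def)
        ultimately show ?case using Suc by simp
      qed
      from this[of d] have "F (u d) = F x" by simp
      moreover have "u d = x'" using xE x'E by (auto simp: u_def)
      moreover have "F x' = g z'" "F x = g z" using z' U(2) inj by (auto simp: F_def x_def x'_def Box_def)
      ultimately show ?thesis by simp
    qed
    moreover have "openin (subtopology (torus n) S) (Box \<inter> S)" using oO by (auto simp: openin_subtopology)
    moreover have "z \<in> Box \<inter> S" using z U(2) e(1) by (simp add: Box_def x_def)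
    ultimately show ?thesis by blast
  qed
  \<comment> \<open>a locally constant function on a connected space is constant\<close>
  let ?A = "{w \<in> S. g w = g z}" and ?B = "{w \<in> S. g w \<noteq> g z}"
  have "openin (subtopology (torus n) S) ?A" "openin (subtopology (torus n) S) ?B"
  proof -
    have sub: "Nb \<subseteq> S" if "openin (subtopology (torus n) S) Nb" for Nb
      using openin_subset[OF that] by auto
    show "openin (subtopology (torus n) S) ?A"
    proof (subst openin_subopen, intro ballI)
      fix w assume w: "w \<in> ?A"
      then have "w \<in> S" by simp
      from loc[OF this] obtain Nb where Nb: "openin (subtopology (torus n) S) Nb" "w \<in> Nb" "\<forall>z'\<in>Nb. g z' = g w"
        by (elim exE conjE) (rule that)
      have "Nb \<subseteq> ?A"
      proof
        fix x assume x: "x \<in> Nb"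
        have "x \<in> S" using sub[OF Nb(1)] x by (rule subsetD)
        moreover have "g x = g w" using Nb(3) x by (rule bspec)
        moreover have "g w = g z" using w by simp
        ultimately show "x \<in> ?A" by simp
      qed
      then show "\<exists>T. openin (subtopology (torus n) S) T \<and> w \<in> T \<and> T \<subseteq> ?A"
        using Nb(1,2) by blast
    qed
    show "openin (subtopology (torus n) S) ?B"
    proof (subst openin_subopen, intro ballI)
      fix w assume w: "w \<in> ?B"
      then have "w \<in> S" by simp
      from loc[OF this] obtain Nb where Nb: "openin (subtopology (torus n) S) Nb" "w \<in> Nb" "\<forall>z'\<in>Nb. g z' = g w"
        by (elim exE conjE) (rule that)
      have "Nb \<subseteq> ?B"
      proof
        fix x assume x: "x \<in> Nb"
        have "x \<in> S" using sub[OF Nb(1)] x by (rule subsetD)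
        moreover have "g x = g w" using Nb(3) x by (rule bspec)
        moreover have "g w \<noteq> g z" using w by simp
        ultimately show "x \<in> ?B" by simp
      qed
      then show "\<exists>T. openin (subtopology (torus n) S) T \<and> w \<in> T \<and> T \<subseteq> ?B"
        using Nb(1,2) by blast
    qed
  qed
  moreover have "topspace (subtopology (torus n) S) \<subseteq> ?A \<union> ?B" "?A \<inter> ?B = {}" "?A \<noteq> {}" using z by auto
  ultimately have "?B = {}" using conn unfolding connected_space_def by blast
  then have "z' \<notin> ?B" by (simp only: empty_iff not_False_eq_True)
  then have "g z' = g z" using z(2) by blast
  then show ?thesis by (rule sym)
qed

end

section \<open>The lower bound\<close>

lemma connected_space_torus: "connected_space (torus k)"
proof -
  have "connected (sphere (0::complex) 1)" by (rule connected_sphere) simp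
  then show ?thesis
    unfolding torus_def connected_space_product_topology by (simp add: connected_space_subtopology)
qed

text \<open>
  Since each submanifold is open in the critical set, a small box meets only one of them; this
  local statement yields both the uniform distance between the pieces and the uniform local
  constancy of the \<open>D s\<close>.
\<close>

theorem critical_submanifolds_lower_bound:
  assumes smooth: "smooth_function n (torus_atlas n) g"
    and cs: "critical_submanifolds n (torus n) (torus_atlas n) (torus k) g \<S>"
    and fin: "finite \<S>"
  shows "n + 1 \<le> card \<S> + k"
proof (rule ccontr)
  define m where "m = card \<S>"
  let ?crit = "critical_set n (torus n) (torus_atlas n) g"
  assume "\<not> n + 1 \<le> card \<S> + k"
  then have mk: "m + k \<le> n" by (simp add: m_def)
  interpret smooth_on_torus n g by unfold_locales (rule smooth)
  have un: "\<Union>\<S> = ?crit" and dis: "disjoint \<S>"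
    and each: "\<And>S. S \<in> \<S> \<Longrightarrow> (\<exists>d. smooth_submanifold n (torus n) (torus_atlas n) d S) \<and>
       openin (subtopology (torus n) ?crit) S \<and> subtopology (torus n) S homeomorphic_space torus k"
    using cs by (auto simp: critical_submanifolds_def)
  obtain T where T: "bij_betw T {..<m} \<S>"
    using ex_bij_betw_nat_finite[OF fin] unfolding m_def lessThan_atLeast0 by blast
  have TS: "T s \<in> \<S>" if "s < m" for s using T that by (auto simp: bij_betw_def)
  have Tinj: "s = t" if "s < m" "t < m" "z \<in> T s" "z \<in> T t" for s t z
  proof -
    have "T s = T t" using dis TS that by (auto simp: disjoint_def)
    then show ?thesis using T that(1,2) by (auto simp: bij_betw_def inj_on_def)
  qed
  have Tun: "z \<in> ?crit \<longleftrightarrow> (\<exists>s<m. z \<in> T s)" for z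
  proof -
    have "\<Union>\<S> = (\<Union>s<m. T s)" using T by (auto simp: bij_betw_def)
    then show ?thesis using un by auto
  qed
  have Tsub: "T s \<subseteq> ?crit" if "s < m" for s using Tun that by blast
  have crit_sub: "?crit \<subseteq> topspace (torus n)" by (auto simp: critical_set_def)
  define C where "C = (\<lambda>s. {x. torus_exp n x \<in> T s})"
  have crit: "(\<forall>i<n. p i x = 0) \<longleftrightarrow> (\<exists>s<m. x \<in> C s)" for x
    using critical_set_iff Tun by (simp add: C_def)
  have "\<exists>w :: nat \<Rightarrow> nat \<Rightarrow> real. \<forall>a. (\<forall>j<k. (\<Sum>i<n. a i * w j i) = 0) \<longrightarrow> (\<exists>D B. primitive_on n (T s) a D B)"
    if "s < m" for s
  proof (rule annihilators_have_primitives)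
    show "T s \<subseteq> topspace (torus n)" using Tsub[OF that] crit_sub by (rule subset_trans)
    show "subtopology (torus n) (T s) homeomorphic_space torus k" using each[OF TS[OF that]] by blast
  qed
  then obtain w :: "nat \<Rightarrow> nat \<Rightarrow> nat \<Rightarrow> real" where
    w: "\<And>s a. s < m \<Longrightarrow> \<forall>j<k. (\<Sum>i<n. a i * w s j i) = 0 \<Longrightarrow> \<exists>D B. primitive_on n (T s) a D B"
    by metis
  obtain a v where av: "\<forall>s<m. \<forall>j<k. (\<Sum>i<n. a s i * w s j i) = 0"
      "\<forall>s<m. \<forall>t<m. (\<Sum>i<n. a s i * v t i) = (if s = t then 1 else (0::real))"
    using biorthogonal_annihilators[OF mk, of w] by (elim exE conjE) (rule that)
  have "\<exists>D B. primitive_on n (T s) (a s) D B" if "s < m" for s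
    by (rule w[OF that]) (use av(1) that in blast)
  then obtain D Bd where DB: "\<And>s. s < m \<Longrightarrow> primitive_on n (T s) (a s) (D s) (Bd s)" by metis
  have D_bd: "\<bar>D s x - (\<Sum>i<n. a s i * x i)\<bar> \<le> Bd s"
    and D_shift: "D s (period_shift u x) = D s x + 2 * pi * (\<Sum>i<n. a s i * of_int (u i))"
    and D_loc: "x \<in> C s \<Longrightarrow> \<exists>d>0. \<forall>x'. x' \<in> C s \<longrightarrow> near n d x x' \<longrightarrow> D s x' = D s x" if "s < m" for s x u
    using DB[OF that] unfolding primitive_on_def C_def mem_Collect_eq by blast+
  have local_index: "\<exists>d>0. \<forall>x. near n d b x \<longrightarrow> (\<forall>s<m. x \<in> C s \<longrightarrow> b \<in> C s)" for b
  proof (cases "\<exists>s<m. b \<in> C s")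
    case False
    then obtain i where i: "i < n" "p i b \<noteq> 0" using crit by blast
    obtain d where d: "d > 0" "\<forall>x. near n d b x \<longrightarrow> \<bar>p i x - p i b\<bar> < \<bar>p i b\<bar>"
      using p_cont[OF i(1), of "\<bar>p i b\<bar>" b] i(2) by auto
    have "x \<notin> C s" if x: "near n d b x" and s: "s < m" for x s
    proof
      assume "x \<in> C s"
      then have "p i x = 0" using crit s i(1) by blast
      moreover have "\<bar>p i x - p i b\<bar> < \<bar>p i b\<bar>" using d(2) x by blast
      ultimately show False by simp
    qed
    then show ?thesis using d(1) by blast
  next
    case True
    then obtain s where s: "s < m" "b \<in> C s" by blast
    have "openin (subtopology (torus n) ?crit) (T s)" using each[OF TS[OF s(1)]] by blast
    then obtain Nb where Nb: "openin (torus n) Nb" "T s = Nb \<inter> ?crit" by (auto simp: openin_subtopology)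
    have "open {x. torus_exp n x \<in> Nb}"
      using openin_continuous_map_preimage[OF continuous_torus_exp Nb(1)] by simp
    moreover have "b \<in> {x. torus_exp n x \<in> Nb}" using s(2) Nb(2) by (auto simp: C_def)
    ultimately obtain d where d: "d > 0" "\<forall>x. near n d b x \<longrightarrow> (\<forall>i\<ge>n. x i = b i) \<longrightarrow> x \<in> {x. torus_exp n x \<in> Nb}"
      using open_contains_near_box by blast
    have "b \<in> C t" if x: "near n d b x" and t: "t < m" "x \<in> C t" for x t
    proof -
      define x' where "x' = (\<lambda>i. if i < n then x i else b i)"
      have e: "torus_exp n x' = torus_exp n x" by (rule torus_exp_cong) (simp add: x'_def)
      have "torus_exp n x' \<in> Nb" using d(2) x by (simp add: x'_def)
      moreover have "torus_exp n x \<in> T t" using t(2) by (simp add: C_def)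
      moreover from this have "torus_exp n x \<in> ?crit" using Tsub[OF t(1)] by blast
      ultimately have "torus_exp n x \<in> T s" using Nb(2) e by simp
      then have "s = t" using Tinj[OF s(1) t(1)] \<open>torus_exp n x \<in> T t\<close> by blast
      then show ?thesis using s(2) by simp
    qed
    then show ?thesis using d(1) by blast
  qed
  have C_shift: "period_shift u x \<in> C s \<longleftrightarrow> x \<in> C s" for u x s by (simp add: C_def torus_exp_shift)
  have "\<exists>d>0. \<forall>x y. near n d x y \<longrightarrow> (\<forall>s<m. \<forall>t<m. x \<in> C s \<longrightarrow> y \<in> C t \<longrightarrow> s = t)"
  proof (rule uniform_threshold)
    fix b
    obtain d where d: "d > 0" "\<forall>x. near n d b x \<longrightarrow> (\<forall>s<m. x \<in> C s \<longrightarrow> b \<in> C s)" using local_index by blast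
    have "s = t" if "near n d b x" "near n d b y" "s < m" "t < m" "x \<in> C s" "y \<in> C t" for x y s t
    proof -
      have "b \<in> C s" "b \<in> C t" using d(2) that by blast+
      then show ?thesis using Tinj[OF that(3,4)] by (simp add: C_def)
    qed
    then show "\<exists>d>0. \<forall>x y. near n d b x \<longrightarrow> near n d b y \<longrightarrow> (\<forall>s<m. \<forall>t<m. x \<in> C s \<longrightarrow> y \<in> C t \<longrightarrow> s = t)"
      using d(1) by blast
  next
    fix d :: real and u x y
    assume "\<forall>s<m. \<forall>t<m. period_shift u x \<in> C s \<longrightarrow> period_shift u y \<in> C t \<longrightarrow> s = t"
    then show "\<forall>s<m. \<forall>t<m. x \<in> C s \<longrightarrow> y \<in> C t \<longrightarrow> s = t" unfolding C_shift .
  qed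
  then obtain e1 where e1: "e1 > 0" "\<And>x y s t. near n e1 x y \<Longrightarrow> s < m \<Longrightarrow> t < m \<Longrightarrow> x \<in> C s \<Longrightarrow> y \<in> C t \<Longrightarrow> s = t" by blast
  have "\<exists>d>0. \<forall>x y. near n d x y \<longrightarrow> (x \<in> C s \<longrightarrow> y \<in> C s \<longrightarrow> D s x = D s y)" if s: "s < m" for s
  proof (rule uniform_threshold)
    fix b
    obtain d where d: "d > 0" "\<forall>x. near n d b x \<longrightarrow> (\<forall>s<m. x \<in> C s \<longrightarrow> b \<in> C s)" using local_index by blast
    show "\<exists>d>0. \<forall>x y. near n d b x \<longrightarrow> near n d b y \<longrightarrow> (x \<in> C s \<longrightarrow> y \<in> C s \<longrightarrow> D s x = D s y)"
    proof (cases "b \<in> C s")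
      case False
      then show ?thesis using d s by blast
    next
      case True
      then obtain d' where "d' > 0" "\<forall>x'. x' \<in> C s \<longrightarrow> near n d' b x' \<longrightarrow> D s x' = D s b"
        using D_loc[OF s] by blast
      then show ?thesis by (intro exI[of _ d']) metis
    qed
  next
    fix d :: real and u x y
    assume "period_shift u x \<in> C s \<longrightarrow> period_shift u y \<in> C s \<longrightarrow> D s (period_shift u x) = D s (period_shift u y)"
    then show "x \<in> C s \<longrightarrow> y \<in> C s \<longrightarrow> D s x = D s y" unfolding C_shift D_shift[OF s] by simp
  qed
  then obtain e2 where e2: "\<And>s. s < m \<Longrightarrow> e2 s > 0"
    "\<And>s x y. s < m \<Longrightarrow> near n (e2 s) x y \<Longrightarrow> x \<in> C s \<Longrightarrow> y \<in> C s \<Longrightarrow> D s x = D s y" by metis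
  define \<eta> where "\<eta> = Min (insert e1 (e2 ` {..<m}))"
  have \<eta>: "\<eta> > 0" "\<eta> \<le> e1" "\<And>s. s < m \<Longrightarrow> \<eta> \<le> e2 s"
    using e1(1) e2(1) by (auto simp: \<eta>_def)
  define c where "c = (\<lambda>s. g (SOME z. z \<in> T s))"
  have val: "G x = c s" if s: "s < m" and x: "x \<in> C s" for s x
  proof -
    have "subtopology (torus n) (T s) homeomorphic_space torus k" using each[OF TS[OF s]] by blast
    then have conn: "connected_space (subtopology (torus n) (T s))"
      using connected_space_torus homeomorphic_connected_space by blast
    obtain d where d: "smooth_submanifold n (torus n) (torus_atlas n) d (T s)" using each[OF TS[OF s]] by blast
    have xz: "torus_exp n x \<in> T s" using x by (simp add: C_def)
    then have "(SOME z. z \<in> T s) \<in> T s" by (rule someI[of "\<lambda>z. z \<in> T s"])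
    from constant_on_critical_submanifold[OF d Tsub[OF s] conn xz this]
    show ?thesis by (simp add: G_def c_def)
  qed
  define B where "B = (\<Sum>s<m. \<bar>Bd s\<bar>)"
  have bd: "\<bar>D s x - (\<Sum>i<n. a s i * x i)\<bar> \<le> B" if "s < m" for s x
  proof -
    have "\<bar>Bd s\<bar> \<le> B" unfolding B_def using that by (intro member_le_sum) auto
    then show ?thesis using D_bd[OF that, of x] by linarith
  qed
  have "\<exists>V E d B'. d > 0 \<and> (\<forall>x. \<exists>s<m. \<forall>y. near n d x y \<longrightarrow> y \<in> V s \<and> E s y = E s x) \<and>
      (\<forall>s<m. \<forall>y\<in>V s. \<bar>E s y - (\<Sum>i<n. a s i * y i)\<bar> \<le> (B' :: real))"
  proof (rule critical_pieces_give_strips[OF crit \<eta>(1)])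
    show "s = t" if "s < m" "t < m" "x \<in> C s" "y \<in> C t" "near n \<eta> x y" for s t x y
      by (rule e1(2)[OF near_mono[OF that(5) \<eta>(2)] that(1-4)])
    show "D s x = D s y" if "s < m" "x \<in> C s" "y \<in> C s" "near n \<eta> x y" for s x y
      by (rule e2(2)[OF that(1) near_mono[OF that(4) \<eta>(3)[OF that(1)]] that(2,3)])
  qed (rule val bd; assumption)+
  then obtain V E d B' where V: "d > 0" "\<forall>x. \<exists>s<m. \<forall>y. near n d x y \<longrightarrow> y \<in> V s \<and> E s y = E s x"
      "\<forall>s<m. \<forall>y\<in>V s. \<bar>E s y - (\<Sum>i<n. a s i * y i)\<bar> \<le> B'"
    by (elim exE conjE) (rule that)
  show False
  proof (rule no_cover_by_bounded_strips)
    show "(\<Sum>i<n. a s i * v t i) = (if s = t then 1 else 0)" if "s < m" "t < m" for s t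
      using av(2) that by blast
    show "\<exists>s<m. \<forall>y. near n d x y \<longrightarrow> y \<in> V s \<and> E s y = E s x" for x using V(2) by blast
    show "\<bar>E s y - (\<Sum>i<n. a s i * y i)\<bar> \<le> B'" if "s < m" "y \<in> V s" for s y using V(3) that by blast
  qed (rule V(1))
qed

section \<open>Smooth expressions, a flat function and a concave profile\<close>

lemma C_diff_subset: "C_diff n r W f \<Longrightarrow> V \<subseteq> W \<Longrightarrow> C_diff n r V f"
proof (induction r arbitrary: f)
  case 0
  then show ?case using continuous_map_from_subtopology_mono by auto
next
  case (Suc r)
  have "continuous_map (subtopology (Euclidean_space n) V) euclideanreal f"
    using Suc.prems continuous_map_from_subtopology_mono by auto
  moreover have "\<exists>g. (\<forall>x\<in>V. ((\<lambda>t. f (x(i := t))) has_real_derivative g x) (at (x i))) \<and> C_diff n r V g"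
    if i: "i < n" for i
  proof -
    obtain g where g: "\<forall>x\<in>W. ((\<lambda>t. f (x(i := t))) has_real_derivative g x) (at (x i))" "C_diff n r W g"
      using Suc.prems i by auto
    have "C_diff n r V g" using Suc.IH[OF g(2)] Suc.prems by blast
    then show ?thesis using g(1) Suc.prems by blast
  qed
  ultimately show ?case by simp
qed

lemma C_diff_locally:
  assumes W: "W \<subseteq> topspace (Euclidean_space n)"
    and loc: "\<And>x. x \<in> W \<Longrightarrow> \<exists>V. openin (Euclidean_space n) V \<and> x \<in> V \<and> V \<subseteq> W \<and> C_diff n r V f"
  shows "C_diff n r W f"
  using loc
proof (induction r arbitrary: f)
  case 0
  let ?X = "subtopology (Euclidean_space n) W"
  define \<V> where "\<V> = {V. openin (Euclidean_space n) V \<and> V \<subseteq> W \<and> C_diff n 0 V f}"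
  have "continuous_map ?X euclideanreal f"
  proof (rule pasting_lemma[of \<V> ?X "\<lambda>V. V" _ "\<lambda>_. f"])
    show "openin ?X V" if "V \<in> \<V>" for V
      using that by (auto simp: \<V>_def openin_subtopology)
    show "continuous_map (subtopology ?X V) euclideanreal f" if "V \<in> \<V>" for V
      using that by (auto simp: \<V>_def subtopology_subtopology Int_absorb1)
    show "\<exists>V. V \<in> \<V> \<and> x \<in> V \<and> f x = f x" if "x \<in> topspace ?X" for x
    proof -
      have "x \<in> W" using that by auto
      from "0.prems"[OF this] show ?thesis unfolding \<V>_def by blast
    qed
  qed auto
  then show ?case by simp
next
  case (Suc r)
  let ?X = "subtopology (Euclidean_space n) W"
  define \<V> where "\<V> = {V. openin (Euclidean_space n) V \<and> V \<subseteq> W \<and> C_diff n (Suc r) V f}"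
  have in\<V>: "\<exists>V. V \<in> \<V> \<and> x \<in> V" if "x \<in> W" for x
    using Suc.prems[OF that] unfolding \<V>_def by blast
  have "continuous_map ?X euclideanreal f"
  proof (rule pasting_lemma[of \<V> ?X "\<lambda>V. V" _ "\<lambda>_. f"])
    show "openin ?X V" if "V \<in> \<V>" for V
      using that by (auto simp: \<V>_def openin_subtopology)
    show "continuous_map (subtopology ?X V) euclideanreal f" if "V \<in> \<V>" for V
      using that by (auto simp: \<V>_def subtopology_subtopology Int_absorb1)
    show "\<exists>V. V \<in> \<V> \<and> x \<in> V \<and> f x = f x" if "x \<in> topspace ?X" for x
      using in\<V> that by auto
  qed auto
  moreover have "\<exists>g. (\<forall>x\<in>W. ((\<lambda>t. f (x(i := t))) has_real_derivative g x) (at (x i))) \<and> C_diff n r W g"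
    if i: "i < n" for i
  proof -
    define g where "g = (\<lambda>x. deriv (\<lambda>t. f (x(i := t))) (x i))"
    have V: "(\<forall>x\<in>V. ((\<lambda>t. f (x(i := t))) has_real_derivative g x) (at (x i))) \<and> C_diff n r V g"
      if VV: "V \<in> \<V>" for V
    proof -
      have oV: "openin (Euclidean_space n) V" using VV by (simp add: \<V>_def)
      obtain h where h: "\<forall>x\<in>V. ((\<lambda>t. f (x(i := t))) has_real_derivative h x) (at (x i))" "C_diff n r V h"
        using VV i by (auto simp: \<V>_def)
      have "h x = g x" if "x \<in> V" for x
        using h(1) that unfolding g_def by (metis DERIV_imp_deriv)
      then show ?thesis using h C_diff_cong[OF oV h(2)] by auto
    qed
    have "\<forall>x\<in>W. ((\<lambda>t. f (x(i := t))) has_real_derivative g x) (at (x i))" using in\<V> V by blast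
    moreover have "C_diff n r W g"
    proof (rule Suc.IH)
      fix x assume "x \<in> W"
      then obtain U where "U \<in> \<V>" "x \<in> U" using in\<V> by blast
      then show "\<exists>V. openin (Euclidean_space n) V \<and> x \<in> V \<and> V \<subseteq> W \<and> C_diff n r V g"
        using V[of U] unfolding \<V>_def by blast
    qed
    ultimately show ?thesis by blast
  qed
  ultimately show ?case by simp
qed

text \<open>
  Expressions built from given functions \<open>B\<close> of the point and given functions \<open>\<Phi>\<close> of a real variable. Smoothness of an
  implicitly defined function is circular in that its derivatives involve the function itself;
  with the function put into \<open>B\<close>, it suffices that its first derivatives are again such expressions.
\<close>

inductive_set smooth_terms ::
  "((nat \<Rightarrow> real) \<Rightarrow> real) set \<Rightarrow> (real \<Rightarrow> real) set \<Rightarrow> (nat \<Rightarrow> real) set \<Rightarrow> ((nat \<Rightarrow> real) \<Rightarrow> real) set"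
  for B \<Phi> W where
  base: "b \<in> B \<Longrightarrow> b \<in> smooth_terms B \<Phi> W"
| const: "(\<lambda>_. c) \<in> smooth_terms B \<Phi> W"
| add: "f \<in> smooth_terms B \<Phi> W \<Longrightarrow> g \<in> smooth_terms B \<Phi> W \<Longrightarrow> (\<lambda>x. f x + g x) \<in> smooth_terms B \<Phi> W"
| mult: "f \<in> smooth_terms B \<Phi> W \<Longrightarrow> g \<in> smooth_terms B \<Phi> W \<Longrightarrow> (\<lambda>x. f x * g x) \<in> smooth_terms B \<Phi> W"
| inverse: "f \<in> smooth_terms B \<Phi> W \<Longrightarrow> (\<And>x. x \<in> W \<Longrightarrow> f x \<noteq> 0) \<Longrightarrow> (\<lambda>x. inverse (f x)) \<in> smooth_terms B \<Phi> W"
| comp: "\<phi> \<in> \<Phi> \<Longrightarrow> f \<in> smooth_terms B \<Phi> W \<Longrightarrow> (\<lambda>x. \<phi> (f x)) \<in> smooth_terms B \<Phi> W"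

lemma smooth_terms_uminus: "f \<in> smooth_terms B \<Phi> W \<Longrightarrow> (\<lambda>x. - f x) \<in> smooth_terms B \<Phi> W"
  using smooth_terms.mult[OF smooth_terms.const[of "-1"]] by fastforce

lemma smooth_terms_diff:
  "f \<in> smooth_terms B \<Phi> W \<Longrightarrow> g \<in> smooth_terms B \<Phi> W \<Longrightarrow> (\<lambda>x. f x - g x) \<in> smooth_terms B \<Phi> W"
  using smooth_terms.add[OF _ smooth_terms_uminus] by fastforce

lemma smooth_terms_divide:
  "f \<in> smooth_terms B \<Phi> W \<Longrightarrow> g \<in> smooth_terms B \<Phi> W \<Longrightarrow> (\<And>x. x \<in> W \<Longrightarrow> g x \<noteq> 0) \<Longrightarrow>
    (\<lambda>x. f x / g x) \<in> smooth_terms B \<Phi> W"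
  using smooth_terms.mult[OF _ smooth_terms.inverse] by (fastforce simp: divide_inverse)

lemma smooth_terms_sum:
  "(\<And>a. a \<in> A \<Longrightarrow> f a \<in> smooth_terms B \<Phi> W) \<Longrightarrow> (\<lambda>x. \<Sum>a\<in>A. f a x) \<in> smooth_terms B \<Phi> W"
proof (induction A rule: infinite_finite_induct)
  case (insert a A)
  then show ?case using smooth_terms.add[of "f a" B \<Phi> W "\<lambda>x. \<Sum>a\<in>A. f a x"] by simp
qed (auto intro: smooth_terms.const)

text \<open>
  The expressions are continuous and closed under partial derivatives, hence smooth by induction on
  the order.
\<close>

theorem smooth_terms_C_infinity:
  fixes n :: nat
  assumes W: "W \<subseteq> topspace (Euclidean_space n)"
    and B: "\<And>b. b \<in> B \<Longrightarrow> continuous_on W b"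
      "\<And>b i. b \<in> B \<Longrightarrow> i < n \<Longrightarrow> \<exists>g\<in>smooth_terms B \<Phi> W. \<forall>x\<in>W. ((\<lambda>t. b (x(i := t))) has_real_derivative g x) (at (x i))"
    and \<Phi>: "\<And>\<phi>. \<phi> \<in> \<Phi> \<Longrightarrow> \<exists>\<phi>'. (\<forall>x. (\<phi> has_real_derivative \<phi>' x) (at x)) \<and>
        (\<forall>f\<in>smooth_terms B \<Phi> W. (\<lambda>x. \<phi>' (f x)) \<in> smooth_terms B \<Phi> W)"
    and f: "f \<in> smooth_terms B \<Phi> W"
  shows "C_infinity n W f"
proof -
  let ?T = "smooth_terms B \<Phi> W"
  have cont: "continuous_on W f" if "f \<in> ?T" for f
    using that
  proof induction
    case (comp \<phi> f)
    then obtain \<phi>' where \<phi>': "\<forall>x. (\<phi> has_real_derivative \<phi>' x) (at x)" using \<Phi> by blast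
    have "continuous_on UNIV \<phi>"
      using \<phi>' by (intro DERIV_continuous_on[of _ _ \<phi>']) auto
    then show ?case using comp by (intro continuous_on_compose2[of UNIV \<phi> W f]) auto
  qed (auto intro: B(1) intro!: continuous_intros)
  have part: "\<exists>g\<in>?T. \<forall>x\<in>W. ((\<lambda>t. f (x(i := t))) has_real_derivative g x) (at (x i))"
    if "f \<in> ?T" "i < n" for f i
    using that
  proof induction
    case (base b)
    then show ?case using B(2) by blast
  next
    case (const c)
    show ?case by (intro bexI[of _ "\<lambda>_. 0"] smooth_terms.const) auto
  next
    case (add f g)
    then obtain f' g' where *: "f' \<in> ?T" "\<forall>x\<in>W. ((\<lambda>t. f (x(i := t))) has_real_derivative f' x) (at (x i))"
      "g' \<in> ?T" "\<forall>x\<in>W. ((\<lambda>t. g (x(i := t))) has_real_derivative g' x) (at (x i))" by blast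
    have D: "((\<lambda>t. f (x(i := t)) + g (x(i := t))) has_real_derivative f' x + g' x) (at (x i))"
      if "x \<in> W" for x
    proof (rule DERIV_add)
      show "((\<lambda>t. f (x(i := t))) has_real_derivative f' x) (at (x i))"
        "((\<lambda>t. g (x(i := t))) has_real_derivative g' x) (at (x i))" using * that by blast+
    qed
    have T: "(\<lambda>x. f' x + g' x) \<in> ?T" using * by (intro smooth_terms.add)
    show ?case by (rule bexI[OF _ T]) (intro ballI D)
  next
    case (mult f g)
    then obtain f' g' where *: "f' \<in> ?T" "\<forall>x\<in>W. ((\<lambda>t. f (x(i := t))) has_real_derivative f' x) (at (x i))"
      "g' \<in> ?T" "\<forall>x\<in>W. ((\<lambda>t. g (x(i := t))) has_real_derivative g' x) (at (x i))" by blast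
    have D: "((\<lambda>t. f (x(i := t)) * g (x(i := t))) has_real_derivative f' x * g x + g' x * f x) (at (x i))"
      if "x \<in> W" for x
    proof -
      have "((\<lambda>t. f (x(i := t))) has_real_derivative f' x) (at (x i))"
        "((\<lambda>t. g (x(i := t))) has_real_derivative g' x) (at (x i))" using * that by blast+
      from DERIV_mult[OF this] show ?thesis by simp
    qed
    have T: "(\<lambda>x. f' x * g x + g' x * f x) \<in> ?T"
      using * mult.hyps by (intro smooth_terms.add smooth_terms.mult)
    show ?case by (rule bexI[OF _ T]) (intro ballI D)
  next
    case (inverse f)
    then obtain f' where *: "f' \<in> ?T" "\<forall>x\<in>W. ((\<lambda>t. f (x(i := t))) has_real_derivative f' x) (at (x i))" by blast
    have D: "((\<lambda>t. Fields.inverse (f (x(i := t)))) has_real_derivative - (f' x * (Fields.inverse (f x) * Fields.inverse (f x)))) (at (x i))"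
      if "x \<in> W" for x
    proof -
      have "((\<lambda>t. f (x(i := t))) has_real_derivative f' x) (at (x i))" using * that by blast
      from DERIV_inverse_fun[OF this] inverse.hyps(2)[OF that] show ?thesis
        by (simp add: power2_eq_square numeral_2_eq_2)
    qed
    have T: "(\<lambda>x. - (f' x * (Fields.inverse (f x) * Fields.inverse (f x)))) \<in> ?T"
      using * inverse.hyps by (intro smooth_terms_uminus smooth_terms.mult smooth_terms.inverse)
    show ?case by (rule bexI[OF _ T]) (intro ballI D)
  next
    case (comp \<phi> f)
    then obtain f' where *: "f' \<in> ?T" "\<forall>x\<in>W. ((\<lambda>t. f (x(i := t))) has_real_derivative f' x) (at (x i))" by blast
    obtain \<phi>' where \<phi>': "\<And>x. (\<phi> has_real_derivative \<phi>' x) (at x)" "\<forall>f\<in>?T. (\<lambda>x. \<phi>' (f x)) \<in> ?T"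
      using \<Phi>[OF comp.hyps(1)] by blast
    have D: "((\<lambda>t. \<phi> (f (x(i := t)))) has_real_derivative \<phi>' (f x) * f' x) (at (x i))" if "x \<in> W" for x
    proof -
      have "((\<lambda>t. f (x(i := t))) has_real_derivative f' x) (at (x i))" using * that by blast
      from DERIV_chain2[OF \<phi>'(1) this] show ?thesis by simp
    qed
    have T: "(\<lambda>x. \<phi>' (f x) * f' x) \<in> ?T"
      by (rule smooth_terms.mult[OF \<phi>'(2)[rule_format, OF comp.hyps(2)] *(1)])
    show ?case by (rule bexI[OF _ T]) (intro ballI D)
  qed
  have "C_diff n r W f" if "f \<in> ?T" for r f
    using that
  proof (induction r arbitrary: f)
    case 0
    then show ?case using cont continuous_map_Euclidean_subset[OF W] by simp
  next
    case (Suc r)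
    then show ?case using cont part continuous_map_Euclidean_subset[OF W] by (simp; blast)
  qed
  then show ?thesis using f by (simp add: C_infinity_def)
qed

text \<open>
  \<open>exp (- 1/x) / x^a\<close>, extended by \<open>0\<close>. The exponent \<open>a\<close> makes the family closed under
  derivatives up to linear combinations.
\<close>

definition flat :: "nat \<Rightarrow> real \<Rightarrow> real" where
  "flat a x = (if x > 0 then exp (- inverse x) * inverse x ^ a else 0)"

lemma flat_tendsto_0: "((\<lambda>x. exp (- inverse x) * inverse x ^ a) \<longlongrightarrow> 0) (at_right (0::real))"
proof -
  have "((\<lambda>x. x ^ a / exp x) \<longlongrightarrow> (0::real)) at_top" by (rule tendsto_power_div_exp_0)
  from filterlim_compose[OF this filterlim_inverse_at_top_right]
  show ?thesis by (simp add: exp_minus field_simps)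
qed

lemma flat_derivative: "(flat a has_real_derivative (flat (a + 2) x - real a * flat (a + 1) x)) (at x)"
proof -
  consider "x < 0" | "x = 0" | "x > 0" by linarith
  then show ?thesis
  proof cases
    case 1
    have "\<forall>\<^sub>F t in nhds x. 0 = flat a t"
      using eventually_nhds_in_open[of "{..<0}" x] 1 by (auto simp: flat_def elim!: eventually_mono)
    from has_real_derivative_cong_nhds[OF this, of 0]
    have "(flat a has_real_derivative 0) (at x)" by simp
    moreover have "flat (a + 2) x - real a * flat (a + 1) x = 0" using 1 by (simp add: flat_def)
    ultimately show ?thesis by simp
  next
    case 2
    have "((\<lambda>t. flat a t / t) \<longlongrightarrow> 0) (at 0)"
    proof (rule filterlim_split_at)
      have "\<forall>\<^sub>F t in at_left (0::real). 0 = flat a t / t"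
        by (auto simp: eventually_at_filter flat_def)
      then show "((\<lambda>t. flat a t / t) \<longlongrightarrow> 0) (at_left 0)"
        by (rule Lim_transform_eventually[OF tendsto_const])
      have "\<forall>\<^sub>F t in at_right (0::real). exp (- inverse t) * inverse t ^ (a + 1) = flat a t / t"
        by (auto simp: eventually_at_filter flat_def field_simps)
      then show "((\<lambda>t. flat a t / t) \<longlongrightarrow> 0) (at_right 0)"
        by (rule Lim_transform_eventually[OF flat_tendsto_0])
    qed
    then show ?thesis using 2 by (simp add: has_field_derivative_iff flat_def)
  next
    case 3
    have "\<forall>\<^sub>F t in nhds x. exp (- inverse t) * inverse t ^ a = flat a t"
      using eventually_nhds_in_open[of "{0<..}" x] 3 by (auto simp: flat_def elim!: eventually_mono)
    note cong = has_real_derivative_cong_nhds[OF this]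
    have "((\<lambda>t. exp (- inverse t) * inverse t ^ a) has_real_derivative
        exp (- inverse x) * (inverse x * inverse x) * inverse x ^ a +
        exp (- inverse x) * (real a * inverse x ^ (a - 1) * (- (inverse x * inverse x)))) (at x)"
      using 3 by (auto intro!: derivative_eq_intros simp: power2_eq_square)
    moreover have "exp (- inverse x) * (inverse x * inverse x) * inverse x ^ a +
        exp (- inverse x) * (real a * inverse x ^ (a - 1) * (- (inverse x * inverse x))) =
        flat (a + 2) x - real a * flat (a + 1) x"
      using 3 by (cases a) (auto simp: flat_def algebra_simps)
    ultimately show ?thesis using cong by simp
  qed
qed

text \<open>
  Integrate a bump function twice and subtract the chord.
\<close>

lemma concave_profile:
  "\<exists>H H1 :: real \<Rightarrow> real.
     (\<forall>x. (H has_real_derivative H1 x) (at x)) \<and>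
     (\<forall>x. (H1 has_real_derivative - (flat 0 x * flat 0 (1 - x))) (at x)) \<and> H 0 = 0 \<and> H 1 = 0"
proof -
  have anti: "\<exists>F. \<forall>x. (F has_real_derivative f x) (at x)" if "\<And>x. isCont f x" for f :: "real \<Rightarrow> real"
  proof -
    have "\<exists>F. \<forall>x::real. -\<infinity> < ereal x \<longrightarrow> ereal x < \<infinity> \<longrightarrow> (F has_vector_derivative f x) (at x)"
      by (rule einterval_antiderivative) (use that in auto)
    then show ?thesis by (auto simp: has_real_derivative_iff_has_vector_derivative)
  qed
  have "isCont (\<lambda>x. - (flat 0 x * flat 0 (1 - x))) x" for x
  proof -
    have "((\<lambda>x. 1 - x) has_real_derivative (- 1)) (at x)" by (auto intro!: derivative_eq_intros)
    from DERIV_isCont[OF DERIV_chain2[OF flat_derivative this]]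
    show ?thesis by (intro continuous_intros DERIV_isCont[OF flat_derivative])
  qed
  then obtain K1 where K1: "\<forall>x. (K1 has_real_derivative - (flat 0 x * flat 0 (1 - x))) (at x)"
    using anti[of "\<lambda>x. - (flat 0 x * flat 0 (1 - x))"] by blast
  then have "isCont K1 x" for x using DERIV_isCont by blast
  then obtain K where K: "\<forall>x. (K has_real_derivative K1 x) (at x)" using anti by blast
  define H where "H = (\<lambda>x. K x - K 0 - (K 1 - K 0) * x)"
  define H1 where "H1 = (\<lambda>x. K1 x - (K 1 - K 0))"
  have "(H has_real_derivative H1 x) (at x)" for x
    unfolding H_def H1_def using K by (auto intro!: derivative_eq_intros)
  moreover have "(H1 has_real_derivative - (flat 0 x * flat 0 (1 - x))) (at x)" for x
    unfolding H1_def using K1 by (auto intro!: derivative_eq_intros)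
  moreover have "H 0 = 0" "H 1 = 0" by (auto simp: H_def)
  ultimately show ?thesis by blast
qed

locale profile =
  fixes H H1 :: "real \<Rightarrow> real"
  assumes H: "\<And>x. (H has_real_derivative H1 x) (at x)"
    and H1: "\<And>x. (H1 has_real_derivative - (flat 0 x * flat 0 (1 - x))) (at x)"
    and H_0: "H 0 = 0" and H_1: "H 1 = 0"
begin

lemma H1_decreasing:
  assumes "0 \<le> x" "x < y" "y \<le> 1" shows "H1 y < H1 x"
proof -
  obtain \<xi> where \<xi>: "x < \<xi>" "\<xi> < y" "H1 y - H1 x = (y - x) * - (flat 0 \<xi> * flat 0 (1 - \<xi>))"
    using MVT2[OF assms(2), of H1 "\<lambda>x. - (flat 0 x * flat 0 (1 - x))"] H1 by blast
  have "flat 0 \<xi> > 0" "flat 0 (1 - \<xi>) > 0" using \<xi>(1,2) assms by (auto simp: flat_def)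
  then have "(y - x) * (flat 0 \<xi> * flat 0 (1 - \<xi>)) > 0" using assms(2) by simp
  then show ?thesis using \<xi>(3) by simp
qed

lemma H1_inj: "0 \<le> x \<Longrightarrow> x \<le> 1 \<Longrightarrow> 0 \<le> y \<Longrightarrow> y \<le> 1 \<Longrightarrow> H1 x = H1 y \<Longrightarrow> x = y"
  using H1_decreasing[of x y] H1_decreasing[of y x] by (cases x y rule: linorder_cases) auto

lemma H1_left: assumes "x \<le> 0" shows "H1 x = H1 0"
proof (cases "x = 0")
  case False
  then have "x < 0" using assms by simp
  from MVT2[OF this, of H1 "\<lambda>x. - (flat 0 x * flat 0 (1 - x))"] H1
  obtain \<xi> where "x < \<xi>" "\<xi> < 0" "H1 0 - H1 x = (0 - x) * - (flat 0 \<xi> * flat 0 (1 - \<xi>))" by blast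
  then show ?thesis by (simp add: flat_def)
qed simp

lemma H1_right: assumes "1 \<le> x" shows "H1 x = H1 1"
proof (cases "x = 1")
  case False
  then have "1 < x" using assms by simp
  from MVT2[OF this, of H1 "\<lambda>x. - (flat 0 x * flat 0 (1 - x))"] H1
  obtain \<xi> where "1 < \<xi>" "\<xi> < x" "H1 x - H1 1 = (x - 1) * - (flat 0 \<xi> * flat 0 (1 - \<xi>))" by blast
  then show ?thesis by (simp add: flat_def)
qed simp

lemma H_left: assumes "x \<le> 0" shows "H x = H1 0 * x"
proof (cases "x = 0")
  case False
  then have "x < 0" using assms by simp
  from MVT2[OF this, of H H1] H
  obtain \<xi> where "x < \<xi>" "\<xi> < 0" "H 0 - H x = (0 - x) * H1 \<xi>" by blast
  then show ?thesis using H1_left[of \<xi>] by (simp add: H_0 algebra_simps)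
qed (simp add: H_0)

lemma H_right: assumes "1 \<le> x" shows "H x = H1 1 * (x - 1)"
proof (cases "x = 1")
  case False
  then have "1 < x" using assms by simp
  from MVT2[OF this, of H H1] H
  obtain \<xi> where "1 < \<xi>" "\<xi> < x" "H x - H 1 = (x - 1) * H1 \<xi>" by blast
  then show ?thesis using H1_right[of \<xi>] by (simp add: H_1 algebra_simps)
qed (simp add: H_1)

text \<open>
  The tangent at \<open>x\<close> of a strictly concave function that vanishes at \<open>0\<close> meets the vertical axis
  above the origin.
\<close>

lemma intercept_pos:
  assumes "0 < x" "x \<le> 1" shows "H x - x * H1 x > 0"
proof -
  obtain \<xi> where \<xi>: "0 < \<xi>" "\<xi> < x" "H x - H 0 = (x - 0) * H1 \<xi>"
    using MVT2[OF assms(1), of H H1] H by blast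
  have "H1 x < H1 \<xi>" using H1_decreasing[of \<xi> x] \<xi> assms by simp
  then have "x * H1 x < x * H1 \<xi>" using assms(1) by simp
  then show ?thesis using \<xi>(3) by (simp add: H_0)
qed

lemma H_pos:
  assumes "0 < x" "x < 1" shows "H x > 0"
proof -
  obtain \<xi> where \<xi>: "0 < \<xi>" "\<xi> < x" "H x - H 0 = (x - 0) * H1 \<xi>"
    using MVT2[OF assms(1), of H H1] H by blast
  obtain \<zeta> where \<zeta>: "x < \<zeta>" "\<zeta> < 1" "H 1 - H x = (1 - x) * H1 \<zeta>"
    using MVT2[OF assms(2), of H H1] H by blast
  have "H1 \<zeta> < H1 \<xi>" using H1_decreasing[of \<xi> \<zeta>] \<xi> \<zeta> by simp
  have a: "H x = x * H1 \<xi>" "H x = - ((1 - x) * H1 \<zeta>)" using \<xi>(3) \<zeta>(3) by (auto simp: H_0 H_1)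
  show ?thesis
  proof (rule ccontr)
    assume "\<not> H x > 0"
    then have "H1 \<xi> \<le> 0" using a(1) assms(1) by (simp add: not_less mult_le_0_iff)
    then have "H1 \<zeta> < 0" using \<open>H1 \<zeta> < H1 \<xi>\<close> by simp
    then have "(1 - x) * H1 \<zeta> < 0" using assms(2) by (simp add: mult_pos_neg)
    then show False using a(2) \<open>\<not> H x > 0\<close> by simp
  qed
qed

end

section \<open>The building block of the minimal function\<close>

text \<open>
  Differentiability of \<open>\<Psi>\<close> at the one point and continuity of \<open>u\<close> give first that \<open>u\<close> is Lipschitz at \<open>t\<^sub>0\<close>,
  and then the derivative.
\<close>

lemma implicit_derivative:
  fixes u :: "real \<Rightarrow> real" and \<Psi> :: "real \<Rightarrow> real \<Rightarrow> real"
  assumes zero: "\<And>t. \<Psi> t (u t) = 0"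
    and cont: "isCont u t0"
    and der: "((\<lambda>q. \<Psi> (fst q) (snd q)) has_derivative (\<lambda>q. A * fst q + B * snd q)) (at (t0, u t0))"
    and B: "B \<noteq> 0"
  shows "(u has_real_derivative - A / B) (at t0)"
  unfolding has_field_derivative_iff tendsto_iff
proof (intro allI impI)
  fix e :: real assume e: "e > 0"
  define K where "K = 2 * (\<bar>A\<bar> + \<bar>B\<bar>) / \<bar>B\<bar>"
  have K: "K \<ge> 0" using B by (simp add: K_def)
  \<comment> \<open>the first bound makes \<open>u\<close> Lipschitz with constant \<open>K\<close>, the second one makes the error at most \<open>e/2\<close>\<close>
  define c where "c = min (\<bar>B\<bar> / 2) (\<bar>B\<bar> * e / (2 * (1 + K)))"
  have c: "c > 0" "c \<le> \<bar>B\<bar> / 2" "c \<le> \<bar>B\<bar> * e / (2 * (1 + K))"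
    unfolding c_def by (use B e K in \<open>simp add: add_pos_nonneg\<close>, rule min.cobounded1, rule min.cobounded2)
  have cK: "c * (1 + K) \<le> \<bar>B\<bar> * e / 2"
  proof -
    have "c * (1 + K) \<le> \<bar>B\<bar> * e / (2 * (1 + K)) * (1 + K)" using c(3) K by (intro mult_right_mono) auto
    also have "\<dots> = \<bar>B\<bar> * e / 2" using K by (simp add: field_simps add_nonneg_eq_0_iff)
    finally show ?thesis .
  qed
  obtain d where d: "d > 0" "\<And>y. norm (y - (t0, u t0)) < d \<Longrightarrow>
      norm (\<Psi> (fst y) (snd y) - \<Psi> t0 (u t0) - (A * fst (y - (t0, u t0)) + B * snd (y - (t0, u t0)))) \<le> c * norm (y - (t0, u t0))"
    using der c(1) unfolding has_derivative_at_alt by (auto simp: fst_conv snd_conv)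
  have "\<forall>\<^sub>F t in at t0. dist (u t) (u t0) < d / 2"
    using cont d(1) unfolding isCont_def tendsto_iff by (auto dest: spec[of _ "d / 2"])
  moreover have "\<forall>\<^sub>F t in at t0. dist t t0 < d / 2"
    using d(1) tendsto_ident_at[of t0 UNIV] unfolding tendsto_iff by (auto dest: spec[of _ "d / 2"])
  moreover have "\<forall>\<^sub>F t in at t0. t \<noteq> t0" by (auto simp: eventually_at_filter)
  ultimately show "\<forall>\<^sub>F t in at t0. dist ((u t - u t0) / (t - t0)) (- A / B) < e"
  proof eventually_elim
    case (elim t)
    have halves: "x \<le> a + c \<Longrightarrow> 0 \<le> b \<Longrightarrow> c = (b + x) / 2 \<Longrightarrow> x \<le> 2 * a + 2 * b" for a b c x :: real
      by argo
    define h r where "h = t - t0" and "r = u t - u t0"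
    have nb: "norm (h, r) \<le> \<bar>h\<bar> + \<bar>r\<bar>" using norm_Pair_le[of h r] by simp
    have "norm ((t, u t) - (t0, u t0)) < d"
      using nb elim(1,2) by (simp add: h_def r_def dist_real_def)
    from d(2)[OF this] have "\<bar>A * h + B * r\<bar> \<le> c * norm (h, r)"
      by (simp add: zero h_def r_def)
    also have "\<dots> \<le> c * (\<bar>h\<bar> + \<bar>r\<bar>)" using nb c(1) by (intro mult_left_mono) auto
    finally have 1: "\<bar>A * h + B * r\<bar> \<le> c * (\<bar>h\<bar> + \<bar>r\<bar>)" .
    have "\<bar>B\<bar> * \<bar>r\<bar> \<le> \<bar>A\<bar> * \<bar>h\<bar> + c * (\<bar>h\<bar> + \<bar>r\<bar>)"
      using 1 by (simp only: abs_mult[symmetric])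
    also have "\<dots> \<le> \<bar>A\<bar> * \<bar>h\<bar> + \<bar>B\<bar> / 2 * (\<bar>h\<bar> + \<bar>r\<bar>)" using c(2) by (intro add_left_mono mult_right_mono) auto
    finally have "\<bar>B\<bar> * \<bar>r\<bar> \<le> \<bar>A\<bar> * \<bar>h\<bar> + \<bar>B\<bar> / 2 * (\<bar>h\<bar> + \<bar>r\<bar>)" .
    moreover have "0 \<le> \<bar>B\<bar> * \<bar>h\<bar>" by simp
    moreover have "\<bar>B\<bar> / 2 * (\<bar>h\<bar> + \<bar>r\<bar>) = (\<bar>B\<bar> * \<bar>h\<bar> + \<bar>B\<bar> * \<bar>r\<bar>) / 2" by (simp add: algebra_simps)
    ultimately have "\<bar>B\<bar> * \<bar>r\<bar> \<le> 2 * (\<bar>A\<bar> * \<bar>h\<bar>) + 2 * (\<bar>B\<bar> * \<bar>h\<bar>)" by (rule halves)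
    then have "\<bar>B\<bar> * \<bar>r\<bar> \<le> 2 * (\<bar>A\<bar> + \<bar>B\<bar>) * \<bar>h\<bar>"
      by (simp add: algebra_simps)
    then have rK: "\<bar>r\<bar> \<le> K * \<bar>h\<bar>" using B by (simp add: K_def field_simps)
    have "\<bar>A * h + B * r\<bar> \<le> c * (1 + K) * \<bar>h\<bar>"
    proof -
      have "c * (\<bar>h\<bar> + \<bar>r\<bar>) \<le> c * (\<bar>h\<bar> + K * \<bar>h\<bar>)" using rK c(1) by (intro mult_left_mono) auto
      then show ?thesis using 1 by (simp add: algebra_simps)
    qed
    also have "\<dots> \<le> \<bar>B\<bar> * e / 2 * \<bar>h\<bar>" using cK by (intro mult_right_mono) auto
    finally have 2: "\<bar>A * h + B * r\<bar> \<le> \<bar>B\<bar> * e / 2 * \<bar>h\<bar>" .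
    have h0: "\<bar>h\<bar> > 0" using elim(3) by (simp add: h_def)
    have "r / h - - A / B = (A * h + B * r) / (B * h)" using B h0 by (simp add: field_simps)
    then have "\<bar>r / h - - A / B\<bar> = \<bar>A * h + B * r\<bar> / (\<bar>B\<bar> * \<bar>h\<bar>)" by (simp add: abs_divide abs_mult)
    also have "\<dots> \<le> e / 2" using 2 B h0 by (simp add: pos_divide_le_eq mult_pos_pos algebra_simps)
    finally show ?case using e by (simp add: dist_real_def h_def r_def)
  qed
qed

text \<open>
  A function that is linear to the left of \<open>0\<close>, and to the right of \<open>1\<close> continues with the same
  slope and the value at \<open>0\<close>: its translates add up, over an interval of length \<open>2M\<close>, to its periodic
  extension plus a linear function. Thus the periodic extension is a finite sum of smooth
  functions, without a case distinction at the integers.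
\<close>

lemma periodize:
  fixes \<theta> :: "real \<Rightarrow> real" and M :: nat
  assumes left: "\<And>z. z \<le> 0 \<Longrightarrow> \<theta> z = b - a * z" and right: "\<And>z. 1 \<le> z \<Longrightarrow> \<theta> z = b - a * (z - 1)"
    and z: "- real M \<le> z" "z < real M"
  shows "(\<Sum>l\<in>{- int M..<int M}. \<theta> (z - of_int l)) = \<theta> (frac z) + (2 * real M - 1) * (b - a * z)"
proof -
  define j where "j = \<lfloor>z\<rfloor>"
  have j: "j \<in> {- int M..<int M}" using z unfolding j_def by (simp add: le_floor_iff floor_less_iff)
  have zj: "z - of_int j = frac z" by (simp add: frac_def j_def)
  have f01: "0 \<le> frac z" "frac z < 1" by (simp_all add: frac_lt_1)
  have M0: "M > 0" using z by linarith
  let ?I = "{- int M..<int M}"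
  have termwise: "\<theta> (z - of_int l) = b - a * (z - of_int l) + (if l < j then a else 0) + (if l = j then \<theta> (frac z) - b + a * frac z else 0)"
    if "l \<in> ?I" for l
  proof -
    consider "l < j" | "l = j" | "j < l" by linarith
    then show ?thesis
    proof cases
      case 1
      then have "of_int (l + 1) \<le> (of_int j :: real)" by (simp only: of_int_le_iff)
      then have "z - of_int l \<ge> 1" using zj f01(1) unfolding of_int_add of_int_1 by linarith
      then show ?thesis using 1 right[of "z - of_int l"] by (simp add: algebra_simps)
    next
      case 2
      then show ?thesis using zj by simp
    next
      case 3
      then have "of_int (j + 1) \<le> (of_int l :: real)" by (simp only: of_int_le_iff)
      then have "z - of_int l \<le> 0" using zj f01(2) unfolding of_int_add of_int_1 by linarith
      then show ?thesis using 3 left[of "z - of_int l"] by simp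
    qed
  qed
  have ints: "(\<Sum>l\<in>{- int m..<int m}. real_of_int l) = - real m" for m
  proof (induction m)
    case (Suc m)
    have "{- int (Suc m)..<int (Suc m)} = insert (- int (Suc m)) (insert (int m) {- int m..<int m})" by auto
    then show ?case using Suc by simp
  qed simp
  have lt: "(\<Sum>l\<in>?I. if l < j then a else 0) = a * (of_int j + real M)"
  proof -
    have "(\<Sum>l\<in>?I. if l < j then a else 0) = (\<Sum>l\<in>{l \<in> ?I. l < j}. a)" by (rule sum.inter_filter[symmetric]) simp
    also have "{l \<in> ?I. l < j} = {- int M..<j}" using j by auto
    finally show ?thesis using j by (simp add: algebra_simps)
  qed
  have eq: "(\<Sum>l\<in>?I. if l = j then \<theta> (frac z) - b + a * frac z else 0) = \<theta> (frac z) - b + a * frac z"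
    using j by simp
  have lin: "(\<Sum>l\<in>?I. b - a * (z - of_int l)) = 2 * real M * (b - a * z) - a * real M"
  proof -
    have "(\<Sum>l\<in>?I. b - a * (z - of_int l)) = (\<Sum>l\<in>?I. b - a * z) + a * (\<Sum>l\<in>?I. real_of_int l)"
      by (simp add: sum_distrib_left algebra_simps sum.distrib sum_subtractf)
    then show ?thesis by (simp add: ints)
  qed
  have "(\<Sum>l\<in>?I. \<theta> (z - of_int l)) =
      (\<Sum>l\<in>?I. b - a * (z - of_int l) + (if l < j then a else 0) + (if l = j then \<theta> (frac z) - b + a * frac z else 0))"
    by (intro sum.cong termwise) auto
  also have "\<dots> = 2 * real M * (b - a * z) - a * real M + a * (of_int j + real M) + (\<theta> (frac z) - b + a * frac z)"
    by (simp only: sum.distrib lin lt eq)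
  also have "\<dots> = \<theta> (frac z) + (2 * real M - 1) * (b - a * z)"
    by (simp add: zj[symmetric] algebra_simps)
  finally show ?thesis .
qed

context profile begin

text \<open>
  On \<open>[0,1]\<close> this is the function \<open>\<kappa>\<^sub>u\<close> of the introduction (\<open>\<Theta>_lower\<close>, \<open>\<Theta>_upper\<close>), written without a
  case distinction: outside \<open>[0,1]\<close> the profile is continued by its tangents, and the last term
  cancels what the continuation of each half contributes to the other one.
\<close>

definition \<Theta> :: "real \<Rightarrow> real \<Rightarrow> real" where
  "\<Theta> u z = - u * H (z / u) + (1 - u) * H ((1 - z) / (1 - u)) + H1 1 * (z - u)"

definition \<Theta>z :: "real \<Rightarrow> real \<Rightarrow> real" where
  "\<Theta>z u z = - H1 (z / u) - H1 ((1 - z) / (1 - u)) + H1 1"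

definition \<Theta>u :: "real \<Rightarrow> real \<Rightarrow> real" where
  "\<Theta>u u z = - (H (z / u) - z / u * H1 (z / u)) - (H ((1 - z) / (1 - u)) - (1 - z) / (1 - u) * H1 ((1 - z) / (1 - u))) - H1 1"

lemma \<Theta>_has_derivative:
  assumes "0 < u" "u < 1"
  shows "((\<lambda>q. \<Theta> (fst q) (snd q)) has_derivative (\<lambda>q. \<Theta>u u z * fst q + \<Theta>z u z * snd q)) (at (u, z))"
proof -
  have d1: "((\<lambda>q. snd q / fst q) has_derivative (\<lambda>q. snd q / u - z * fst q / u\<^sup>2)) (at (u, z))"
    using assms by (auto intro!: derivative_eq_intros simp: fun_eq_iff field_simps power2_eq_square)
  have quot: "(- s * w - c * - f) / (w * w) = - s / w + c * f / w\<^sup>2" if "w \<noteq> 0" for s w c f :: real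
    using that by (simp add: field_simps power2_eq_square)
  have "((\<lambda>q. (1 - snd q) / (1 - fst q)) has_derivative
      (\<lambda>q. (- snd q * (1 - u) - (1 - z) * - fst q) / ((1 - u) * (1 - u)))) (at (u, z))"
    using assms by (auto intro!: derivative_eq_intros)
  then have d2: "((\<lambda>q. (1 - snd q) / (1 - fst q)) has_derivative (\<lambda>q. - snd q / (1 - u) + (1 - z) * fst q / (1 - u)\<^sup>2)) (at (u, z))"
    using assms by (subst (asm) quot) auto
  have e1: "((\<lambda>q. H (snd q / fst q)) has_derivative (\<lambda>q. (snd q / u - z * fst q / u\<^sup>2) * H1 (z / u))) (at (u, z))"
    using DERIV_compose_FDERIV[OF _ d1, of H "H1 (z / u)"] H by simp
  have e2: "((\<lambda>q. H ((1 - snd q) / (1 - fst q))) has_derivative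
      (\<lambda>q. (- snd q / (1 - u) + (1 - z) * fst q / (1 - u)\<^sup>2) * H1 ((1 - z) / (1 - u)))) (at (u, z))"
    using DERIV_compose_FDERIV[OF _ d2, of H "H1 ((1 - z) / (1 - u))"] H by simp
  have "((\<lambda>q. - fst q * H (snd q / fst q) + (1 - fst q) * H ((1 - snd q) / (1 - fst q)) + H1 1 * (snd q - fst q))
     has_derivative (\<lambda>q. - u * ((snd q / u - z * fst q / u\<^sup>2) * H1 (z / u)) - fst q * H (z / u) +
       ((1 - u) * ((- snd q / (1 - u) + (1 - z) * fst q / (1 - u)\<^sup>2) * H1 ((1 - z) / (1 - u))) - fst q * H ((1 - z) / (1 - u)))
       + H1 1 * (snd q - fst q))) (at (u, z))"
    by (auto intro!: derivative_eq_intros e1 e2 simp: fun_eq_iff)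
  moreover have "(\<lambda>q. - u * ((snd q / u - z * fst q / u\<^sup>2) * H1 (z / u)) - fst q * H (z / u) +
       ((1 - u) * ((- snd q / (1 - u) + (1 - z) * fst q / (1 - u)\<^sup>2) * H1 ((1 - z) / (1 - u))) - fst q * H ((1 - z) / (1 - u)))
       + H1 1 * (snd q - fst q)) = (\<lambda>q. \<Theta>u u z * fst q + \<Theta>z u z * snd q)"
  proof
    fix q :: "real \<times> real"
    have a: "u * ((snd q / u - z * fst q / u\<^sup>2) * H1 (z / u)) = (snd q - z / u * fst q) * H1 (z / u)"
      using assms by (simp add: field_simps power2_eq_square)
    have w: "w * ((- s / w + c * f / w\<^sup>2) * h) = (- s + c / w * f) * h" if "w \<noteq> 0" for w s c f h :: real
      using that by (simp add: field_simps power2_eq_square)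
    have b: "(1 - u) * ((- snd q / (1 - u) + (1 - z) * fst q / (1 - u)\<^sup>2) * H1 ((1 - z) / (1 - u))) =
        (- snd q + (1 - z) / (1 - u) * fst q) * H1 ((1 - z) / (1 - u))"
      by (rule w) (use assms in simp)
    show "- u * ((snd q / u - z * fst q / u\<^sup>2) * H1 (z / u)) - fst q * H (z / u) +
       ((1 - u) * ((- snd q / (1 - u) + (1 - z) * fst q / (1 - u)\<^sup>2) * H1 ((1 - z) / (1 - u))) - fst q * H ((1 - z) / (1 - u)))
       + H1 1 * (snd q - fst q) = \<Theta>u u z * fst q + \<Theta>z u z * snd q"
      unfolding b mult_minus_left a by (simp add: \<Theta>u_def \<Theta>z_def algebra_simps)
  qed
  ultimately show ?thesis unfolding \<Theta>_def by simp
qed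

lemma \<Theta>_lower: assumes "0 < u" "u < 1" "z \<le> u"
  shows "\<Theta> u z = - u * H (z / u)" "\<Theta>z u z = - H1 (z / u)" "\<Theta>u u z = - (H (z / u) - z / u * H1 (z / u))"
proof -
  have q: "(1 - z) / (1 - u) \<ge> 1" using assms by simp
  have "(1 - u) * H ((1 - z) / (1 - u)) = H1 1 * (u - z)"
    unfolding H_right[OF q] using assms by (simp add: field_simps)
  then show "\<Theta> u z = - u * H (z / u)" by (simp add: \<Theta>_def algebra_simps)
  show "\<Theta>z u z = - H1 (z / u)" unfolding \<Theta>z_def H1_right[OF q] by simp
  show "\<Theta>u u z = - (H (z / u) - z / u * H1 (z / u))"
    unfolding \<Theta>u_def H1_right[OF q] H_right[OF q] by (simp add: algebra_simps)
qed

lemma \<Theta>_upper: assumes "0 < u" "u < 1" "u \<le> z"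
  shows "\<Theta> u z = (1 - u) * H ((1 - z) / (1 - u))" "\<Theta>z u z = - H1 ((1 - z) / (1 - u))"
    "\<Theta>u u z = - (H ((1 - z) / (1 - u)) - (1 - z) / (1 - u) * H1 ((1 - z) / (1 - u)))"
proof -
  have q: "z / u \<ge> 1" using assms by simp
  have "u * H (z / u) = H1 1 * (z - u)"
    unfolding H_right[OF q] using assms by (simp add: field_simps)
  then show "\<Theta> u z = (1 - u) * H ((1 - z) / (1 - u))" by (simp add: \<Theta>_def algebra_simps)
  show "\<Theta>z u z = - H1 ((1 - z) / (1 - u))" unfolding \<Theta>z_def H1_right[OF q] by simp
  show "\<Theta>u u z = - (H ((1 - z) / (1 - u)) - (1 - z) / (1 - u) * H1 ((1 - z) / (1 - u)))"
    unfolding \<Theta>u_def H1_right[OF q] H_right[OF q] by (simp add: algebra_simps)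
qed

lemma \<Theta>_left: assumes "0 < u" "u < 1" "z \<le> 0"
  shows "\<Theta> u z = - H1 0 * z" "\<Theta>z u z = - H1 0" "\<Theta>u u z = 0"
proof -
  have z: "z \<le> u" "z / u \<le> 0" using assms by (auto simp: divide_le_0_iff)
  show "\<Theta> u z = - H1 0 * z" unfolding \<Theta>_lower[OF assms(1,2) z(1)] H_left[OF z(2)] using assms by simp
  show "\<Theta>z u z = - H1 0" unfolding \<Theta>_lower[OF assms(1,2) z(1)] H1_left[OF z(2)] by simp
  show "\<Theta>u u z = 0" unfolding \<Theta>_lower[OF assms(1,2) z(1)] H1_left[OF z(2)] H_left[OF z(2)] by simp
qed

lemma \<Theta>_right: assumes "0 < u" "u < 1" "1 \<le> z"
  shows "\<Theta> u z = - H1 0 * (z - 1)" "\<Theta>z u z = - H1 0" "\<Theta>u u z = 0"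
proof -
  have z: "u \<le> z" "(1 - z) / (1 - u) \<le> 0" using assms by (auto simp: divide_le_0_iff)
  show "\<Theta> u z = - H1 0 * (z - 1)" unfolding \<Theta>_upper[OF assms(1,2) z(1)] H_left[OF z(2)] using assms by (simp add: field_simps)
  show "\<Theta>z u z = - H1 0" unfolding \<Theta>_upper[OF assms(1,2) z(1)] H1_left[OF z(2)] by simp
  show "\<Theta>u u z = 0" unfolding \<Theta>_upper[OF assms(1,2) z(1)] H1_left[OF z(2)] H_left[OF z(2)] by simp
qed

lemma \<Theta>_periodize:
  assumes u: "0 < u" "u < 1" and z: "- real M \<le> z" "z < real M"
  shows "(\<Sum>l\<in>{- int M..<int M}. \<Theta> u (z - of_int l)) = \<Theta> u (frac z) - (2 * real M - 1) * H1 0 * z"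
    "(\<Sum>l\<in>{- int M..<int M}. \<Theta>z u (z - of_int l)) = \<Theta>z u (frac z) - (2 * real M - 1) * H1 0"
    "(\<Sum>l\<in>{- int M..<int M}. \<Theta>u u (z - of_int l)) = \<Theta>u u (frac z)"
  using periodize[of "\<Theta> u" 0 "H1 0", OF _ _ z] \<Theta>_left(1)[OF u] \<Theta>_right(1)[OF u]
    periodize[of "\<Theta>z u" "- H1 0" 0, OF _ _ z] \<Theta>_left(2)[OF u] \<Theta>_right(2)[OF u]
    periodize[of "\<Theta>u u" 0 0, OF _ _ z] \<Theta>_left(3)[OF u] \<Theta>_right(3)[OF u]
  by (simp_all add: algebra_simps)

text \<open>
  Strict monotonicity in \<open>u\<close> is the positivity of the intercepts of the tangents.
\<close>

lemma \<Theta>u_neg: assumes "0 < u" "u < 1" "0 < z" "z < 1" shows "\<Theta>u u z < 0"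
proof (cases "z \<le> u")
  case True
  have "H (z / u) - z / u * H1 (z / u) > 0" using True assms by (intro intercept_pos) auto
  then show ?thesis using \<Theta>_lower(3)[OF assms(1,2) True] by simp
next
  case False
  then have "u \<le> z" by simp
  have "H ((1 - z) / (1 - u)) - (1 - z) / (1 - u) * H1 ((1 - z) / (1 - u)) > 0"
    using False assms by (intro intercept_pos) auto
  then show ?thesis using \<Theta>_upper(3)[OF assms(1,2) \<open>u \<le> z\<close>] by simp
qed

lemma \<Theta>_0: "0 < u \<Longrightarrow> u < 1 \<Longrightarrow> \<Theta> u 0 = 0" "0 < u \<Longrightarrow> u < 1 \<Longrightarrow> \<Theta>u u 0 = 0"
  using \<Theta>_left(1,3)[of u 0] by auto

end

section \<open>The level function and its critical points\<close>

locale level_function = profile +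
  fixes n k :: nat assumes kn: "k \<le> n"
begin

text \<open>
  The \<open>N = n - k + 1\<close> points on the circle, in full turns and indexed by \<open>{k..n}\<close>. The last one makes their sum
  equal to \<open>1/2\<close> as a real number and not only modulo \<open>1\<close>, so that all of them are affine in \<open>x\<close>.
\<close>

definition turn :: "nat \<Rightarrow> (nat \<Rightarrow> real) \<Rightarrow> real" where
  "turn i x = (if i < n then x i / (2 * pi) else 1 / 2 - (\<Sum>l\<in>{k..<n}. x l / (2 * pi)))"

definition balance :: "(nat \<Rightarrow> real) \<Rightarrow> real \<Rightarrow> real" where
  "balance x u = (\<Sum>i\<in>{k..n}. \<Theta> u (frac (turn i x)))"

lemma points_split: "{k..n} = insert n {k..<n}" "n \<notin> {k..<n}"
  using kn by auto

lemma sum_turn: "(\<Sum>i\<in>{k..n}. turn i x) = 1 / 2"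
proof -
  have "(\<Sum>i\<in>{k..n}. turn i x) = turn n x + (\<Sum>i\<in>{k..<n}. turn i x)"
    unfolding points_split(1) by simp
  also have "(\<Sum>i\<in>{k..<n}. turn i x) = (\<Sum>l\<in>{k..<n}. x l / (2 * pi))"
    by (intro sum.cong) (auto simp: turn_def)
  finally show ?thesis by (simp add: turn_def)
qed

lemma sum_frac_not_int: "(\<Sum>i\<in>{k..n}. frac (turn i x)) \<noteq> of_int m"
proof
  assume e: "(\<Sum>i\<in>{k..n}. frac (turn i x)) = of_int m"
  have "(\<Sum>i\<in>{k..n}. frac (turn i x)) = 1 / 2 - of_int (\<Sum>i\<in>{k..n}. \<lfloor>turn i x\<rfloor>)"
    using sum_turn[of x] by (simp add: frac_def sum_subtractf)
  then have "1 / 2 = (of_int (m + (\<Sum>i\<in>{k..n}. \<lfloor>turn i x\<rfloor>)) :: real)" using e by simp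
  then have "(of_int (2 * (m + (\<Sum>i\<in>{k..n}. \<lfloor>turn i x\<rfloor>))) :: real) = of_int 1" by simp
  then have "2 * (m + (\<Sum>i\<in>{k..n}. \<lfloor>turn i x\<rfloor>)) = 1" by (simp only: of_int_eq_iff)
  then show False by presburger
qed

lemma some_frac_pos: "\<exists>i\<in>{k..n}. 0 < frac (turn i x)"
proof (rule ccontr)
  assume "\<not> ?thesis"
  then have "\<And>i. i \<in> {k..n} \<Longrightarrow> frac (turn i x) = 0" using frac_ge_0 by (metis antisym_conv2)
  then have "(\<Sum>i\<in>{k..n}. frac (turn i x)) = 0" by (intro sum.neutral) blast
  then show False using sum_frac_not_int[of x 0] by simp
qed

lemma \<Theta>_DERIV: "0 < u \<Longrightarrow> u < 1 \<Longrightarrow> ((\<lambda>u. \<Theta> u z) has_real_derivative \<Theta>u u z) (at u)"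
proof -
  assume u: "0 < u" "u < 1"
  have "((\<lambda>u. (u, z)) has_derivative (\<lambda>h. (h, 0))) (at u)" by (auto intro!: derivative_eq_intros)
  from has_derivative_compose[OF this \<Theta>_has_derivative[OF u]]
  have "((\<lambda>u. \<Theta> u z) has_derivative (\<lambda>h. \<Theta>u u z * h)) (at u)" by simp
  then show ?thesis by (simp add: has_field_derivative_def)
qed

lemma \<Theta>u_nonpos: assumes "0 < u" "u < 1" shows "\<Theta>u u (frac z) \<le> 0"
proof (cases "frac z = 0")
  case True
  show ?thesis unfolding True \<Theta>_0(2)[OF assms] by (rule order_refl)
next
  case False
  then have "0 < frac z" using frac_ge_0[of z] by linarith
  from \<Theta>u_neg[OF assms this frac_lt_1] show ?thesis by simp
qed

lemma sum_\<Theta>u_neg: assumes "0 < u" "u < 1" shows "(\<Sum>i\<in>{k..n}. \<Theta>u u (frac (turn i x))) < 0"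
proof -
  obtain i where i: "i \<in> {k..n}" "0 < frac (turn i x)" using some_frac_pos by blast
  have "(\<Sum>i\<in>{k..n}. \<Theta>u u (frac (turn i x))) < (\<Sum>i\<in>{k..n}. 0)"
    using \<Theta>u_nonpos[OF assms] \<Theta>u_neg[OF assms i(2) frac_lt_1] i(1)
    by (intro sum_strict_mono_ex1) auto
  then show ?thesis by simp
qed

lemma balance_DERIV: "0 < u \<Longrightarrow> u < 1 \<Longrightarrow> (balance x has_real_derivative (\<Sum>i\<in>{k..n}. \<Theta>u u (frac (turn i x)))) (at u)"
  unfolding balance_def[abs_def] by (intro DERIV_sum \<Theta>_DERIV)

lemma balance_decreasing: assumes "0 < u" "u < v" "v < 1" shows "balance x v < balance x u"
proof (rule DERIV_neg_imp_decreasing[OF assms(2)])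
  fix w assume "u \<le> w" "w \<le> v"
  then have "0 < w" "w < 1" using assms by auto
  then show "\<exists>y. (balance x has_real_derivative y) (at w) \<and> y < 0" using balance_DERIV sum_\<Theta>u_neg by blast
qed

lemma balance_root: "\<exists>u. 0 < u \<and> u < 1 \<and> balance x u = 0"
proof -
  define Y where "Y = (\<lambda>i. frac (turn i x)) ` {i \<in> {k..n}. 0 < frac (turn i x)}"
  have Y: "finite Y" "Y \<noteq> {}" "\<And>y. y \<in> Y \<Longrightarrow> 0 < y \<and> y < 1"
    using some_frac_pos[of x] by (auto simp: Y_def frac_lt_1)
  \<comment> \<open>below all points that differ from the base point only the upper branch counts, above them only the lower one\<close>
  define a b where "a = Min Y / 2" and "b = (1 + Max Y) / 2"
  have ab: "0 < a" "a < 1" "0 < b" "b < 1" "\<And>y. y \<in> Y \<Longrightarrow> a < y" "\<And>y. y \<in> Y \<Longrightarrow> y < b"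
  proof -
    have m: "Min Y \<in> Y" "Max Y \<in> Y" using Y by auto
    then show "0 < a" "a < 1" "0 < b" "b < 1" using Y(3)[OF m(1)] Y(3)[OF m(2)] by (auto simp: a_def b_def)
    show "a < y" if "y \<in> Y" for y
    proof -
      have "Min Y \<le> y" using that Y(1) by simp
      then show ?thesis using Y(3)[OF m(1)] by (simp add: a_def)
    qed
    show "y < b" if "y \<in> Y" for y
    proof -
      have "y \<le> Max Y" using that Y(1) by simp
      then show ?thesis using Y(3)[OF m(2)] by (simp add: b_def)
    qed
  qed
  have pos: "\<Theta> a y > 0" if "y \<in> Y" for y
    using that ab Y(3)[OF that] H_pos[of "(1 - y) / (1 - a)"] \<Theta>_upper(1)[of a y] by (force simp: less_imp_le)
  have neg: "\<Theta> b y < 0" if "y \<in> Y" for y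
    using that ab Y(3)[OF that] H_pos[of "y / b"] \<Theta>_lower(1)[of b y] by (force simp: less_imp_le)
  have balance_eq: "balance x u = (\<Sum>i\<in>{i \<in> {k..n}. 0 < frac (turn i x)}. \<Theta> u (frac (turn i x)))" if "0 < u" "u < 1" for u
    unfolding balance_def
  proof (rule sum.mono_neutral_right)
    show "\<forall>i\<in>{k..n} - {i \<in> {k..n}. 0 < frac (turn i x)}. \<Theta> u (frac (turn i x)) = 0"
    proof
      fix i assume "i \<in> {k..n} - {i \<in> {k..n}. 0 < frac (turn i x)}"
      then have "\<not> 0 < frac (turn i x)" by blast
      then have "frac (turn i x) = 0" using frac_ge_0[of "turn i x"] by linarith
      then show "\<Theta> u (frac (turn i x)) = 0" using \<Theta>_0(1)[OF that] by (simp only:)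
    qed
  qed auto
  have ne: "{i \<in> {k..n}. 0 < frac (turn i x)} \<noteq> {}" using some_frac_pos[of x] by blast
  have Sa: "balance x a > 0" unfolding balance_eq[OF ab(1,2)] using ne pos by (intro sum_pos) (auto simp: Y_def)
  have "0 < (\<Sum>i\<in>{i \<in> {k..n}. 0 < frac (turn i x)}. - \<Theta> b (frac (turn i x)))"
    using ne neg by (intro sum_pos) (auto simp: Y_def)
  then have Sb: "balance x b < 0" unfolding balance_eq[OF ab(3,4)] by (simp add: sum_negf)
  have "a < b" using ab Y(2) by (meson all_not_in_conv less_trans)
  have "\<exists>u. a \<le> u \<and> u \<le> b \<and> balance x u = 0"
  proof (rule IVT2)
    show "\<forall>u. a \<le> u \<and> u \<le> b \<longrightarrow> isCont (balance x) u"
      using ab DERIV_isCont[OF balance_DERIV] by auto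
  qed (use Sa Sb \<open>a < b\<close> in auto)
  then show ?thesis using ab by (meson le_less_trans less_le_trans)
qed

definition level :: "(nat \<Rightarrow> real) \<Rightarrow> real" where
  "level x = (THE u. 0 < u \<and> u < 1 \<and> balance x u = 0)"

lemma level: "0 < level x" "level x < 1" "balance x (level x) = 0"
proof -
  have "\<exists>!u. 0 < u \<and> u < 1 \<and> balance x u = 0"
  proof (rule ex_ex1I[OF balance_root])
    fix u v assume "0 < u \<and> u < 1 \<and> balance x u = 0" "0 < v \<and> v < 1 \<and> balance x v = 0"
    then show "u = v" using balance_decreasing[of u v x] balance_decreasing[of v u x] by (cases u v rule: linorder_cases) auto
  qed
  from theI'[OF this] show "0 < level x" "level x < 1" "balance x (level x) = 0" by (auto simp: level_def)
qed

lemma balance_sign: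
  assumes "0 < v" "v < 1"
  shows "balance x v > 0 \<longleftrightarrow> v < level x" "balance x v < 0 \<longleftrightarrow> level x < v"
  using balance_decreasing[of v "level x" x] balance_decreasing[of "level x" v x] level[of x] assms
  by (cases v "level x" rule: linorder_cases; force)+

lemma frac_turn_cong:
  assumes "torus_exp n x = torus_exp n y" "i \<in> {k..n}"
  shows "frac (turn i x) = frac (turn i y)"
proof -
  obtain v where v: "\<forall>i<n. x i = period_shift v y i" using assms(1) unfolding torus_exp_eq_iff by blast
  have v': "x i / (2 * pi) = y i / (2 * pi) + of_int (v i)" if "i < n" for i
    using v that by (simp add: period_shift_def add_divide_distrib)
  have fr: "frac (r + of_int m) = frac r" for r :: real and m by (simp add: frac_def)
  show ?thesis
  proof (cases "i < n")
    case True
    then show ?thesis using v' fr by (simp add: turn_def)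
  next
    case False
    have "(\<Sum>l\<in>{k..<n}. x l / (2 * pi)) = (\<Sum>l\<in>{k..<n}. y l / (2 * pi)) + of_int (\<Sum>l\<in>{k..<n}. v l)"
      using v' by (simp add: sum.distrib)
    then have "turn i x = turn i y + of_int (- (\<Sum>l\<in>{k..<n}. v l))" using False by (simp add: turn_def)
    then show ?thesis using fr by metis
  qed
qed

lemma level_cong: assumes "torus_exp n x = torus_exp n y" shows "level x = level y"
proof -
  have "balance x u = balance y u" for u
    unfolding balance_def by (intro sum.cong refl) (simp only: frac_turn_cong[OF assms])
  then have "balance x = balance y" by (rule ext)
  then show ?thesis by (simp add: level_def)
qed

definition turn_deriv :: "nat \<Rightarrow> nat \<Rightarrow> real" where
  "turn_deriv l i = (if i < n then (if i = l then 1 / (2 * pi) else 0) else if k \<le> l then - 1 / (2 * pi) else 0)"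

lemma turn_update: assumes "l < n" shows "turn i (x(l := t)) = turn i x + turn_deriv l i * (t - x l)"
proof (cases "i < n")
  case True
  then show ?thesis by (auto simp: turn_def turn_deriv_def field_simps)
next
  case False
  have "(\<Sum>j\<in>{k..<n}. (x(l := t)) j / (2 * pi)) = (\<Sum>j\<in>{k..<n}. x j / (2 * pi) + (if j = l then (t - x l) / (2 * pi) else 0))"
    by (intro sum.cong) (auto simp: field_simps)
  also have "\<dots> = (\<Sum>j\<in>{k..<n}. x j / (2 * pi)) + (if k \<le> l then (t - x l) / (2 * pi) else 0)"
    using assms by (simp add: sum.distrib)
  finally show ?thesis using False by (auto simp: turn_def turn_deriv_def field_simps)
qed

lemma continuous_turn: "continuous_on A (turn i)"
proof -
  have "continuous_on A (\<lambda>x :: nat \<Rightarrow> real. x l)" for l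
    by (rule continuous_on_subset[OF continuous_on_product_coordinates]) simp
  then show ?thesis unfolding turn_def[abs_def]
    by (cases "i < n") (auto intro!: continuous_intros)
qed

definition region :: "nat \<Rightarrow> (nat \<Rightarrow> real) set" where
  "region M = {x. \<forall>i\<in>{k..n}. \<bar>turn i x\<bar> < real M}"

lemma in_some_region: "\<exists>M. x \<in> region M"
proof -
  obtain M :: nat where M: "real M > (\<Sum>i\<in>{k..n}. \<bar>turn i x\<bar>)" using reals_Archimedean2 by blast
  have "\<bar>turn i x\<bar> < real M" if "i \<in> {k..n}" for i
  proof -
    have "\<bar>turn i x\<bar> \<le> (\<Sum>i\<in>{k..n}. \<bar>turn i x\<bar>)" using that by (intro member_le_sum) auto
    then show ?thesis using M by simp
  qed
  then have "x \<in> region M" by (simp add: region_def)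
  then show ?thesis by blast
qed

lemma open_region: "open (region M)"
proof -
  have "region M = (\<Inter>i\<in>{k..n}. {x. \<bar>turn i x\<bar> < real M})" by (auto simp: region_def)
  moreover have "open {x. \<bar>turn i x\<bar> < real M}" for i
    using continuous_turn[of UNIV i] by (intro open_Collect_less continuous_intros) auto
  ultimately show ?thesis by auto
qed

text \<open>On a region, the fractional parts are replaced by sums that are smooth expressions.\<close>

definition smooth_balance :: "nat \<Rightarrow> (nat \<Rightarrow> real) \<Rightarrow> real \<Rightarrow> real" where
  "smooth_balance M x u = (\<Sum>i\<in>{k..n}. (\<Sum>l\<in>{- int M..<int M}. \<Theta> u (turn i x - of_int l)) + (2 * real M - 1) * H1 0 * turn i x)"

definition smooth_slope :: "nat \<Rightarrow> nat \<Rightarrow> (nat \<Rightarrow> real) \<Rightarrow> real \<Rightarrow> real" where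
  "smooth_slope M i x u = (\<Sum>l\<in>{- int M..<int M}. \<Theta>z u (turn i x - of_int l)) + (2 * real M - 1) * H1 0"

definition smooth_balance_u :: "nat \<Rightarrow> (nat \<Rightarrow> real) \<Rightarrow> real \<Rightarrow> real" where
  "smooth_balance_u M x u = (\<Sum>i\<in>{k..n}. \<Sum>l\<in>{- int M..<int M}. \<Theta>u u (turn i x - of_int l))"

lemma region_eqs:
  assumes "x \<in> region M" "0 < u" "u < 1"
  shows "balance x u = smooth_balance M x u" "i \<in> {k..n} \<Longrightarrow> smooth_slope M i x u = \<Theta>z u (frac (turn i x))"
    "smooth_balance_u M x u = (\<Sum>i\<in>{k..n}. \<Theta>u u (frac (turn i x)))"
proof -
  have b: "- real M \<le> turn i x" "turn i x < real M" if "i \<in> {k..n}" for i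
    using assms(1) that by (force simp: region_def)+
  show "balance x u = smooth_balance M x u" unfolding balance_def smooth_balance_def
    using \<Theta>_periodize(1)[OF assms(2,3) b] by (intro sum.cong) auto
  show "smooth_slope M i x u = \<Theta>z u (frac (turn i x))" if "i \<in> {k..n}"
    unfolding smooth_slope_def using \<Theta>_periodize(2)[OF assms(2,3) b[OF that]] by simp
  show "smooth_balance_u M x u = (\<Sum>i\<in>{k..n}. \<Theta>u u (frac (turn i x)))" unfolding smooth_balance_u_def
    using \<Theta>_periodize(3)[OF assms(2,3) b] by (intro sum.cong) auto
qed

lemma continuous_H: "continuous_on A H"
  using DERIV_continuous_on[of A H H1] H by (auto intro: has_field_derivative_at_within)

lemma continuous_smooth_balance: assumes "0 < v" "v < 1" shows "continuous_on UNIV (\<lambda>x. smooth_balance M x v)"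
  unfolding smooth_balance_def \<Theta>_def
  by (intro continuous_intros continuous_turn continuous_on_compose2[OF continuous_H[of UNIV]])
     (use assms in auto)

lemma isCont_level: "isCont level x"
  unfolding isCont_def
proof (rule order_tendstoI)
  obtain M where M: "x \<in> region M" using in_some_region by blast
  have reg: "\<forall>\<^sub>F y in at x. y \<in> region M"
    using open_region M by (auto simp: eventually_at_topological)
  have tend: "((\<lambda>y. smooth_balance M y v) \<longlongrightarrow> smooth_balance M x v) (at x)" if "0 < v" "v < 1" for v
    using continuous_smooth_balance[OF that, of M] by (simp add: continuous_on_eq_continuous_at isCont_def)
  show "\<forall>\<^sub>F y in at x. a < level y" if a: "a < level x" for a
  proof -
    define v where "v = (max a 0 + level x) / 2"
    have v: "0 < v" "v < 1" "a < v" "v < level x" using a level[of x] by (auto simp: v_def)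
    have "0 < smooth_balance M x v" using balance_sign(1)[OF v(1,2), of x] v(4) region_eqs(1)[OF M v(1,2)] by simp
    from order_tendstoD(1)[OF tend[OF v(1,2)] this] reg show ?thesis
    proof eventually_elim
      case (elim y)
      then have "v < level y" using balance_sign(1)[OF v(1,2), of y] elim(1) region_eqs(1)[OF elim(2) v(1,2)] by simp
      then show ?case using v(3) by simp
    qed
  qed
  show "\<forall>\<^sub>F y in at x. level y < a" if a: "level x < a" for a
  proof -
    define v where "v = (min a 1 + level x) / 2"
    have v: "0 < v" "v < 1" "v < a" "level x < v" using a level[of x] by (auto simp: v_def)
    have "smooth_balance M x v < 0" using balance_sign(2)[OF v(1,2), of x] v(4) region_eqs(1)[OF M v(1,2)] by simp
    from order_tendstoD(2)[OF tend[OF v(1,2)] this] reg show ?thesis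
    proof eventually_elim
      case (elim y)
      then have "level y < v" using balance_sign(2)[OF v(1,2), of y] elim(1) region_eqs(1)[OF elim(2) v(1,2)] by simp
      then show ?case using v(3) by simp
    qed
  qed
qed

lemma continuous_update: "continuous_on A (\<lambda>t::real. x(l := t))"
proof (rule continuous_on_coordinatewise_then_product)
  show "continuous_on A (\<lambda>t. (x(l := t)) i)" for i by (cases "i = l") auto
qed

text \<open>
  Implicit differentiation, on a region where the fractional parts have been removed.
\<close>

lemma level_partial:
  assumes x: "x \<in> region M" and l: "l < n"
  shows "((\<lambda>t. level (x(l := t))) has_real_derivative
    - (\<Sum>i\<in>{k..n}. turn_deriv l i * smooth_slope M i x (level x)) / smooth_balance_u M x (level x)) (at (x l))"
proof -
  let ?u = "level x"
  have u: "0 < ?u" "?u < 1" using level by auto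
  define A where "A = (\<Sum>i\<in>{k..n}. turn_deriv l i * smooth_slope M i x ?u)"
  define B where "B = smooth_balance_u M x ?u"
  have z0: "turn i (x(l := x l)) = turn i x" for i by simp
  have one: "((\<lambda>q. \<Theta> (snd q) (turn i x + turn_deriv l i * (fst q - x l) - c)) has_derivative
      (\<lambda>q. \<Theta>u ?u (turn i x - c) * snd q + \<Theta>z ?u (turn i x - c) * (turn_deriv l i * fst q))) (at (x l, ?u))" for i c
  proof -
    have g: "((\<lambda>q. (snd q, turn i x + turn_deriv l i * (fst q - x l) - c)) has_derivative (\<lambda>q. (snd q, turn_deriv l i * fst q))) (at (x l, ?u))"
      by (auto intro!: derivative_eq_intros)
    have "((\<lambda>q. \<Theta> (fst q) (snd q)) has_derivative (\<lambda>q. \<Theta>u ?u (turn i x - c) * fst q + \<Theta>z ?u (turn i x - c) * snd q))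
        (at (snd (x l, ?u), turn i x + turn_deriv l i * (fst (x l, ?u) - x l) - c))"
      using \<Theta>_has_derivative[OF u, of "turn i x - c"] by simp
    from has_derivative_compose[OF g this] show ?thesis by simp
  qed
  have "((\<lambda>q. \<Sum>i\<in>{k..n}. (\<Sum>m\<in>{- int M..<int M}. \<Theta> (snd q) (turn i x + turn_deriv l i * (fst q - x l) - of_int m)) +
        (2 * real M - 1) * H1 0 * (turn i x + turn_deriv l i * (fst q - x l)))
      has_derivative (\<lambda>q. \<Sum>i\<in>{k..n}. (\<Sum>m\<in>{- int M..<int M}. \<Theta>u ?u (turn i x - of_int m) * snd q + \<Theta>z ?u (turn i x - of_int m) * (turn_deriv l i * fst q)) +
        (2 * real M - 1) * H1 0 * (turn_deriv l i * fst q))) (at (x l, ?u))"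
    by (intro has_derivative_sum has_derivative_add one) (auto intro!: derivative_eq_intros)
  moreover have "(\<lambda>q. \<Sum>i\<in>{k..n}. (\<Sum>m\<in>{- int M..<int M}. \<Theta>u ?u (turn i x - of_int m) * snd q + \<Theta>z ?u (turn i x - of_int m) * (turn_deriv l i * fst q)) +
        (2 * real M - 1) * H1 0 * (turn_deriv l i * fst q)) = (\<lambda>q. A * fst q + B * snd q)"
    by (simp add: fun_eq_iff A_def B_def smooth_slope_def smooth_balance_u_def sum.distrib sum_subtractf sum_distrib_left sum_distrib_right algebra_simps)
  moreover have "(\<lambda>q. \<Sum>i\<in>{k..n}. (\<Sum>m\<in>{- int M..<int M}. \<Theta> (snd q) (turn i x + turn_deriv l i * (fst q - x l) - of_int m)) +
        (2 * real M - 1) * H1 0 * (turn i x + turn_deriv l i * (fst q - x l))) = (\<lambda>q. smooth_balance M (x(l := fst q)) (snd q))"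
    by (simp add: smooth_balance_def turn_update[OF l] fun_eq_iff)
  ultimately have "((\<lambda>q. smooth_balance M (x(l := fst q)) (snd q)) has_derivative (\<lambda>q. A * fst q + B * snd q)) (at (x l, ?u))"
    by simp
  then have "((\<lambda>q. balance (x(l := fst q)) (snd q)) has_derivative (\<lambda>q. A * fst q + B * snd q)) (at (x l, ?u))"
  proof (rule has_derivative_transform_within_open)
    have "open ((\<lambda>t. x(l := t)) -` region M)"
      using continuous_update[of UNIV x l] open_region by (simp add: continuous_on_open_vimage)
    then show "open (((\<lambda>t. x(l := t)) -` region M) \<times> {0<..<1::real})" by (intro open_Times) auto
    show "(x l, ?u) \<in> ((\<lambda>t. x(l := t)) -` region M) \<times> {0<..<1}" using x u by simp
    show "smooth_balance M (x(l := fst q)) (snd q) = balance (x(l := fst q)) (snd q)"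
      if "q \<in> ((\<lambda>t. x(l := t)) -` region M) \<times> {0<..<1}" for q
      using region_eqs(1) that by auto
  qed
  then have der: "((\<lambda>q. balance (x(l := fst q)) (snd q)) has_derivative (\<lambda>q. A * fst q + B * snd q))
      (at (x l, level (x(l := x l))))" by simp
  have Bneg: "B \<noteq> 0" using region_eqs(3)[OF x u] sum_\<Theta>u_neg[OF u, of x] by (simp add: B_def)
  have "isCont (\<lambda>t. level (x(l := t))) (x l)"
  proof -
    have c: "isCont (\<lambda>t. x(l := t)) (x l)"
      using continuous_update[of UNIV x l] by (simp only: continuous_on_eq_continuous_at[OF open_UNIV] UNIV_I)
    show ?thesis by (rule isCont_o2[OF c]) (rule isCont_level)
  qed
  from implicit_derivative[where \<Psi> = "\<lambda>t. balance (x(l := t))", OF level(3) this der Bneg]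
  show ?thesis unfolding A_def B_def .
qed

text \<open>
  By \<open>level_partial\<close> the partial derivatives of the level function are expressions in the coordinates,
  the level function itself, the profile and its derivatives.
\<close>

lemma C_infinity_level: "C_infinity n (topspace (Euclidean_space n)) level"
proof -
  define Bs where "Bs = insert level (range (\<lambda>l (x :: nat \<Rightarrow> real). x l))"
  define \<Phi> where "\<Phi> = insert H (insert H1 (range flat))"
  have region: "C_infinity n (region M \<inter> topspace (Euclidean_space n)) level" for M
  proof -
    let ?W = "region M \<inter> topspace (Euclidean_space n)"
    let ?terms = "smooth_terms Bs \<Phi> ?W"
    have level_in: "level \<in> ?terms" by (rule smooth_terms.base) (simp add: Bs_def)
    have co_in: "(\<lambda>x. x l) \<in> ?terms" for l by (rule smooth_terms.base) (simp add: Bs_def)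
    have turn_in: "turn i \<in> ?terms" for i
      unfolding turn_def[abs_def]
      by (cases "i < n") (auto intro!: smooth_terms_divide smooth_terms_diff smooth_terms_sum co_in smooth_terms.const)
    have H1_in: "(\<lambda>x. H1 (f x)) \<in> ?terms" if "f \<in> ?terms" for f
      by (rule smooth_terms.comp[OF _ that]) (simp add: \<Phi>_def)
    have H_in: "(\<lambda>x. H (f x)) \<in> ?terms" if "f \<in> ?terms" for f
      by (rule smooth_terms.comp[OF _ that]) (simp add: \<Phi>_def)
    have flat_in: "(\<lambda>x. flat a (f x)) \<in> ?terms" if "f \<in> ?terms" for f a
      by (rule smooth_terms.comp[OF _ that]) (simp add: \<Phi>_def)
    have level01: "level x \<noteq> 0" "1 - level x \<noteq> 0" for x using level[of x] by auto
    note intros = smooth_terms.add smooth_terms.mult smooth_terms_divide smooth_terms_diff smooth_terms_uminus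
      smooth_terms_sum smooth_terms.const level_in turn_in H1_in H_in
    have smooth_slope_in: "(\<lambda>x. smooth_slope M i x (level x)) \<in> ?terms" for i
      unfolding smooth_slope_def \<Theta>z_def by (intro intros) (use level01 in auto)
    have smooth_balance_u_in: "(\<lambda>x. smooth_balance_u M x (level x)) \<in> ?terms"
      unfolding smooth_balance_u_def \<Theta>u_def by (intro intros) (use level01 in auto)
    show ?thesis
    proof (rule smooth_terms_C_infinity[OF _ _ _ _ level_in])
      show "continuous_on ?W b" if "b \<in> Bs" for b
      proof -
        have "continuous_on ?W (\<lambda>x. x l)" for l
          by (rule continuous_on_subset[OF continuous_on_product_coordinates]) simp
        moreover have "continuous_on ?W level" using isCont_level by (simp add: continuous_at_imp_continuous_on)
        ultimately show ?thesis using that by (auto simp: Bs_def)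
      qed
      show "\<exists>g\<in>?terms. \<forall>x\<in>?W. ((\<lambda>t. b (x(i := t))) has_real_derivative g x) (at (x i))" if b: "b \<in> Bs" and i: "i < n" for b i
      proof (cases "b = level")
        case True
        have T_in: "(\<lambda>x. - (\<Sum>j\<in>{k..n}. turn_deriv i j * smooth_slope M j x (level x)) / smooth_balance_u M x (level x)) \<in> ?terms"
        proof (intro smooth_terms_divide smooth_terms_uminus smooth_terms_sum smooth_terms.mult smooth_terms.const smooth_slope_in smooth_balance_u_in)
          fix x assume "x \<in> ?W"
          then have "x \<in> region M" by simp
          then show "smooth_balance_u M x (level x) \<noteq> 0"
            using region_eqs(3)[OF _ level(1,2), of x M x] sum_\<Theta>u_neg[OF level(1,2), of x x] by simp
        qed
        show ?thesis unfolding True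
          by (rule bexI[OF _ T_in], rule ballI, rule level_partial[OF _ i]) (erule IntD1)
      next
        case False
        then obtain l where l: "b = (\<lambda>x. x l)" using b by (auto simp: Bs_def)
        have "((\<lambda>t. (x(i := t)) l) has_real_derivative (if l = i then 1 else 0)) (at (x i))" for x :: "nat \<Rightarrow> real"
          by (cases "l = i") auto
        then show ?thesis unfolding l by (intro bexI[of _ "\<lambda>_. if l = i then 1 else 0"] smooth_terms.const ballI)
      qed
      show "\<exists>\<phi>'. (\<forall>x. (\<phi> has_real_derivative \<phi>' x) (at x)) \<and> (\<forall>f\<in>?terms. (\<lambda>x. \<phi>' (f x)) \<in> ?terms)"
        if phi: "\<phi> \<in> \<Phi>" for \<phi>
      proof -
        consider "\<phi> = H" | "\<phi> = H1" | a where "\<phi> = flat a" using phi by (auto simp: \<Phi>_def)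
        then show ?thesis
        proof cases
          case 1
          then show ?thesis using H H1_in by blast
        next
          case 2
          have "(\<lambda>x. - (flat 0 (f x) * flat 0 (1 - f x))) \<in> ?terms" if "f \<in> ?terms" for f
            using that by (intro smooth_terms_uminus smooth_terms.mult flat_in smooth_terms_diff smooth_terms.const)
          then show ?thesis using H1 unfolding 2 by (intro exI[of _ "\<lambda>x. - (flat 0 x * flat 0 (1 - x))"]) blast
        next
          case 3
          have "(\<lambda>x. flat (a + 2) (f x) - real a * flat (a + 1) (f x)) \<in> ?terms" if "f \<in> ?terms" for f
            using that by (intro smooth_terms.mult flat_in smooth_terms_diff smooth_terms.const)
          then show ?thesis using flat_derivative unfolding 3
            by (intro exI[of _ "\<lambda>x. flat (a + 2) x - real a * flat (a + 1) x"]) blast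
        qed
      qed
    qed simp
  qed
  show ?thesis
    unfolding C_infinity_def
  proof
    fix r
    show "C_diff n r (topspace (Euclidean_space n)) level"
    proof (rule C_diff_locally)
      fix x assume x: "x \<in> topspace (Euclidean_space n)"
      obtain M where M: "x \<in> region M" using in_some_region by blast
      have "openin (Euclidean_space n) (region M \<inter> topspace (Euclidean_space n))"
        unfolding Euclidean_space_top_of_set using open_region by (auto simp: openin_open Int_commute)
      then show "\<exists>V. openin (Euclidean_space n) V \<and> x \<in> V \<and> V \<subseteq> topspace (Euclidean_space n) \<and> C_diff n r V level"
        using region[of M] M x unfolding C_infinity_def by blast
    qed simp
  qed
qed

definition crit_level :: "nat \<Rightarrow> real" where "crit_level j = (1 / 2 + real j) / real (n - k + 1)"

lemma crit_level_bounds: assumes "j \<le> n - k" shows "0 < crit_level j" "crit_level j < 1"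
  using assms by (auto simp: crit_level_def field_simps)

text \<open>
  This is the computation of the introduction; \<open>s i\<close> is the argument of the profile at the \<open>i\<close>-th
  point, and \<open>Up\<close> is the set of points beyond \<open>u\<close>.
\<close>

lemma equal_slopes_iff:
  "(\<forall>i\<in>{k..n}. \<Theta>z (level x) (frac (turn i x)) = \<Theta>z (level x) (frac (turn n x))) \<longleftrightarrow>
    (\<exists>j\<le>n - k. \<forall>i\<in>{k..<n}. frac (x i / (2 * pi)) = crit_level j)"
proof
  let ?N = "real (n - k + 1)"
  have card: "card {k..n} = n - k + 1" using kn by simp
  assume eq: "\<forall>i\<in>{k..n}. \<Theta>z (level x) (frac (turn i x)) = \<Theta>z (level x) (frac (turn n x))"
  define u where "u = level x"
  define y where "y = (\<lambda>i. frac (turn i x))"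
  have u: "0 < u" "u < 1" using level by (auto simp: u_def)
  have y: "0 \<le> y i" "y i < 1" for i by (simp_all add: y_def frac_lt_1)
  define s where "s = (\<lambda>i. if y i \<le> u then y i / u else (1 - y i) / (1 - u))"
  have s: "0 \<le> s i" "s i \<le> 1" for i using u y[of i] by (auto simp: s_def)
  have slope: "\<Theta>z u (y i) = - H1 (s i)" for i
    using \<Theta>_lower(2)[OF u] \<Theta>_upper(2)[OF u] by (auto simp: s_def)
  define \<xi> where "\<xi> = s n"
  have sx: "s i = \<xi>" if "i \<in> {k..n}" for i
  proof (rule H1_inj[OF s(1) s(2)])
    have "\<Theta>z u (y i) = \<Theta>z u (y n)" using eq that unfolding u_def y_def by blast
    then show "H1 (s i) = H1 \<xi>" unfolding slope \<xi>_def by simp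
  qed (simp_all add: \<xi>_def s)
  define Up where "Up = {i \<in> {k..n}. u < y i}"
  define q where "q = real (card Up)"
  have ind: "(\<Sum>i\<in>{k..n}. if u < y i then c else d) = q * c + (?N - q) * d" for c d :: real
  proof -
    have sub: "Up \<subseteq> {k..n}" by (auto simp: Up_def)
    have "(\<Sum>i\<in>{k..n}. if u < y i then c else d) = (\<Sum>i\<in>{k..n}. d + (if u < y i then c - d else 0))"
      by (intro sum.cong) auto
    also have "\<dots> = ?N * d + (\<Sum>i\<in>{k..n}. if u < y i then c - d else 0)"
      using card by (simp add: sum.distrib)
    also have "(\<Sum>i\<in>{k..n}. if u < y i then c - d else 0) = (\<Sum>i\<in>Up. c - d)"
      unfolding Up_def by (rule sum.inter_filter[symmetric]) simp
    finally show ?thesis by (simp add: q_def algebra_simps)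
  qed
  have y_eq: "y i = (if u < y i then 1 - (1 - u) * \<xi> else u * \<xi>)" if "i \<in> {k..n}" for i
    using sx[OF that] u by (auto simp: s_def field_simps split: if_splits)
  have sum_y: "(\<Sum>i\<in>{k..n}. y i) = \<xi> * (?N * u - q) + q"
  proof -
    have "(\<Sum>i\<in>{k..n}. y i) = (\<Sum>i\<in>{k..n}. if u < y i then 1 - (1 - u) * \<xi> else u * \<xi>)"
      by (intro sum.cong y_eq) auto
    then show ?thesis unfolding ind by (simp add: algebra_simps)
  qed
  have "balance x u = (\<Sum>i\<in>{k..n}. if u < y i then (1 - u) * H \<xi> else - u * H \<xi>)"
    unfolding balance_def
  proof (intro sum.cong refl)
    fix i assume i: "i \<in> {k..n}"
    have fy: "frac (turn i x) = y i" by (simp add: y_def)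
    show "\<Theta> u (frac (turn i x)) = (if u < y i then (1 - u) * H \<xi> else - u * H \<xi>)"
      unfolding fy using \<Theta>_lower(1)[OF u, of "y i"] \<Theta>_upper(1)[OF u, of "y i"] sx[OF i] by (auto simp: s_def split: if_splits)
  qed
  also have "\<dots> = H \<xi> * (q - ?N * u)" unfolding ind by (simp add: algebra_simps)
  finally have "H \<xi> * (q - ?N * u) = 0" using level(3)[of x] by (simp add: u_def)
  moreover have not_int: "(\<Sum>i\<in>{k..n}. y i) \<noteq> of_int m" for m
    using sum_frac_not_int by (simp add: y_def)
  have "q \<noteq> ?N * u"
  proof
    assume "q = ?N * u"
    then have "(\<Sum>i\<in>{k..n}. y i) = of_int (int (card Up))" using sum_y by (simp add: q_def)
    then show False using not_int by blast
  qed
  ultimately have "H \<xi> = 0" by simp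
  then have "\<xi> = 0 \<or> \<xi> = 1" using H_pos[of \<xi>] s[of n] by (auto simp: \<xi>_def less_le)
  moreover have "\<xi> \<noteq> 0"
  proof
    assume "\<xi> = 0"
    then have "(\<Sum>i\<in>{k..n}. y i) = of_int (int (card Up))" using sum_y by (simp add: q_def)
    then show False using not_int by blast
  qed
  ultimately have "\<xi> = 1" by blast
  then have yu: "y i = u" if "i \<in> {k..n}" for i using y_eq[OF that] by (auto split: if_splits)
  then have "(\<Sum>i\<in>{k..n}. y i) = ?N * u" using card by simp
  moreover have "(\<Sum>i\<in>{k..n}. y i) = 1 / 2 - of_int (\<Sum>i\<in>{k..n}. \<lfloor>turn i x\<rfloor>)"
    using sum_turn[of x] by (simp add: y_def frac_def sum_subtractf)
  ultimately have Nu: "?N * u = 1 / 2 + of_int (- (\<Sum>i\<in>{k..n}. \<lfloor>turn i x\<rfloor>))" by simp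
  define j where "j = - (\<Sum>i\<in>{k..n}. \<lfloor>turn i x\<rfloor>)"
  have Nj: "?N * u = 1 / 2 + of_int j" using Nu by (simp add: j_def)
  have N0: "?N > 0" by simp
  have "0 < ?N * u" using N0 u(1) by (rule mult_pos_pos)
  moreover have "?N * u < ?N" using mult_strict_left_mono[OF u(2) N0] by simp
  ultimately have "- 1 / 2 < real_of_int j" "real_of_int j < ?N - 1 / 2" unfolding Nj by argo+
  then have j: "0 \<le> j" "j < int (n - k + 1)" by linarith+
  have "u = crit_level (nat j)"
    using Nj j(1) by (simp add: crit_level_def field_simps)
  moreover have "frac (x i / (2 * pi)) = u" if "i \<in> {k..<n}" for i
    using yu[of i] that by (simp add: y_def turn_def)
  ultimately show "\<exists>j\<le>n - k. \<forall>i\<in>{k..<n}. frac (x i / (2 * pi)) = crit_level j"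
    using j by (intro exI[of _ "nat j"]) auto
next
  let ?N = "real (n - k + 1)"
  assume "\<exists>j\<le>n - k. \<forall>i\<in>{k..<n}. frac (x i / (2 * pi)) = crit_level j"
  then obtain j where j: "j \<le> n - k" "\<And>i. i \<in> {k..<n} \<Longrightarrow> frac (x i / (2 * pi)) = crit_level j" by blast
  let ?c = "crit_level j"
  have c: "0 < ?c" "?c < 1" using crit_level_bounds[OF j(1)] by auto
  have f1: "frac (turn i x) = ?c" if "i \<in> {k..<n}" for i
    using j(2)[OF that] that by (simp add: turn_def)
  have "(\<Sum>l\<in>{k..<n}. x l / (2 * pi)) = (\<Sum>l\<in>{k..<n}. ?c + of_int \<lfloor>x l / (2 * pi)\<rfloor>)"
  proof (intro sum.cong refl)
    fix l assume "l \<in> {k..<n}"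
    from j(2)[OF this] show "x l / (2 * pi) = ?c + of_int \<lfloor>x l / (2 * pi)\<rfloor>" unfolding frac_def by linarith
  qed
  also have "\<dots> = real (n - k) * ?c + of_int (\<Sum>l\<in>{k..<n}. \<lfloor>x l / (2 * pi)\<rfloor>)" by (simp add: sum.distrib)
  also have "real (n - k) * ?c = (1 / 2 + real j) - ?c"
  proof -
    have "?N * ?c = 1 / 2 + real j" by (simp add: crit_level_def)
    then show ?thesis by (simp add: algebra_simps)
  qed
  finally have "turn n x = ?c + of_int (- int j - (\<Sum>l\<in>{k..<n}. \<lfloor>x l / (2 * pi)\<rfloor>))" by (simp add: turn_def)
  moreover have "frac (r + of_int m) = frac r" for r :: real and m by (simp add: frac_def)
  ultimately have "frac (turn n x) = frac ?c" by (simp only:)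
  then have "frac (turn n x) = ?c" using c by (simp add: frac_eq)
  then have all: "frac (turn i x) = ?c" if "i \<in> {k..n}" for i using that f1 unfolding points_split(1) by auto
  then show "\<forall>i\<in>{k..n}. \<Theta>z (level x) (frac (turn i x)) = \<Theta>z (level x) (frac (turn n x))" using kn by auto
qed

text \<open>
  The derivative in the coordinate \<open>l \<ge> k\<close> compares the slope at the \<open>l\<close>-th point with the slope at the
  last point, which moves in the opposite direction.
\<close>

lemma critical_lift_iff:
  assumes x: "x \<in> region M"
  shows "(\<forall>l<n. (\<Sum>i\<in>{k..n}. turn_deriv l i * smooth_slope M i x (level x)) = 0) \<longleftrightarrow>
    (\<exists>j\<le>n - k. \<forall>i\<in>{k..<n}. frac (x i / (2 * pi)) = crit_level j)"
proof -
  let ?t = "\<lambda>i. \<Theta>z (level x) (frac (turn i x))"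
  have smooth_slope: "smooth_slope M i x (level x) = ?t i" if "i \<in> {k..n}" for i using region_eqs(2)[OF x level(1,2) that] .
  have sum: "(\<Sum>i\<in>{k..n}. turn_deriv l i * smooth_slope M i x (level x)) = (if k \<le> l then (?t l - ?t n) / (2 * pi) else 0)" if l: "l < n" for l
  proof -
    have "(\<Sum>i\<in>{k..n}. turn_deriv l i * smooth_slope M i x (level x)) = (\<Sum>i\<in>{k..n}. turn_deriv l i * ?t i)"
      using smooth_slope by (intro sum.cong) auto
    also have "\<dots> = turn_deriv l n * ?t n + (\<Sum>i\<in>{k..<n}. turn_deriv l i * ?t i)" unfolding points_split(1) by simp
    also have "(\<Sum>i\<in>{k..<n}. turn_deriv l i * ?t i) = (\<Sum>i\<in>{k..<n}. if i = l then ?t l / (2 * pi) else 0)"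
      by (intro sum.cong) (auto simp: turn_deriv_def)
    also have "\<dots> = (if k \<le> l then ?t l / (2 * pi) else 0)" using l by simp
    finally show ?thesis using l by (auto simp: turn_deriv_def diff_divide_distrib)
  qed
  have "(\<forall>l<n. (\<Sum>i\<in>{k..n}. turn_deriv l i * smooth_slope M i x (level x)) = 0) \<longleftrightarrow> (\<forall>l\<in>{k..<n}. ?t l = ?t n)"
    using sum by auto
  also have "\<dots> \<longleftrightarrow> (\<forall>i\<in>{k..n}. ?t i = ?t n)" unfolding points_split(1) by auto
  finally show ?thesis unfolding equal_slopes_iff .
qed

end

section \<open>Critical submanifolds of the level function and the theorem\<close>

lemma is_chart_restrict:
  assumes "is_chart n X (U, \<phi>)" "openin X V" "V \<subseteq> U"
  shows "is_chart n X (V, \<phi>)"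
proof -
  have U: "openin X U" "openin (Euclidean_space n) (\<phi> ` U)"
    and h: "homeomorphic_map (subtopology X U) (subtopology (Euclidean_space n) (\<phi> ` U)) \<phi>"
    using assms(1) by (auto simp: is_chart_def)
  have "openin (subtopology X U) V" using assms(2,3) by (metis openin_subtopology_Int2 Int_absorb1)
  then have "openin (subtopology (Euclidean_space n) (\<phi> ` U)) (\<phi> ` V)"
    using homeomorphic_imp_open_map[OF h] by (auto simp: open_map_def)
  then have oV: "openin (Euclidean_space n) (\<phi> ` V)" using U(2) openin_trans_full by blast
  have "homeomorphic_map (subtopology (subtopology X U) V) (subtopology (subtopology (Euclidean_space n) (\<phi> ` U)) (\<phi> ` V)) \<phi>"
    by (rule homeomorphic_map_subtopologies[OF h])
       (use openin_subset[OF assms(2)] openin_subset[OF oV] assms(3) in auto)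
  then show ?thesis using assms(2,3) oV
    by (auto simp: is_chart_def subtopology_subtopology Int_absorb1 image_mono)
qed

lemma translate_inverse:
  "x \<in> topspace (Euclidean_space n) \<Longrightarrow> translate n (\<lambda>i. - c i) (translate n c x) = x"
  by (auto simp: translate_def topspace_Euclidean_space)

lemma C_diff_translate:
  assumes "C_diff n r W f" "W \<subseteq> topspace (Euclidean_space n)"
  shows "C_diff n r (translate n c ` W) (\<lambda>x. f (translate n (\<lambda>i. - c i) x))"
  using assms(1)
proof (induction r arbitrary: f)
  have cont: "continuous_map (subtopology (Euclidean_space n) (translate n c ` W)) euclideanreal (\<lambda>x. f (translate n (\<lambda>i. - c i) x))"
    if f: "continuous_map (subtopology (Euclidean_space n) W) euclideanreal f" for f
  proof -
    have "continuous_map (subtopology (Euclidean_space n) (translate n c ` W)) (Euclidean_space n) (translate n (\<lambda>i. - c i))"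
      by (intro continuous_map_from_subtopology homeomorphic_imp_continuous_map homeomorphic_translate)
    moreover have "translate n (\<lambda>i. - c i) ` (translate n c ` W) \<subseteq> W"
      using assms(2) translate_inverse by (auto simp: subset_iff)
    ultimately have "continuous_map (subtopology (Euclidean_space n) (translate n c ` W)) (subtopology (Euclidean_space n) W) (translate n (\<lambda>i. - c i))"
      by (auto simp: continuous_map_in_subtopology)
    from continuous_map_compose[OF this f] show ?thesis by (simp add: o_def)
  qed
  {
    case 0
    then show ?case using cont by simp
  next
    case (Suc r)
    have "\<exists>g. (\<forall>x\<in>translate n c ` W. ((\<lambda>t. f (translate n (\<lambda>i. - c i) (x(i := t)))) has_real_derivative g x) (at (x i))) \<and>
        C_diff n r (translate n c ` W) g" if i: "i < n" for i
    proof -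
      obtain g where g: "\<forall>x\<in>W. ((\<lambda>t. f (x(i := t))) has_real_derivative g x) (at (x i))" "C_diff n r W g"
        using Suc.prems i by auto
      have D: "((\<lambda>t. f (translate n (\<lambda>i. - c i) (x(i := t)))) has_real_derivative g (translate n (\<lambda>i. - c i) x)) (at (x i))"
        if x: "x \<in> translate n c ` W" for x
      proof -
        obtain y where y: "y \<in> W" "x = translate n c y" using x by blast
        have tx: "translate n (\<lambda>i. - c i) x = y" using y assms(2) translate_inverse by blast
        have upd: "translate n (\<lambda>i. - c i) (x(i := t)) = y(i := t + - c i)" for t
          using i unfolding tx[symmetric] by (auto simp: translate_def)
        have xi: "x i + - c i = y i" using i y(2) by (simp add: translate_def)
        have "((\<lambda>t. f (y(i := t))) has_real_derivative g y) (at (x i + - c i))" using g(1) y(1) xi by simp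
        then have "((\<lambda>t. f (y(i := t + - c i))) has_real_derivative g y) (at (x i))"
          unfolding DERIV_shift .
        then show ?thesis unfolding upd tx .
      qed
      show ?thesis
        by (rule exI, rule conjI, rule ballI, erule D, rule Suc.IH[OF g(2)])
    qed
    then show ?case using cont Suc.prems by simp
  }
qed

lemma C_diff_add_const:
  assumes "C_diff n r W f" shows "C_diff n r W (\<lambda>x. f x + c)"
proof -
  have cont: "continuous_map (subtopology (Euclidean_space n) W) euclideanreal (\<lambda>x. f x + c)"
    if "continuous_map (subtopology (Euclidean_space n) W) euclideanreal f"
    using that by (intro continuous_map_add) auto
  show ?thesis
  proof (cases r)
    case 0
    then show ?thesis using assms cont by simp
  next
    case (Suc s)
    have "\<exists>g. (\<forall>x\<in>W. ((\<lambda>t. f (x(i := t)) + c) has_real_derivative g x) (at (x i))) \<and> C_diff n s W g" if i: "i < n" for i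
    proof -
      obtain g where g: "\<forall>x\<in>W. ((\<lambda>t. f (x(i := t))) has_real_derivative g x) (at (x i))" "C_diff n s W g"
        using assms Suc i by auto
      have D: "((\<lambda>t. f (x(i := t)) + c) has_real_derivative g x) (at (x i))" if "x \<in> W" for x
      proof -
        have "((\<lambda>t. f (x(i := t))) has_real_derivative g x) (at (x i))" using g(1) that by blast
        from DERIV_add[OF this DERIV_const[of c]] show ?thesis by simp
      qed
      show ?thesis by (rule exI, rule conjI, rule ballI, erule D, rule g(2))
    qed
    then show ?thesis using assms cont Suc by simp
  qed
qed

text \<open>
  A slice has to lie in \<open>R^k\<close>, where the coordinates from \<open>k\<close> on vanish. Charts of the atlas give these
  coordinates the value of an angle of the point, so they have to be translated.
\<close>

lemma translated_chart_in_maximal_atlas: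
  assumes U: "(U, \<phi>) \<in> torus_atlas n"
  shows "(U, translate n c \<circ> \<phi>) \<in> maximal_atlas n (torus n) (torus_atlas n)"
proof -
  let ?\<psi> = "translate n c \<circ> \<phi>"
  have ch: "is_chart n (torus n) (U, \<phi>)" using U by (auto simp: torus_atlas_def)
  note tc = torus_chart[OF U]
  have sub: "\<phi> ` U \<subseteq> topspace (Euclidean_space n)" using openin_subset[OF tc(2)] .
  have inj: "inj_on ?\<psi> U"
  proof (rule inj_onI)
    fix a b assume ab: "a \<in> U" "b \<in> U" "?\<psi> a = ?\<psi> b"
    have "translate n (\<lambda>i. - c i) (?\<psi> a) = \<phi> a" "translate n (\<lambda>i. - c i) (?\<psi> b) = \<phi> b"
      using ab(1,2) sub translate_inverse by (auto simp: image_subset_iff)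
    then show "a = b" using ab tc(3) by (metis inj_onD)
  qed
  have inv: "inv_into U ?\<psi> x = inv_into U \<phi> (translate n (\<lambda>i. - c i) x)" if "x \<in> ?\<psi> ` U" for x
  proof -
    obtain w where w: "w \<in> U" "x = ?\<psi> w" using \<open>x \<in> ?\<psi> ` U\<close> by blast
    have "translate n (\<lambda>i. - c i) x = \<phi> w" using w sub translate_inverse by (auto simp: image_subset_iff)
    then show ?thesis using w tc(3) inv_into_f_f[OF inj w(1)] by simp
  qed
  have open_inter: "openin (Euclidean_space n) (\<rho> ` (A \<inter> B))"
    if A: "is_chart n (torus n) (A, \<rho>)" and B: "openin (torus n) B" for A B :: "(nat \<Rightarrow> complex) set" and \<rho>
  proof -
    have "is_chart n (torus n) (A \<inter> B, \<rho>)"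
      by (rule is_chart_restrict[OF A]) (use A B in \<open>auto simp: is_chart_def\<close>)
    then show ?thesis by (simp add: is_chart_def)
  qed
  have "smooth_transition n (U, ?\<psi>) (V, \<rho>) \<and> smooth_transition n (V, \<rho>) (U, ?\<psi>)"
    if V: "(V, \<rho>) \<in> torus_atlas n" for V \<rho>
  proof
    have oV: "openin (torus n) V" by (rule torus_chart(1)[OF V])
    have chV: "is_chart n (torus n) (V, \<rho>)" using V by (auto simp: torus_atlas_def)
    show "smooth_transition n (U, ?\<psi>) (V, \<rho>)"
      unfolding smooth_transition_def C_infinity_def prod.case
    proof (intro allI impI)
      fix i r assume i: "i < n"
      have "C_diff n r (\<phi> ` (U \<inter> V)) (\<lambda>x. \<rho> (inv_into U \<phi> x) i)"
        using torus_transitions_smooth[OF U V] i by (simp add: smooth_transition_def C_infinity_def)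
      then have "C_diff n r (translate n c ` \<phi> ` (U \<inter> V)) (\<lambda>x. \<rho> (inv_into U \<phi> (translate n (\<lambda>i. - c i) x)) i)"
        using sub by (intro C_diff_translate) auto
      then show "C_diff n r (?\<psi> ` (U \<inter> V)) (\<lambda>x. \<rho> (inv_into U ?\<psi> x) i)"
        unfolding image_comp
      proof (rule C_diff_cong[rotated])
        show "openin (Euclidean_space n) (?\<psi> ` (U \<inter> V))" by (rule open_inter[OF is_chart_translate[OF ch] oV])
        show "\<rho> (inv_into U \<phi> (translate n (\<lambda>i. - c i) x)) i = \<rho> (inv_into U ?\<psi> x) i" if "x \<in> ?\<psi> ` (U \<inter> V)" for x
        proof -
          have "x \<in> ?\<psi> ` U" using that by blast
          then show ?thesis by (simp only: inv)
        qed
      qed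
    qed
    show "smooth_transition n (V, \<rho>) (U, ?\<psi>)"
      unfolding smooth_transition_def C_infinity_def prod.case
    proof (intro allI impI)
      fix i r assume i: "i < n"
      have "C_diff n r (\<rho> ` (V \<inter> U)) (\<lambda>x. \<phi> (inv_into V \<rho> x) i)"
        using torus_transitions_smooth[OF V U] i by (simp add: smooth_transition_def C_infinity_def)
      from C_diff_add_const[OF this, of "c i"]
      show "C_diff n r (\<rho> ` (V \<inter> U)) (\<lambda>x. ?\<psi> (inv_into V \<rho> x) i)"
        using i by (simp add: translate_def)
    qed
  qed
  then show ?thesis using is_chart_translate[OF ch] by (auto simp: maximal_atlas_def)
qed

definition coordinate_torus :: "nat \<Rightarrow> nat \<Rightarrow> real \<Rightarrow> (nat \<Rightarrow> complex) set" where
  "coordinate_torus n k c = {w \<in> topspace (torus n). \<forall>i\<in>{k..<n}. w i = cis c}"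

text \<open>
  On a chart domain on which all coordinates vary by less than \<open>\<pi>\<close>, a point with the prescribed
  last coordinates on the torus has the prescribed angles, not only up to \<open>2\<pi>\<close>.
\<close>

lemma coordinate_torus_submanifold:
  assumes "k \<le> n" shows "smooth_submanifold n (torus n) (torus_atlas n) k (coordinate_torus n k c)"
  unfolding smooth_submanifold_def
proof (intro conjI ballI)
  show "k \<le> n" by (rule assms)
  show "coordinate_torus n k c \<subseteq> topspace (torus n)" by (auto simp: coordinate_torus_def)
  fix w assume w: "w \<in> coordinate_torus n k c"
  then have wt: "w \<in> topspace (torus n)" by (simp add: coordinate_torus_def)
  define x where "x = (\<lambda>i. if i < k then Arg (w i) else if i < n then c else 0)"
  have xE: "x \<in> topspace (Euclidean_space n)" using assms by (simp add: x_def topspace_Euclidean_space)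
  have ex: "torus_exp n x = w"
  proof (rule torus_exp_eqI[OF wt])
    fix i assume i: "i < n"
    have "cmod (w i) = 1" using wt i by (auto simp: topspace_torus PiE_def Pi_iff)
    then show "cis (x i) = w i" using w i by (auto simp: x_def cis_Arg_unit coordinate_torus_def)
  qed
  obtain U \<phi> where U: "(U, \<phi>) \<in> torus_atlas n" "torus_exp n x \<in> U" "\<phi> (torus_exp n x) = x"
    using torus_chart_at[OF xE] by blast
  note tc = torus_chart[OF U(1)]
  define V where "V = {z \<in> U. near n pi x (\<phi> z)}"
  have oV: "openin (torus n) V"
    using openin_chart_box[of n "torus n" U \<phi> x pi] U(1) by (simp add: V_def torus_atlas_def)
  have VU: "V \<subseteq> U" by (auto simp: V_def)
  have "is_chart n (torus n) (V, \<phi>)"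
    by (rule is_chart_restrict[OF _ oV VU]) (use U(1) in \<open>auto simp: torus_atlas_def\<close>)
  then have V: "(V, \<phi>) \<in> torus_atlas n" using U(1) VU by (auto simp: torus_atlas_def)
  define s where "s = (\<lambda>i. if k \<le> i then - c else 0)"
  let ?\<psi> = "translate n s \<circ> \<phi>"
  have slice: "z \<in> coordinate_torus n k c \<longleftrightarrow> ?\<psi> z \<in> topspace (Euclidean_space k)" if z: "z \<in> V" for z
  proof -
    have zt: "z \<in> topspace (torus n)" using openin_subset[OF oV] z by blast
    have cz: "cis (\<phi> z i) = z i" if "i < n" for i
      using V z that by (auto simp: torus_atlas_def)
    have one: "z i = cis c \<longleftrightarrow> ?\<psi> z i = 0" if i: "i \<in> {k..<n}" for i
    proof -
      have "\<bar>x i - \<phi> z i\<bar> < pi" using z i by (auto simp: V_def)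
      then have close: "\<bar>\<phi> z i - c\<bar> < pi" using i by (auto simp: x_def)
      have "z i = cis c \<longleftrightarrow> cis (\<phi> z i) = cis c" using cz i by auto
      also have "\<dots> \<longleftrightarrow> \<phi> z i = c"
      proof
        assume "cis (\<phi> z i) = cis c"
        then obtain m :: int where m: "\<phi> z i - c = 2 * pi * of_int m" unfolding cis_eq_cis_iff by blast
        then have "pi * (2 * \<bar>real_of_int m\<bar>) < pi * 1" using close by (simp add: abs_mult)
        then have "2 * \<bar>real_of_int m\<bar> < 1" by (simp only: mult_less_cancel_left_pos[OF pi_gt_zero])
        then have "m = 0" by linarith
        then show "\<phi> z i = c" using m by simp
      qed simp
      also have "\<dots> \<longleftrightarrow> ?\<psi> z i = 0" using i by (simp add: translate_def s_def)
      finally show ?thesis .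
    qed
    have zero: "?\<psi> z i = 0" if "i \<ge> n" for i using that by (simp add: translate_def)
    have "z \<in> coordinate_torus n k c \<longleftrightarrow> (\<forall>i\<in>{k..<n}. ?\<psi> z i = 0)"
      using zt one by (simp add: coordinate_torus_def)
    also have "\<dots> \<longleftrightarrow> ?\<psi> z \<in> topspace (Euclidean_space k)"
      unfolding topspace_Euclidean_space mem_Collect_eq using zero by (meson atLeastLessThan_iff not_le)
    finally show ?thesis .
  qed
  have "w \<in> V" using U(2,3) pi_gt_zero unfolding ex V_def by simp
  moreover have "?\<psi> ` (V \<inter> coordinate_torus n k c) = ?\<psi> ` V \<inter> topspace (Euclidean_space k)"
    using slice by blast
  ultimately show "\<exists>(U, \<phi>)\<in>maximal_atlas n (torus n) (torus_atlas n).
      w \<in> U \<and> \<phi> ` (U \<inter> coordinate_torus n k c) = \<phi> ` U \<inter> topspace (Euclidean_space k)"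
    using translated_chart_in_maximal_atlas[OF V, of s] by blast
qed

lemma coordinate_torus_homeomorphic:
  assumes "k \<le> n" shows "subtopology (torus n) (coordinate_torus n k c) homeomorphic_space torus k"
proof -
  let ?X = "subtopology (torus n) (coordinate_torus n k c)"
  define r where "r = (\<lambda>w :: nat \<Rightarrow> complex. restrict w {..<k})"
  define s where "s = (\<lambda>z :: nat \<Rightarrow> complex. \<lambda>i. if i < k then z i else if i < n then cis c else undefined)"
  have sub: "coordinate_torus n k c \<subseteq> topspace (torus n)" by (auto simp: coordinate_torus_def)
  have cor: "continuous_map (torus n) circle (\<lambda>w. w i)" if "i < n" for i n
    using continuous_map_product_projection[of i "{..<n}" "\<lambda>_. circle"] that by (simp add: torus_def)
  have "continuous_map ?X (torus k) r"
  proof -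
    have "continuous_map (torus n) circle (\<lambda>w. r w i)" if "i < k" for i
      using cor[of i n] that assms by (simp add: r_def)
    then have "continuous_map (torus n) (torus k) r"
      unfolding torus_def[of k] continuous_map_componentwise by (auto simp: r_def)
    then show ?thesis by (rule continuous_map_from_subtopology)
  qed
  moreover have "continuous_map (torus k) ?X s"
  proof -
    have "continuous_map (torus k) circle (\<lambda>z. s z i)" if "i < n" for i
      using cor[of i k] that by (cases "i < k") (auto simp: s_def)
    then have "continuous_map (torus k) (torus n) s"
      unfolding torus_def[of n] continuous_map_componentwise using assms by (auto simp: s_def extensional_def)
    moreover have "s ` topspace (torus k) \<subseteq> coordinate_torus n k c"
      using assms by (auto simp: coordinate_torus_def s_def topspace_torus PiE_def Pi_iff extensional_def)
    ultimately show ?thesis by (auto simp: continuous_map_in_subtopology)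
  qed
  moreover have "s (r w) = w" if "w \<in> coordinate_torus n k c" for w
    using that by (auto simp: coordinate_torus_def s_def r_def fun_eq_iff topspace_torus PiE_def extensional_def)
  moreover have "r (s z) = z" if "z \<in> topspace (torus k)" for z
    using that by (auto simp: s_def r_def fun_eq_iff topspace_torus PiE_def extensional_def)
  ultimately have "homeomorphic_maps ?X (torus k) r s"
    using sub by (auto simp: homeomorphic_maps_def)
  then show ?thesis by (auto simp: homeomorphic_space_def)
qed

lemma closedin_coordinate_torus: "closedin (torus n) (coordinate_torus n k c)"
proof -
  have "closedin (torus n) {w \<in> topspace (torus n). w i \<in> {cis c}}" if "i \<in> {k..<n}" for i
    by (rule closedin_continuous_map_preimage[OF continuous_map_torus_coordinate]) (use that in auto)
  then have "closedin (torus n) (topspace (torus n) \<inter> \<Inter>((\<lambda>i. {w \<in> topspace (torus n). w i \<in> {cis c}}) ` {k..<n}))"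
    by (cases "{k..<n} = {}") (auto intro!: closedin_Int closedin_Inter)
  also have "\<dots> = coordinate_torus n k c" by (auto simp: coordinate_torus_def)
  finally show ?thesis .
qed

text \<open>
  The critical levels are \<open>(1/2 + j)/N\<close> for \<open>j < N\<close>. If \<open>k < n\<close>, the pieces are disjoint because a coordinate
  determines the level; for \<open>k = n\<close> the function is constant and there is a single piece, the whole torus.
\<close>

theorem minimal_function_exists:
  assumes kn: "k \<le> n"
  shows "\<exists>F. P_function n (torus n) (torus_atlas n) (torus k) F \<and>
    has_critical_submanifolds n (torus n) (torus_atlas n) (torus k) F (n - k + 1)"
proof -
  obtain H H1 where "profile H H1" using concave_profile unfolding profile_def by blast
  then interpret level_function H H1 n k
    unfolding level_function_def level_function_axioms_def using kn by blast
  define F where "F = (\<lambda>w :: nat \<Rightarrow> complex. level (\<lambda>i. Arg (w i)))"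
  have F_exp: "F (torus_exp n y) = level y" for y
  proof -
    have "torus_exp n (\<lambda>i. Arg (torus_exp n y i)) = torus_exp n (\<lambda>i. if i < n then Arg (torus_exp n y i) else 0)"
      by (rule torus_exp_cong) simp
    also have "\<dots> = torus_exp n y" by (rule torus_exp_surj[OF torus_exp_in])
    finally show ?thesis unfolding F_def by (rule level_cong)
  qed
  have smooth: "smooth_function n (torus_atlas n) F"
    unfolding smooth_function_def C_infinity_def
  proof (intro ballI, clarify)
    fix U \<phi> r assume U: "(U, \<phi>) \<in> torus_atlas n"
    have "C_diff n r (\<phi> ` U) level"
      by (rule C_diff_subset[of n r "topspace (Euclidean_space n)"])
         (use C_infinity_level openin_subset[OF torus_chart(2)[OF U]] in \<open>auto simp: C_infinity_def\<close>)
    then show "C_diff n r (\<phi> ` U) (\<lambda>x. F (inv_into U \<phi> x))"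
      by (rule C_diff_cong[OF torus_chart(2)[OF U]]) (simp only: torus_chart(6)[OF U] F_exp)
  qed
  interpret sf: smooth_on_torus n F by unfold_locales (rule smooth)
  let ?crit = "critical_set n (torus n) (torus_atlas n) F"
  have crit_exp: "torus_exp n x \<in> ?crit \<longleftrightarrow> (\<exists>j\<le>n - k. \<forall>i\<in>{k..<n}. frac (x i / (2 * pi)) = crit_level j)" for x
  proof -
    obtain M where M: "x \<in> region M" using in_some_region by blast
    have B: "smooth_balance_u M x (level x) \<noteq> 0" using region_eqs(3)[OF M level(1,2), of x] sum_\<Theta>u_neg[OF level(1,2), of x x] by simp
    have "sf.p l x = - (\<Sum>i\<in>{k..n}. turn_deriv l i * smooth_slope M i x (level x)) / smooth_balance_u M x (level x)" if "l < n" for l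
      unfolding sf.p_def sf.G_def F_exp by (rule DERIV_imp_deriv[OF level_partial[OF M that]])
    then have "(\<forall>l<n. sf.p l x = 0) \<longleftrightarrow> (\<forall>l<n. (\<Sum>i\<in>{k..n}. turn_deriv l i * smooth_slope M i x (level x)) = 0)"
      using B by auto
    then show ?thesis unfolding sf.critical_set_iff critical_lift_iff[OF M] .
  qed
  define piece where "piece = (\<lambda>j. coordinate_torus n k (2 * pi * crit_level j))"
  have fr: "frac (t / (2 * pi)) = crit_level j \<longleftrightarrow> cis t = cis (2 * pi * crit_level j)" if "j \<le> n - k" for t j
  proof -
    have c: "0 \<le> crit_level j" "crit_level j < 1" using crit_level_bounds[OF that] by auto
    have "frac (t / (2 * pi)) = crit_level j \<longleftrightarrow> t / (2 * pi) - crit_level j \<in> \<int>"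
      unfolding frac_unique_iff using c by auto
    also have "\<dots> \<longleftrightarrow> (\<exists>m::int. t / (2 * pi) - crit_level j = of_int m)" by (auto elim: Ints_cases)
    also have "\<dots> \<longleftrightarrow> (\<exists>m::int. t - 2 * pi * crit_level j = 2 * pi * of_int m)"
      by (intro ex_cong1) (auto simp: field_simps)
    finally show ?thesis unfolding cis_eq_cis_iff .
  qed
  have crit: "?crit = (\<Union>j\<in>{..n - k}. piece j)"
  proof (rule set_eqI)
    fix w
    show "w \<in> ?crit \<longleftrightarrow> w \<in> (\<Union>j\<in>{..n - k}. piece j)"
    proof (cases "w \<in> topspace (torus n)")
      case False
      then show ?thesis by (auto simp: critical_set_def piece_def coordinate_torus_def)
    next
      case True
      define x where "x = (\<lambda>i. if i < n then Arg (w i) else 0)"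
      have x: "torus_exp n x = w" unfolding x_def by (rule torus_exp_surj[OF True])
      have wi: "w i = cis (x i)" if "i < n" for i using x that by (metis torus_exp_apply)
      have "w \<in> ?crit \<longleftrightarrow> (\<exists>j\<le>n - k. \<forall>i\<in>{k..<n}. frac (x i / (2 * pi)) = crit_level j)"
        using crit_exp[of x] x by simp
      also have "\<dots> \<longleftrightarrow> (\<exists>j\<le>n - k. \<forall>i\<in>{k..<n}. w i = cis (2 * pi * crit_level j))"
        using fr wi by auto
      also have "\<dots> \<longleftrightarrow> w \<in> (\<Union>j\<in>{..n - k}. piece j)" using True by (auto simp: piece_def coordinate_torus_def)
      finally show ?thesis .
    qed
  qed
  have nonempty: "piece j \<noteq> {}" for j
  proof -
    have "torus_exp n (\<lambda>_. 2 * pi * crit_level j) \<in> piece j"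
      by (simp add: piece_def coordinate_torus_def torus_exp_in torus_exp_apply)
    then show ?thesis by blast
  qed
  have disj: "i = j" if ij: "i \<le> n - k" "j \<le> n - k" and w: "w \<in> piece i" "w \<in> piece j" for i j w
  proof (cases "k = n")
    case True
    then show ?thesis using ij by simp
  next
    case False
    then have "k \<in> {k..<n}" using kn by auto
    then have "cis (2 * pi * crit_level i) = cis (2 * pi * crit_level j)"
      using w unfolding piece_def coordinate_torus_def by force
    then have "frac (2 * pi * crit_level i / (2 * pi)) = crit_level j" using fr[OF ij(2)] by blast
    moreover have "frac (2 * pi * crit_level i / (2 * pi)) = crit_level i" using fr[OF ij(1)] by blast
    ultimately have "crit_level i = crit_level j" by simp
    then show ?thesis by (simp add: crit_level_def)
  qed
  define \<S> where "\<S> = piece ` {..n - k}"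
  have inj: "inj_on piece {..n - k}"
  proof (rule inj_onI)
    fix i j assume "i \<in> {..n - k}" "j \<in> {..n - k}" "piece i = piece j"
    then show "i = j" using disj nonempty[of i] by auto
  qed
  have "critical_submanifolds n (torus n) (torus_atlas n) (torus k) F \<S>"
    unfolding critical_submanifolds_def
  proof (intro conjI ballI)
    show "\<Union>\<S> = ?crit" by (simp add: \<S>_def crit)
    show "disjoint \<S>" unfolding \<S>_def disjoint_def using disj by fastforce
    fix A assume "A \<in> \<S>"
    then obtain j where j: "j \<le> n - k" "A = piece j" by (auto simp: \<S>_def)
    show "\<exists>d. smooth_submanifold n (torus n) (torus_atlas n) d A"
      using coordinate_torus_submanifold[OF kn] j(2) unfolding piece_def by blast
    show "subtopology (torus n) A homeomorphic_space torus k"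
      using coordinate_torus_homeomorphic[OF kn] j(2) unfolding piece_def by blast
    have "closedin (torus n) (\<Union>i\<in>{..n - k} - {j}. piece i)"
      unfolding piece_def by (intro closedin_Union) (auto intro: closedin_coordinate_torus)
    then have "openin (subtopology (torus n) ?crit) (?crit \<inter> (topspace (torus n) - (\<Union>i\<in>{..n - k} - {j}. piece i)))"
      by (intro openin_subtopology_Int2 openin_diff) auto
    moreover have "?crit \<inter> (topspace (torus n) - (\<Union>i\<in>{..n - k} - {j}. piece i)) = A"
    proof (rule set_eqI, rule iffI)
      fix w assume "w \<in> ?crit \<inter> (topspace (torus n) - (\<Union>i\<in>{..n - k} - {j}. piece i))"
      then show "w \<in> A" unfolding crit j(2) by blast
    next
      fix w assume w: "w \<in> A"
      then have "w \<in> topspace (torus n)" "w \<in> ?crit" using j unfolding crit by (auto simp: piece_def coordinate_torus_def)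
      moreover have "w \<notin> piece i" if "i \<in> {..n - k} - {j}" for i
        using disj[of i j w] that w j by auto
      ultimately show "w \<in> ?crit \<inter> (topspace (torus n) - (\<Union>i\<in>{..n - k} - {j}. piece i))" by blast
    qed
    ultimately show "openin (subtopology (torus n) ?crit) A" by simp
  qed
  moreover have "finite \<S>" "card \<S> = n - k + 1" using inj by (auto simp: \<S>_def card_image)
  ultimately show ?thesis using smooth unfolding P_function_def has_critical_submanifolds_def by blast
qed

lemma circle_homeomorphic_torus_1: "circle homeomorphic_space torus 1"
proof -
  define r where "r = (\<lambda>z :: complex. restrict (\<lambda>_. z) {..<1::nat})"
  have "continuous_map circle (torus 1) r"
    unfolding torus_def continuous_map_componentwise by (auto simp: r_def)
  moreover have "continuous_map (torus 1) circle (\<lambda>w. w 0)"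
    unfolding torus_def by (rule continuous_map_product_projection) simp
  ultimately have "homeomorphic_maps circle (torus 1) r (\<lambda>w. w 0)"
    by (auto simp: homeomorphic_maps_def r_def topspace_torus PiE_def extensional_def fun_eq_iff)
  then show ?thesis by (auto simp: homeomorphic_space_def)
qed

lemma critical_submanifolds_circle:
  "critical_submanifolds n X A circle f \<S> \<longleftrightarrow> critical_submanifolds n X A (torus 1) f \<S>"
proof -
  have eq: "Y homeomorphic_space circle \<longleftrightarrow> Y homeomorphic_space torus 1" for Y :: "'a topology"
    by (metis circle_homeomorphic_torus_1 homeomorphic_space_trans homeomorphic_space_sym)
  show ?thesis unfolding critical_submanifolds_def eq by (rule refl)
qed

lemma exact_function_exists:
  assumes "k \<le> n"
  shows "\<exists>f. exact_P_function n (torus n) (torus_atlas n) (torus k) f \<and>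
    has_critical_submanifolds n (torus n) (torus_atlas n) (torus k) f (n - k + 1)"
proof -
  obtain F where F: "P_function n (torus n) (torus_atlas n) (torus k) F"
    "has_critical_submanifolds n (torus n) (torus_atlas n) (torus k) F (n - k + 1)"
    using minimal_function_exists[OF assms] by blast
  have "n - k + 1 \<le> m'"
    if g: "P_function n (torus n) (torus_atlas n) (torus k) g"
      and m': "has_critical_submanifolds n (torus n) (torus_atlas n) (torus k) g m'" for g m'
  proof -
    obtain \<S> where "critical_submanifolds n (torus n) (torus_atlas n) (torus k) g \<S>" "finite \<S>" "card \<S> = m'"
      using m' unfolding has_critical_submanifolds_def by blast
    then have "n + 1 \<le> m' + k"
      using critical_submanifolds_lower_bound[of n g k \<S>] g unfolding P_function_def by auto
    then show ?thesis using assms by simp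
  qed
  then show ?thesis using F unfolding exact_P_function_def by blast
qed

theorem corollary2p16:
  fixes n k :: nat
  shows
    "(k \<le> n \<longrightarrow>
       (\<exists>f. exact_P_function n (torus n) (torus_atlas n) (torus k) f \<and>
            has_critical_submanifolds n (torus n) (torus_atlas n) (torus k) f (n - k + 1))) \<and>
     (1 \<le> n \<longrightarrow>
       (\<exists>f. exact_round_function n (torus n) (torus_atlas n) f) \<and>
       (\<forall>f. exact_round_function n (torus n) (torus_atlas n) f \<longrightarrow>
            has_critical_submanifolds n (torus n) (torus_atlas n) circle f n))"
proof (intro conjI impI)
  show "\<exists>f. exact_P_function n (torus n) (torus_atlas n) (torus k) f \<and>
      has_critical_submanifolds n (torus n) (torus_atlas n) (torus k) f (n - k + 1)" if "k \<le> n"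
    by (rule exact_function_exists[OF that])
next
  assume n: "1 \<le> n"
  have has: "has_critical_submanifolds n (torus n) (torus_atlas n) circle =
      has_critical_submanifolds n (torus n) (torus_atlas n) (torus 1)"
    by (simp add: has_critical_submanifolds_def critical_submanifolds_circle fun_eq_iff)
  have P: "P_function n (torus n) (torus_atlas n) circle = P_function n (torus n) (torus_atlas n) (torus 1)"
    by (simp add: P_function_def critical_submanifolds_circle fun_eq_iff)
  have exact: "exact_P_function n (torus n) (torus_atlas n) circle = exact_P_function n (torus n) (torus_atlas n) (torus 1)"
    by (simp add: exact_P_function_def has P fun_eq_iff)
  obtain F where F: "exact_P_function n (torus n) (torus_atlas n) (torus 1) F"
    "has_critical_submanifolds n (torus n) (torus_atlas n) (torus 1) F n"
    using exact_function_exists[OF n] n by auto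
  show "\<exists>f. exact_round_function n (torus n) (torus_atlas n) f" unfolding exact using F(1) by blast
  show "\<forall>f. exact_round_function n (torus n) (torus_atlas n) f \<longrightarrow>
      has_critical_submanifolds n (torus n) (torus_atlas n) circle f n"
    unfolding exact has
  proof (intro allI impI)
    fix f assume f: "exact_P_function n (torus n) (torus_atlas n) (torus 1) f"
    obtain m where m: "has_critical_submanifolds n (torus n) (torus_atlas n) (torus 1) f m"
      "\<And>g m'. P_function n (torus n) (torus_atlas n) (torus 1) g \<Longrightarrow>
         has_critical_submanifolds n (torus n) (torus_atlas n) (torus 1) g m' \<Longrightarrow> m \<le> m'"
      using f unfolding exact_P_function_def by blast
    have "m \<le> n" using m(2)[OF _ F(2)] F(1) unfolding exact_P_function_def by blast
    moreover have "n \<le> m"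
    proof -
      obtain \<S> where "critical_submanifolds n (torus n) (torus_atlas n) (torus 1) f \<S>" "finite \<S>" "card \<S> = m"
        using m(1) unfolding has_critical_submanifolds_def by blast
      then show ?thesis
        using critical_submanifolds_lower_bound[of n f 1 \<S>] f unfolding exact_P_function_def P_function_def by auto
    qed
    ultimately show "has_critical_submanifolds n (torus n) (torus_atlas n) (torus 1) f n" using m(1) by simp
  qed
qed

end
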